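(* If $1<p<\infty$, then $$\|\mathcal{B}:L^{p,2}\to F^{p,2}_0\|\le C(n)\max\{\sqrt p,\sqrt{p'}\},$$ where $C(n)$ depends only on $n$ (not on $p$). This estimate is sharp: neither the exponent $1/2$ of $p$ nor the exponent $1/2$ of $p'$ can be replaced by a smaller one (with a constant independent of $p\in(1,\infty)$).
   Context: $\mathbb{B}$ is the open unit ball of $\mathbb{C}^n$, $n\ge1$, $\mathbb{S}=\partial\mathbb{B}$; $d\nu$ and $d\sigma$ are the normalized Lebesgue measures on $\mathbb{B}$ and $\mathbb{S}$; $z\overline w=\sum_j z_j\overline{w_j}$. $p'$ is the conjugate exponent of $p$. $L^{p,2}$ is the space of measurable functions $\varphi$ on $\mathbb{B}$ with $$\|\varphi\|_{L^{p,2}}^p=\int_{\mathbb{S}}\Big(\int_0^1|\varphi(r\zeta)|^2\frac{2nr^{2n-1}dr}{1-r^2}\Big)^{p/2}d\sigma(\zeta)<\infty.$$ $F^{p,2}_0$ is the space of holomorphic functions $f$ on $\mathbb{B}$ with $\|f\|_{F^{p,2}_0}=\big\|(1-|z|^2)\big(I+\frac Rn\big)f(z)\big\|_{L^{p,2}}<\infty$, where $I$ is the identity and $R=\sum_{j=1}^n z_j\frac{\partial}{\partial z_j}$. The Bergman operator is $\mathcal{B}(\varphi)(z)=\int_{\mathbb{B}}\frac{\varphi(w)}{(1-z\overline w)^{n+1}}d\nu(w)$, $z\in\mathbb{B}$. $\|\mathcal{B}:X\to Y\|$ denotes the operator norm. *)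

theory Defs
  imports "HOL-Probability.Probability"
begin

text \<open>
  \<open>\<complex>\<^sup>n\<close> is \<^typ>\<open>complex ^ 'n\<close> with \<open>n = CARD('n)\<close>; its norm is the Hermitian norm, so
  \<open>\<bbbB>\<close> is \<open>ball 0 1\<close> and \<open>\<bbbS>\<close> is \<open>sphere 0 1\<close>.
  Functions on the ball are total functions whose values outside the ball are never used.
\<close>

definition hprod :: "complex ^ 'n \<Rightarrow> complex ^ 'n \<Rightarrow> complex" where
  "hprod z w = (\<Sum>j\<in>UNIV. z $ j * cnj (w $ j))"

text \<open>Normalized Lebesgue measure on the ball, with the Lebesgue measurable subsets of the
  ball as its \<open>\<sigma>\<close>-algebra.\<close>

definition ball_measure :: "(complex ^ 'n) measure" where
  "ball_measure = uniform_measure (lebesgue_on (ball 0 1)) (ball 0 1)"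

text \<open>
  Normalized surface measure as the cone measure
  \<open>\<sigma>(A) = \<nu> {z \<in> \<bbbB>. z / \<bar>z\<bar> \<in> A}\<close>,
  i.e. the measure for which integration in polar coordinates reads
  \<open>\<integral>\<^sub>\<bbbB> f d\<nu> = \<integral>\<^sub>\<bbbS> \<integral>\<^sub>0\<^sup>1 f(r\<zeta>) 2n r\<^bsup>2n-1\<^esup> dr d\<sigma>(\<zeta>)\<close>.
  It is a Borel measure on all of \<open>\<complex>\<^sup>n\<close>, concentrated on the sphere; the origin, where
  \<^const>\<open>sgn\<close> is \<open>0\<close>, is \<open>\<nu>\<close>-null.
\<close>

definition sphere_measure :: "(complex ^ 'n) measure" where
  "sphere_measure = distr ball_measure borel sgn"

text \<open>Powers \<open>x\<^sup>a\<close> of extended nonnegative reals, for exponents \<open>a > 0\<close> only.\<close>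

definition epowr :: "ennreal \<Rightarrow> real \<Rightarrow> ennreal" where
  "epowr x a = (if x = \<infinity> then \<infinity> else ennreal (enn2real x powr a))"

definition Lp2_norm :: "real \<Rightarrow> (complex ^ 'n \<Rightarrow> complex) \<Rightarrow> ennreal" where
  "Lp2_norm p \<phi> =
     epowr (\<integral>\<^sup>+ \<zeta>. epowr
        (\<integral>\<^sup>+ r\<in>{0..<1}. ennreal ((cmod (\<phi> (r *\<^sub>R \<zeta>)))\<^sup>2
            * (2 * real CARD('n) * r ^ (2 * CARD('n) - 1) / (1 - r\<^sup>2))) \<partial>lborel)
        (p / 2) \<partial>sphere_measure) (1 / p)"

definition Lp2 :: "real \<Rightarrow> (complex ^ 'n \<Rightarrow> complex) set" where
  "Lp2 p = {\<phi>. \<phi> \<in> borel_measurable ball_measure \<and> Lp2_norm p \<phi> < \<infinity>}"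

text \<open>Holomorphy in several variables: the real Frechet derivative exists and is complex linear.\<close>

definition holomorphic_vec_on :: "(complex ^ 'n \<Rightarrow> complex) \<Rightarrow> (complex ^ 'n) set \<Rightarrow> bool" where
  "holomorphic_vec_on f U \<longleftrightarrow>
     (\<forall>z\<in>U. \<exists>f'. (f has_derivative f') (at z) \<and> (\<forall>c v. f' (c *s v) = c * f' v))"

definition partial_deriv :: "'n \<Rightarrow> (complex ^ 'n \<Rightarrow> complex) \<Rightarrow> complex ^ 'n \<Rightarrow> complex" where
  "partial_deriv j f z = deriv (\<lambda>t. f (\<chi> i. if i = j then t else z $ i)) (z $ j)"

definition radial_deriv :: "(complex ^ 'n \<Rightarrow> complex) \<Rightarrow> complex ^ 'n \<Rightarrow> complex" where
  "radial_deriv f z = (\<Sum>j\<in>UNIV. z $ j * partial_deriv j f z)"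

definition Fp2_norm :: "real \<Rightarrow> (complex ^ 'n \<Rightarrow> complex) \<Rightarrow> ennreal" where
  "Fp2_norm p f =
     Lp2_norm p (\<lambda>z. (1 - (norm z)\<^sup>2) *\<^sub>R (f z + radial_deriv f z / of_nat CARD('n)))"

definition Fp2 :: "real \<Rightarrow> (complex ^ 'n \<Rightarrow> complex) set" where
  "Fp2 p = {f. holomorphic_vec_on f (ball 0 1) \<and> Fp2_norm p f < \<infinity>}"

definition bergman_integrand ::
    "(complex ^ 'n \<Rightarrow> complex) \<Rightarrow> complex ^ 'n \<Rightarrow> complex ^ 'n \<Rightarrow> complex" where
  "bergman_integrand \<phi> z w = \<phi> w / (1 - hprod z w) ^ (CARD('n) + 1)"

definition bergman :: "(complex ^ 'n \<Rightarrow> complex) \<Rightarrow> complex ^ 'n \<Rightarrow> complex" where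
  "bergman \<phi> z = (\<integral>w. bergman_integrand \<phi> z w \<partial>ball_measure)"

text \<open>Operator norm of \<open>T : X \<rightarrow> Y\<close>, where \<open>NX\<close> and \<open>NY\<close> are the norms of \<open>X\<close> and \<open>Y\<close>;
  the value is \<open>\<infinity>\<close> if \<open>T\<close> is unbounded.\<close>

definition operator_norm ::
    "'a set \<Rightarrow> ('a \<Rightarrow> ennreal) \<Rightarrow> ('b \<Rightarrow> ennreal) \<Rightarrow> ('a \<Rightarrow> 'b) \<Rightarrow> ennreal" where
  "operator_norm X NX NY T = (SUP x\<in>{x \<in> X. NX x \<le> 1}. NY (T x))"

definition bergman_norm :: "'n::finite itself \<Rightarrow> real \<Rightarrow> ennreal" where
  "bergman_norm _ p = operator_norm (Lp2 p :: (complex ^ 'n \<Rightarrow> complex) set)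
     (Lp2_norm p) (Fp2_norm p) bergman"

definition conj_exp :: "real \<Rightarrow> real" where
  "conj_exp p = p / (p - 1)"

lemma prob_space_ball_measure: "prob_space (ball_measure :: (complex ^ 'n) measure)"
proof -
  have "emeasure (lebesgue_on (ball 0 1)) (ball 0 1 :: (complex ^ 'n) set) = emeasure lborel (ball 0 1 :: (complex ^ 'n) set)"
    by (simp add: emeasure_restrict_space)
  moreover have "emeasure lborel (ball 0 1 :: (complex ^ 'n) set) \<noteq> 0"
    using emeasure_lborel_ball_finite[of "0 :: complex ^ 'n" 1] content_ball_pos[of 1 "0 :: complex ^ 'n"]
    by (auto simp: measure_def)
  moreover have "emeasure lborel (ball 0 1 :: (complex ^ 'n) set) \<noteq> \<infinity>"
    using emeasure_lborel_ball_finite[of "0 :: complex ^ 'n" 1] by simp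
  ultimately show ?thesis
    unfolding ball_measure_def by (intro prob_space_uniform_measure) auto
qed

lemma sgn_measurable_ball_measure:
  "(sgn :: complex ^ 'n \<Rightarrow> complex ^ 'n) \<in> measurable ball_measure borel"
proof -
  have "(sgn :: complex ^ 'n \<Rightarrow> complex ^ 'n) \<in> borel_measurable (lebesgue_on (ball 0 1))"
    by (intro measurable_restrict_space1 measurable_completion) simp
  then show ?thesis
    by (simp add: ball_measure_def measurable_def)
qed

lemma prob_space_sphere_measure: "prob_space (sphere_measure :: (complex ^ 'n) measure)"
  unfolding sphere_measure_def
  by (rule prob_space.prob_space_distr[OF prob_space_ball_measure sgn_measurable_ball_measure])

end

theory Submission
  imports Defs
begin

text \<open>
  Let \<open>T \<phi> = (1 - \<bar>z\<bar>\<^sup>2) (I + R / n) \<B> \<phi>\<close>, so that the norm of \<open>\<B> \<phi>\<close> is the \<open>L\<^bsup>p,2\<^esup>\<close> norm of \<open>T \<phi>\<close>.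
  Differentiation under the integral turns the Bergman kernel into
  \<open>(1 + \<langle>z, w\<rangle> / n) / (1 - \<langle>z, w\<rangle>) ^ (n + 2)\<close> (\<open>bergman_radial_formula\<close>). In polar coordinates
  \<open>z = r \<zeta>\<close>, \<open>w = s \<eta>\<close> one has \<open>d\<nu> = (1 - s\<^sup>2) d\<mu>(s) d\<sigma>(\<eta>)\<close>, where
  \<open>d\<mu> = 2 n s\<^bsup>2n-1\<^esup> ds / (1 - s\<^sup>2)\<close> is the measure of the inner integral of \<open>L\<^bsup>p,2\<^esup>\<close>. Hence \<open>\<bar>T \<phi>\<bar>\<close> is at
  most twice the integral of \<open>\<bar>\<phi>\<bar>\<close> against the positive symmetric kernel
  \<open>k = (1 - r\<^sup>2) (1 - s\<^sup>2) / \<bar>1 - r s \<langle>\<zeta>, \<eta>\<rangle>\<bar> ^ (n + 2)\<close> with respect to \<open>\<sigma> \<times> \<mu>\<close>.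

  The upper estimate does not use any cancellation. If \<open>h\<close> is a function on the sphere, then the
  integral of \<open>k h\<close> at \<open>(\<zeta>, r)\<close> is at most a constant times the maximal function \<open>Mh(\<zeta>)\<close> over Koranyi caps
  (\<open>bergman_kernel_integral_le\<close>), and the norm of \<open>M\<close> on \<open>L\<^sup>q\<close> is \<open>O(q')\<close> (\<open>strong_type\<close>). Let \<open>p > 2\<close>,
  let \<open>F\<close> and \<open>G\<close> have norm one in \<open>L\<^bsup>p,2\<^esup>\<close> and in its dual \<open>L\<^bsup>p',2\<^esup>\<close>, and let \<open>g(\<zeta>)\<close> be the inner integral of
  \<open>G\<^sup>2\<close>. For any weight \<open>h\<close> on the sphere,
  \<open>2 F(y) G(x) \<le> F(y)\<^sup>2 h(x) + G(x)\<^sup>2 / h(x)\<close> bounds twice the pairing of the image of \<open>F\<close> with \<open>G\<close> by the integral of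
  \<open>F\<^sup>2 Mh + G\<^sup>2 / h\<close>, up to constants. Choose \<open>h = g powr ((2 - p') / 2) / \<surd>p\<close>. It lies in \<open>L\<^sup>q\<close> for
  \<open>q = (p / 2)'\<close>, where \<open>M\<close> costs \<open>q' = p / 2\<close>; so the first term is \<open>O(p / \<surd>p)\<close>, and the second is
  \<open>O(\<surd>p)\<close> (\<open>pairing_bound_gt2\<close>). The case \<open>p < 2\<close> follows by symmetry of \<open>k\<close>, and duality turns
  the bound for the pairing into one for the operator (\<open>kernel_op_bound\<close>, \<open>Fp2_norm_bergman_le\<close>).

  The sharpness rests on a region that reaches the boundary at a single point \<open>e\<^sub>j\<close> and
  meets every ray through the origin in a set of bounded \<open>\<mu>\<close>-measure, because the region is slanted against the rays
  (\<open>region_section_measure_le\<close>). So its indicator is bounded in every \<open>L\<^bsup>p,2\<^esup>\<close>. It is also so close to the axis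
  through \<open>e\<^sub>j\<close> that the real part of the kernel is at least half of its model
  \<open>(1 - r + depth w) powi (- n - 2)\<close> for all \<open>w\<close> in the region and \<open>z = r \<zeta>\<close> close to the axis (\<open>Re_kernel_ge\<close>).
  Integration over the region at depth comparable to \<open>1 - r\<close> shows that \<open>T\<close> maps the indicator to a function that
  is bounded below for \<open>\<zeta>\<close> in a cap of radius of order \<open>exp (- L)\<close> and \<open>r\<close> in an interval of \<open>\<mu>\<close>-measure of order \<open>L\<close>.
  With \<open>L = p\<close> the \<open>p\<close>-th root of the measure of the cap is bounded below, and the norm is at least
  of order \<open>\<surd>p\<close> (\<open>bergman_norm_ge_sqrt\<close>). For \<open>p \<le> 2\<close> exchange the two sets: the normalized indicator of the cap times the
  interval with \<open>L = p'\<close> is mapped to a function whose pairing with the indicator of the region is at least of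
  order \<open>\<surd>p'\<close> (\<open>bergman_norm_ge_sqrt_conj_exp\<close>). As \<open>p \<rightarrow> \<infinity>\<close> or \<open>p \<rightarrow> 1\<close> these lower bounds exceed every bound with
  a smaller exponent.
\<close>

section \<open>Powers of extended nonnegative reals\<close>

lemma epowr_ennreal: "0 \<le> x \<Longrightarrow> epowr (ennreal x) a = ennreal (x powr a)"
  by (simp add: epowr_def)

lemma epowr_top [simp]: "epowr top a = top"
  by (simp add: epowr_def)

lemma epowr_zero [simp]: "epowr 0 a = 0"
  by (simp add: epowr_def)

lemma epowr_one [simp]: "epowr x 1 = x"
  by (cases x) (simp_all add: epowr_def)

lemma epowr_one_left [simp]: "epowr 1 a = 1"
  by (simp add: epowr_def)

lemma epowr_measurable [measurable]: "(\<lambda>x. epowr x a) \<in> borel_measurable borel"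
  unfolding epowr_def by measurable

lemma epowr_mono: "0 \<le> a \<Longrightarrow> x \<le> y \<Longrightarrow> epowr x a \<le> epowr y a"
  by (cases x; cases y) (auto simp: epowr_def powr_mono2 top_unique)

lemma epowr_epowr: "epowr (epowr x a) b = epowr x (a * b)"
  by (cases x) (simp_all add: epowr_def powr_powr)

lemma epowr_add: "epowr x a * epowr x b = epowr x (a + b)"
  by (cases x) (simp_all add: epowr_def powr_add ennreal_mult)

lemma epowr_eq_0_iff [simp]: "epowr x a = 0 \<longleftrightarrow> x = 0"
  by (cases x) (auto simp: epowr_def ennreal_eq_0_iff not_le)

lemma epowr_mult: "epowr (x * y) a = epowr x a * epowr y a"
proof -
  have top_left: "epowr (top * z) a = epowr top a * epowr z a" for z
  proof (cases "z = 0")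
    case False
    then show ?thesis by (simp add: ennreal_top_mult)
  qed simp
  show ?thesis
  proof (cases x)
    case x: (real c)
    show ?thesis
    proof (cases y)
      case (real d)
      have "epowr (ennreal c * ennreal d) a = ennreal ((c * d) powr a)"
        using x real by (simp add: epowr_ennreal ennreal_mult[symmetric])
      then show ?thesis
        using x real by (simp add: powr_mult epowr_ennreal ennreal_mult)
    next
      case top
      then show ?thesis using top_left[of x] by (simp add: mult.commute)
    qed
  qed (use top_left in simp)
qed

lemma epowr_le_iff: "0 < a \<Longrightarrow> epowr x a \<le> y \<longleftrightarrow> x \<le> epowr y (1 / a)"
  using epowr_mono[of "1/a" "epowr x a" y] epowr_mono[of a x "epowr y (1/a)"]
  by (auto simp: epowr_epowr)

lemma epowr_power2: "epowr x 2 = x ^ 2"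
  by (cases x) (simp_all add: epowr_def flip: ennreal_power)

lemma epowr_SUP:
  assumes "0 < a"
  shows "epowr (SUP i\<in>I. f i) a = (SUP i\<in>I. epowr (f i) a)"
proof (rule antisym)
  have "f i \<le> epowr (SUP i\<in>I. epowr (f i) a) (1 / a)" if "i \<in> I" for i
    unfolding epowr_le_iff[OF assms, symmetric] using that by (rule SUP_upper)
  then show "epowr (SUP i\<in>I. f i) a \<le> (SUP i\<in>I. epowr (f i) a)"
    unfolding epowr_le_iff[OF assms] by (rule SUP_least)
  show "(SUP i\<in>I. epowr (f i) a) \<le> epowr (SUP i\<in>I. f i) a"
    using assms by (intro SUP_least epowr_mono SUP_upper) auto
qed

lemma young_epowr:
  assumes "1 < p" "1 < q" "1 / p + 1 / q = 1"
  shows "x * y \<le> ennreal (1 / p) * epowr x p + ennreal (1 / q) * epowr y q"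
proof (cases "x = \<infinity> \<or> y = \<infinity>")
  case True
  then have "ennreal (1 / p) * epowr x p + ennreal (1 / q) * epowr y q = top"
    using assms by (auto simp: ennreal_mult_top)
  then show ?thesis by (simp only: top_greatest)
next
  case False
  then obtain a b where "x = ennreal a" "0 \<le> a" "y = ennreal b" "0 \<le> b"
    by (cases x; cases y) auto
  then show ?thesis
    using Youngs_inequality[of p q a b] assms
    by (simp add: epowr_ennreal flip: ennreal_mult ennreal_plus)
qed

text \<open>For finite positive \<open>x\<close>, \<open>y\<close>, \<open>h\<close> this is \<open>(x h - y)\<^sup>2 / h \<ge> 0\<close>. The convention \<open>y\<^sup>2 / 0 = \<infinity>\<close> for
  \<open>y \<noteq> 0\<close> keeps it true at the boundary, so that the weight may vanish or be infinite on large sets.\<close>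

lemma mean_ineq_ennreal: "2 * (x * y) \<le> x\<^sup>2 * h + y\<^sup>2 / (h :: ennreal)"
proof (cases "x = 0 \<or> y = 0")
  case nz: False
  show ?thesis
  proof (cases "x = top \<or> y = top \<or> h = top \<or> h = 0")
    case True
    have "x\<^sup>2 * h + y\<^sup>2 / h = top"
    proof (cases "h = 0 \<or> h = \<infinity>")
      case True
      then show ?thesis using nz
        by (auto simp: ennreal_mult_eq_top_iff ennreal_divide_eq_top_iff)
    next
      case False
      then show ?thesis using True nz
        by (auto simp: ennreal_mult_eq_top_iff ennreal_divide_eq_top_iff power_eq_top_ennreal)
    qed
    then show ?thesis by (simp only: top_greatest)
  next
    case False
    then obtain a b c where abc: "x = ennreal a" "0 \<le> a" "y = ennreal b" "0 \<le> b" "h = ennreal c" "0 < c"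
      by (cases x; cases y; cases h) (auto simp: less_le)
    have "0 \<le> (a * c - b)\<^sup>2 / c" using abc by simp
    then have "2 * (a * b) \<le> a\<^sup>2 * c + b\<^sup>2 / c"
      using abc by (simp add: field_simps power2_eq_square)
    then show ?thesis
      using abc by (simp add: divide_ennreal ennreal_power flip: ennreal_mult ennreal_plus
         ennreal_numeral)
  qed
qed auto

text \<open>Both sides are increasing in \<open>x\<close>. For finite \<open>x\<close> this is the integral of the derivative of
  \<open>t\<^sup>a\<close>, and the value at \<open>\<infinity>\<close> is forced by monotonicity.\<close>

lemma epowr_layer_cake:
  assumes "0 < a"
  shows "epowr x a = (\<integral>\<^sup>+ t. ennreal (a * t powr (a - 1)) * indicator {t. 0 < t \<and> ennreal t < x} t \<partial>lborel)"
proof -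
  have layer: "(\<integral>\<^sup>+ t. ennreal (a * t powr (a - 1)) * indicator {t. 0 < t \<and> ennreal t < ennreal c} t \<partial>lborel)
      = ennreal (c powr a)" if "0 \<le> c" for c
  proof -
    have "((\<lambda>t. t powr (a - 1)) has_integral (c powr (a - 1 + 1) / (a - 1 + 1))) {0..c}"
      using has_integral_powr_from_0[of "a - 1" c] assms that by simp
    then have "((\<lambda>t. a * t powr (a - 1)) has_integral (a * (c powr (a - 1 + 1) / (a - 1 + 1)))) {0..c}"
      by (rule has_integral_mult_right)
    then have *: "((\<lambda>t. a * t powr (a - 1)) has_integral c powr a) {0..c}"
      using assms by simp
    then have *: "((\<lambda>t. if t \<in> {0..c} then a * t powr (a - 1) else 0) has_integral c powr a) UNIV"
      by (simp only: has_integral_restrict_UNIV)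
    have "(\<integral>\<^sup>+ t. ennreal (if t \<in> {0..c} then a * t powr (a - 1) else 0) \<partial>lborel) = ennreal (c powr a)"
      by (rule nn_integral_has_integral_lborel[OF _ _ *]) (use assms in auto)
    then have "(\<integral>\<^sup>+ t. ennreal (a * t powr (a - 1)) * indicator {0..c} t \<partial>lborel) = ennreal (c powr a)"
      by (subst (asm) nn_integral_cong[where v="\<lambda>t. ennreal (a * t powr (a - 1)) * indicator {0..c} t"])
         (auto split: split_indicator)
    moreover have "(\<integral>\<^sup>+ t. ennreal (a * t powr (a - 1)) * indicator {t. 0 < t \<and> ennreal t < ennreal c} t \<partial>lborel)
        = (\<integral>\<^sup>+ t. ennreal (a * t powr (a - 1)) * indicator {0..c} t \<partial>lborel)"
    proof (rule nn_integral_cong_AE)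
      show "AE t in lborel. ennreal (a * t powr (a - 1)) * indicator {t. 0 < t \<and> ennreal t < ennreal c} t
          = ennreal (a * t powr (a - 1)) * indicator {0..c} t"
        using AE_lborel_singleton[of 0] AE_lborel_singleton[of c]
        by eventually_elim (auto split: split_indicator simp: ennreal_less_iff)
    qed
    ultimately show ?thesis by simp
  qed
  show ?thesis
  proof (cases x)
    case (real c)
    then show ?thesis by (simp add: epowr_ennreal layer)
  next
    case top
    have "ennreal (c powr a) \<le> (\<integral>\<^sup>+ t. ennreal (a * t powr (a - 1)) * indicator {t. 0 < t \<and> ennreal t < x} t \<partial>lborel)"
      if "0 \<le> c" for c
      unfolding layer[OF that, symmetric]
      by (intro nn_integral_mono) (auto split: split_indicator simp: top)
    note * = this
    have le: "ennreal c \<le> (\<integral>\<^sup>+ t. ennreal (a * t powr (a - 1)) * indicator {t. 0 < t \<and> ennreal t < x} t \<partial>lborel)"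
      (is "_ \<le> ?I") if "0 \<le> c" for c using *[of "c powr (1 / a)"] assms that by (simp add: powr_powr)
    have "?I = top"
    proof (cases ?I)
      case (real d)
      then show ?thesis using le[of "d + 1"] by simp
    qed
    then show ?thesis by (simp add: top)
  qed
qed

text \<open>Young's inequality against the constant \<open>1\<close>, after normalizing the right-hand side to \<open>1\<close>; the
  constant costs nothing because the total mass is one.\<close>

lemma nn_integral_le_epowr:
  assumes "prob_space M" "1 \<le> p" and [measurable]: "f \<in> borel_measurable M"
  shows "(\<integral>\<^sup>+ x. f x \<partial>M) \<le> epowr (\<integral>\<^sup>+ x. epowr (f x) p \<partial>M) (1 / p)"
proof (cases "p = 1")
  case False
  then have p: "1 < p" using assms by simp
  define q where "q = p / (p - 1)"
  have q: "1 < q" "1 / p + 1 / q = 1" using p by (auto simp: q_def field_simps)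
  interpret prob_space M by fact
  define I where "I = (\<integral>\<^sup>+ x. epowr (f x) p \<partial>M)"
  consider "I = 0" | "I = \<infinity>" | c where "I = ennreal c" "0 < c"
    by (cases I) (auto simp: less_le)
  then show ?thesis
  proof cases
    case 1
    then have "AE x in M. epowr (f x) p = 0"
      unfolding I_def by (subst (asm) nn_integral_0_iff_AE) auto
    then have "AE x in M. f x \<le> 0"
      by eventually_elim (use epowr_le_iff[of p _ 0] p in auto)
    then have "(\<integral>\<^sup>+ x. f x \<partial>M) \<le> (\<integral>\<^sup>+ x. 0 \<partial>M)"
      by (intro nn_integral_mono_AE) auto
    then show ?thesis by simp
  next
    case 2 then show ?thesis by (simp add: I_def[symmetric])
  next
    case 3
    define d where "d = c powr (1 / p)"
    have d: "d > 0" "d powr p = c" using 3 p by (auto simp: d_def powr_powr)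
    have "(\<integral>\<^sup>+ x. ennreal (1 / d) * f x \<partial>M)
        \<le> (\<integral>\<^sup>+ x. ennreal (1 / p) * (ennreal (1 / c) * epowr (f x) p) + ennreal (1 / q) \<partial>M)"
    proof (rule nn_integral_mono)
      fix x
      show "ennreal (1 / d) * f x \<le> ennreal (1 / p) * (ennreal (1 / c) * epowr (f x) p) + ennreal (1 / q)"
        using young_epowr[OF p q, of "ennreal (1 / d) * f x" 1] d
        by (simp add: epowr_mult epowr_ennreal powr_divide)
    qed
    also have "\<dots> = ennreal (1 / p) * (ennreal (1 / c) * I) + ennreal (1 / q)"
      by (simp add: nn_integral_add nn_integral_cmult I_def emeasure_space_1)
    also have "\<dots> = 1"
      using 3 p q by (simp flip: ennreal_mult ennreal_plus)
    finally have "ennreal (1 / d) * (\<integral>\<^sup>+ x. f x \<partial>M) \<le> 1"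
      by (simp add: nn_integral_cmult)
    then have "ennreal d * (ennreal (1 / d) * (\<integral>\<^sup>+ x. f x \<partial>M)) \<le> ennreal d * 1"
      by (intro mult_left_mono) auto
    then have "(\<integral>\<^sup>+ x. f x \<partial>M) \<le> ennreal d"
      using d by (simp flip: mult.assoc ennreal_mult)
    then show ?thesis using 3 by (simp add: I_def[symmetric] epowr_ennreal d_def)
  qed
qed simp

section \<open>Symmetric kernels dominated by a maximal operator\<close>

text \<open>The properties of the kernel on which the upper bound rests. The points are pairs \<open>(\<zeta>, r)\<close> of a
  direction and a radius, \<open>S\<close> is the measure for the directions and \<open>M\<close> the one for the radii.
  Averaging a function of the direction alone against the kernel is dominated, uniformly in the radius,
  by a maximal function \<open>Mh\<close> whose norm on \<open>L\<^sup>q\<close> is \<open>O(q')\<close>, as for the Hardy--Littlewood operator.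
  The kernel stands for the absolute value of the true one.\<close>

locale maximal_kernel = prob_space S + M: sigma_finite_measure M
  for S :: "'s measure" and M :: "'r measure" +
  fixes k :: "'s \<times> 'r \<Rightarrow> 's \<times> 'r \<Rightarrow> ennreal" and A :: real
  assumes k_measurable [measurable]:
      "(\<lambda>(x, y). k x y) \<in> borel_measurable ((S \<Otimes>\<^sub>M M) \<Otimes>\<^sub>M (S \<Otimes>\<^sub>M M))"
    and k_sym: "k x y = k y x"
    and A_pos: "0 < A"
    and schur: "AE x in S \<Otimes>\<^sub>M M. (\<integral>\<^sup>+ y. k x y \<partial>(S \<Otimes>\<^sub>M M)) \<le> ennreal A"
    and maximal: "\<And>q h. 1 < q \<Longrightarrow> h \<in> borel_measurable S \<Longrightarrow>
      \<exists>Mh \<in> borel_measurable S.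
        (AE x in S \<Otimes>\<^sub>M M. (\<integral>\<^sup>+ y. k x y * h (fst y) \<partial>(S \<Otimes>\<^sub>M M)) \<le> Mh (fst x)) \<and>
        (\<integral>\<^sup>+ \<zeta>. epowr (Mh \<zeta>) q \<partial>S) \<le> epowr (ennreal (A * (q / (q - 1)))) q * (\<integral>\<^sup>+ \<zeta>. epowr (h \<zeta>) q \<partial>S)"
begin

lemma A_nonneg: "0 \<le> A" using A_pos by simp

abbreviation X where "X \<equiv> S \<Otimes>\<^sub>M M"

sublocale X: sigma_finite_measure X
  by (intro sigma_finite_pair_measure) unfold_locales

definition section_sq :: "('s \<times> 'r \<Rightarrow> ennreal) \<Rightarrow> 's \<Rightarrow> ennreal" where
  "section_sq F \<zeta> = (\<integral>\<^sup>+ r. (F (\<zeta>, r))\<^sup>2 \<partial>M)"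

definition kernel_op :: "('s \<times> 'r \<Rightarrow> ennreal) \<Rightarrow> 's \<times> 'r \<Rightarrow> ennreal" where
  "kernel_op F x = (\<integral>\<^sup>+ y. k x y * F y \<partial>X)"

lemma section_sq_measurable [measurable (raw)]:
  assumes [measurable]: "F \<in> borel_measurable X"
  shows "section_sq F \<in> borel_measurable S"
  unfolding section_sq_def by measurable

lemma kernel_op_measurable [measurable (raw)]:
  assumes [measurable]: "F \<in> borel_measurable X"
  shows "kernel_op F \<in> borel_measurable X"
  unfolding kernel_op_def by measurable

lemma k_section_measurable [measurable]: "x \<in> space X \<Longrightarrow> k x \<in> borel_measurable X"
  using measurable_Pair2[OF k_measurable, of x] by simp

lemma nn_integral_X: "f \<in> borel_measurable X \<Longrightarrow> (\<integral>\<^sup>+ x. f x \<partial>X) = (\<integral>\<^sup>+ \<zeta>. \<integral>\<^sup>+ r. f (\<zeta>, r) \<partial>M \<partial>S)"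
  using M.nn_integral_fst[of f S] by simp

lemma nn_integral_sq_weight:
  assumes [measurable]: "F \<in> borel_measurable X" "h \<in> borel_measurable S"
  shows "(\<integral>\<^sup>+ x. (F x)\<^sup>2 * h (fst x) \<partial>X) = (\<integral>\<^sup>+ \<zeta>. section_sq F \<zeta> * h \<zeta> \<partial>S)"
  by (subst nn_integral_X) (auto simp: section_sq_def nn_integral_multc[symmetric] intro!: nn_integral_cong nn_integral_multc)

lemma kernel_op_pairing_sym:
  assumes [measurable]: "F \<in> borel_measurable X" "G \<in> borel_measurable X"
  shows "(\<integral>\<^sup>+ x. kernel_op F x * G x \<partial>X) = (\<integral>\<^sup>+ x. kernel_op G x * F x \<partial>X)"
proof -
  interpret XX: pair_sigma_finite X X by unfold_locales
  have "(\<integral>\<^sup>+ x. kernel_op F x * G x \<partial>X) = (\<integral>\<^sup>+ x. \<integral>\<^sup>+ y. k x y * F y * G x \<partial>X \<partial>X)"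
    unfolding kernel_op_def by (intro nn_integral_cong nn_integral_multc[symmetric]) measurable
  also have "\<dots> = (\<integral>\<^sup>+ y. \<integral>\<^sup>+ x. k x y * F y * G x \<partial>X \<partial>X)"
    by (rule XX.Fubini') measurable
  also have "\<dots> = (\<integral>\<^sup>+ x. kernel_op G x * F x \<partial>X)"
    unfolding kernel_op_def
  proof (rule nn_integral_cong)
    fix y assume [measurable]: "y \<in> space X"
    have "(\<integral>\<^sup>+ x. k x y * F y * G x \<partial>X) = (\<integral>\<^sup>+ x. (k y x * G x) * F y \<partial>X)"
      by (simp add: k_sym[of _ y] mult_ac)
    also have "\<dots> = (\<integral>\<^sup>+ x. k y x * G x \<partial>X) * F y"
      by (rule nn_integral_multc) measurable
    finally show "(\<integral>\<^sup>+ x. k x y * F y * G x \<partial>X) = (\<integral>\<^sup>+ x. k y x * G x \<partial>X) * F y" .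
  qed
  finally show ?thesis .
qed

text \<open>The weight \<open>h\<close> depends on the direction only. Apply \<open>2 F(y) G(x) \<le> F(y)\<^sup>2 h(x) + G(x)\<^sup>2 / h(x)\<close> under
  the double integral. In the first term integrate in \<open>x\<close> first: by symmetry of the kernel \<open>h\<close> turns
  into \<open>Mh\<close>, evaluated at \<open>y\<close>. In the second term the \<open>y\<close> integral is at most \<open>A\<close>.\<close>

lemma pairing_weighted:
  assumes [measurable]: "F \<in> borel_measurable X" "G \<in> borel_measurable X" "h \<in> borel_measurable S"
    "Mh \<in> borel_measurable S"
    and Mh: "AE x in X. (\<integral>\<^sup>+ y. k x y * h (fst y) \<partial>X) \<le> Mh (fst x)"
  shows "2 * (\<integral>\<^sup>+ x. kernel_op F x * G x \<partial>X)
    \<le> (\<integral>\<^sup>+ \<zeta>. section_sq F \<zeta> * Mh \<zeta> \<partial>S) + ennreal A * (\<integral>\<^sup>+ \<zeta>. section_sq G \<zeta> / h \<zeta> \<partial>S)"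
proof -
  interpret XX: pair_sigma_finite X X by unfold_locales
  have "2 * (\<integral>\<^sup>+ x. kernel_op F x * G x \<partial>X) = (\<integral>\<^sup>+ x. \<integral>\<^sup>+ y. k x y * (2 * (F y * G x)) \<partial>X \<partial>X)"
  proof (subst nn_integral_cmult[symmetric], measurable, rule nn_integral_cong)
    fix x assume [measurable]: "x \<in> space X"
    have "(\<integral>\<^sup>+ y. k x y * (2 * (F y * G x)) \<partial>X) = (\<integral>\<^sup>+ y. (k x y * F y) * (2 * G x) \<partial>X)"
      by (simp add: mult_ac)
    also have "\<dots> = kernel_op F x * (2 * G x)"
      unfolding kernel_op_def by (rule nn_integral_multc) measurable
    finally show "2 * (kernel_op F x * G x) = (\<integral>\<^sup>+ y. k x y * (2 * (F y * G x)) \<partial>X)"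
      by (simp add: mult_ac)
  qed
  also have "\<dots> \<le> (\<integral>\<^sup>+ x. \<integral>\<^sup>+ y. k x y * ((F y)\<^sup>2 * h (fst x)) + k x y * ((G x)\<^sup>2 * inverse (h (fst x))) \<partial>X \<partial>X)"
    using mean_ineq_ennreal
    by (intro nn_integral_mono) (auto simp: divide_ennreal_def simp flip: distrib_left intro!: mult_left_mono)
  also have "\<dots> = (\<integral>\<^sup>+ x. \<integral>\<^sup>+ y. k x y * ((F y)\<^sup>2 * h (fst x)) \<partial>X \<partial>X)
      + (\<integral>\<^sup>+ x. \<integral>\<^sup>+ y. k x y * ((G x)\<^sup>2 * inverse (h (fst x))) \<partial>X \<partial>X)"
    by (subst nn_integral_add[symmetric], measurable)
       (intro nn_integral_cong nn_integral_add; measurable)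
  also have "(\<integral>\<^sup>+ x. \<integral>\<^sup>+ y. k x y * ((F y)\<^sup>2 * h (fst x)) \<partial>X \<partial>X)
      = (\<integral>\<^sup>+ y. \<integral>\<^sup>+ x. k x y * ((F y)\<^sup>2 * h (fst x)) \<partial>X \<partial>X)"
    by (rule XX.Fubini') measurable
  also have "\<dots> = (\<integral>\<^sup>+ y. (F y)\<^sup>2 * (\<integral>\<^sup>+ x. k y x * h (fst x) \<partial>X) \<partial>X)"
  proof (rule nn_integral_cong)
    fix y assume [measurable]: "y \<in> space X"
    have "(\<integral>\<^sup>+ x. k x y * ((F y)\<^sup>2 * h (fst x)) \<partial>X) = (\<integral>\<^sup>+ x. (F y)\<^sup>2 * (k y x * h (fst x)) \<partial>X)"
      by (rule nn_integral_cong) (simp only: k_sym[of _ y] mult.left_commute)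
    also have "\<dots> = (F y)\<^sup>2 * (\<integral>\<^sup>+ x. k y x * h (fst x) \<partial>X)"
      by (rule nn_integral_cmult) measurable
    finally show "(\<integral>\<^sup>+ x. k x y * ((F y)\<^sup>2 * h (fst x)) \<partial>X) = (F y)\<^sup>2 * (\<integral>\<^sup>+ x. k y x * h (fst x) \<partial>X)" .
  qed
  also have "\<dots> \<le> (\<integral>\<^sup>+ y. (F y)\<^sup>2 * Mh (fst y) \<partial>X)"
    by (rule nn_integral_mono_AE, rule eventually_mono[OF Mh]) (auto intro: mult_left_mono)
  also have "\<dots> = (\<integral>\<^sup>+ \<zeta>. section_sq F \<zeta> * Mh \<zeta> \<partial>S)"
    by (simp add: nn_integral_sq_weight)
  also have "(\<integral>\<^sup>+ x. \<integral>\<^sup>+ y. k x y * ((G x)\<^sup>2 * inverse (h (fst x))) \<partial>X \<partial>X)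
      = (\<integral>\<^sup>+ x. (\<integral>\<^sup>+ y. k x y \<partial>X) * ((G x)\<^sup>2 * inverse (h (fst x))) \<partial>X)"
    by (intro nn_integral_cong nn_integral_multc) measurable
  also have "\<dots> \<le> (\<integral>\<^sup>+ x. ennreal A * ((G x)\<^sup>2 * inverse (h (fst x))) \<partial>X)"
    by (rule nn_integral_mono_AE, rule eventually_mono[OF schur]) (auto intro: mult_right_mono)
  also have "\<dots> = ennreal A * (\<integral>\<^sup>+ \<zeta>. section_sq G \<zeta> / h \<zeta> \<partial>S)"
    by (simp add: nn_integral_cmult divide_ennreal_def
      nn_integral_sq_weight[of G "\<lambda>x. inverse (h x)"])
  finally show ?thesis by (simp add: add_mono)
qed

text \<open>This is where \<open>\<surd>p\<close> comes from. With \<open>g = section_sq G\<close>, the weight is \<open>h = g powr ((2 - p') / 2) / \<surd>p\<close>.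
  The power makes \<open>g / h\<close> a multiple of \<open>g powr (p' / 2)\<close>, whose integral is at most \<open>1\<close>, and it makes
  \<open>h\<close> an element of \<open>L\<^sup>q\<close> with \<open>q = (p / 2)' = p / (p - 2)\<close>. Since \<open>q' = p / 2\<close>, the maximal function
  costs a factor \<open>p / 2\<close> in the first term of \<open>pairing_weighted\<close>; the factor \<open>1 / \<surd>p\<close> in \<open>h\<close>
  balances the two terms, leaving \<open>\<surd>p\<close> in both.\<close>

lemma pairing_bound_gt2:
  assumes p: "2 < p" and [measurable]: "F \<in> borel_measurable X" "G \<in> borel_measurable X"
    and F: "(\<integral>\<^sup>+ \<zeta>. epowr (section_sq F \<zeta>) (p / 2) \<partial>S) \<le> 1"
    and G: "(\<integral>\<^sup>+ \<zeta>. epowr (section_sq G \<zeta>) (conj_exp p / 2) \<partial>S) \<le> 1"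
  shows "(\<integral>\<^sup>+ x. kernel_op F x * G x \<partial>X) \<le> ennreal (A * sqrt p)"
proof -
  define p' where "p' = conj_exp p"
  define q where "q = p / (p - 2)"
  define b where "b = (2 - p') / 2"
  have p': "p' = p / (p - 1)" "p' < 2" "0 < p'" using p by (auto simp: p'_def conj_exp_def field_simps)
  have q: "1 < q" "q / (q - 1) = p / 2" "1 / (p / 2) + 1 / q = 1" using p by (auto simp: q_def field_simps)
  have "(p - 2) / (p - 1) * (p / (p - 2)) = p / (p - 1)" using p by simp
  moreover have "2 - p' = (p - 2) / (p - 1)" using p by (simp add: p'(1) field_simps)
  ultimately have b: "b * q = p' / 2" "0 < b" using p p' by (auto simp: b_def q_def p'(1))
  define h where "h \<zeta> = ennreal (1 / sqrt p) * epowr (section_sq G \<zeta>) b" for \<zeta>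
  have [measurable]: "h \<in> borel_measurable S" unfolding h_def by measurable
  obtain Mh where [measurable]: "Mh \<in> borel_measurable S"
    and Mh: "AE x in X. (\<integral>\<^sup>+ y. k x y * h (fst y) \<partial>X) \<le> Mh (fst x)"
      "(\<integral>\<^sup>+ \<zeta>. epowr (Mh \<zeta>) q \<partial>S) \<le> epowr (ennreal (A * (p / 2))) q * (\<integral>\<^sup>+ \<zeta>. epowr (h \<zeta>) q \<partial>S)"
    using maximal[OF q(1), of h] unfolding q(2) by auto
  (* a bound for the norm of Mh in L^q: the factor A q' = A p / 2 of the maximal function times 1 / sqrt p *)
  define d where "d = A * sqrt p / 2"
  have d: "A * (p / 2) * (1 / sqrt p) = d" "0 \<le> d"
    using p A_nonneg by (auto simp: d_def field_simps)
  have hq: "(\<integral>\<^sup>+ \<zeta>. epowr (h \<zeta>) q \<partial>S) \<le> epowr (ennreal (1 / sqrt p)) q"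
  proof -
    have "(\<integral>\<^sup>+ \<zeta>. epowr (h \<zeta>) q \<partial>S) = epowr (ennreal (1 / sqrt p)) q * (\<integral>\<^sup>+ \<zeta>. epowr (section_sq G \<zeta>) (p' / 2) \<partial>S)"
      by (simp add: h_def epowr_mult epowr_epowr b nn_integral_cmult)
    also have "\<dots> \<le> epowr (ennreal (1 / sqrt p)) q * 1"
      by (intro mult_left_mono) (use G in \<open>auto simp: p'_def\<close>)
    finally show ?thesis by simp
  qed
  have Mhq: "(\<integral>\<^sup>+ \<zeta>. epowr (Mh \<zeta>) q \<partial>S) \<le> epowr (ennreal d) q"
  proof -
    have "(\<integral>\<^sup>+ \<zeta>. epowr (Mh \<zeta>) q \<partial>S) \<le> epowr (ennreal (A * (p / 2))) q * epowr (ennreal (1 / sqrt p)) q"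
      using Mh(2) by (rule order_trans) (intro mult_left_mono hq, simp)
    also have "\<dots> = epowr (ennreal d) q"
    proof -
      have "ennreal (A * (p / 2)) * ennreal (1 / sqrt p) = ennreal (A * (p / 2) * (1 / sqrt p))"
        using A_nonneg p by (intro ennreal_mult[symmetric]) auto
      then show ?thesis unfolding d(1) by (simp only: epowr_mult[symmetric])
    qed
    finally show ?thesis .
  qed
  (* Hoelder's inequality with the exponents p / 2 and q, in the form of Young's inequality for Mh / d *)
  have first: "(\<integral>\<^sup>+ \<zeta>. section_sq F \<zeta> * Mh \<zeta> \<partial>S) \<le> ennreal d"
  proof (cases "d = 0")
    case True
    have "(\<integral>\<^sup>+ \<zeta>. epowr (Mh \<zeta>) q \<partial>S) = 0" using Mhq True by simp
    then have "AE \<zeta> in S. Mh \<zeta> = 0"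
      by (subst (asm) nn_integral_0_iff_AE) auto
    then have "(\<integral>\<^sup>+ \<zeta>. section_sq F \<zeta> * Mh \<zeta> \<partial>S) = (\<integral>\<^sup>+ \<zeta>. 0 \<partial>S)"
      by (intro nn_integral_cong_AE) auto
    then show ?thesis by simp
  next
    case False
    have "(\<integral>\<^sup>+ \<zeta>. section_sq F \<zeta> * Mh \<zeta> \<partial>S)
      = (\<integral>\<^sup>+ \<zeta>. ennreal d * (section_sq F \<zeta> * (ennreal (1 / d) * Mh \<zeta>)) \<partial>S)"
    proof (rule nn_integral_cong)
      fix \<zeta>
      have "ennreal d * ennreal (1 / d) = 1" using False d by (simp flip: ennreal_mult)
      then show "section_sq F \<zeta> * Mh \<zeta> = ennreal d * (section_sq F \<zeta> * (ennreal (1 / d) * Mh \<zeta>))"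
        by (metis mult.assoc mult.commute mult_1)
    qed
    also have "\<dots> \<le> (\<integral>\<^sup>+ \<zeta>. ennreal d * (ennreal (1 / (p / 2)) * epowr (section_sq F \<zeta>) (p / 2)
         + ennreal (1 / q) * (epowr (ennreal (1 / d)) q * epowr (Mh \<zeta>) q)) \<partial>S)"
      using young_epowr[of "p / 2" q] p q
      by (intro nn_integral_mono mult_left_mono) (simp_all add: epowr_mult[symmetric])
    also have "\<dots> = ennreal d * (ennreal (1 / (p / 2)) * (\<integral>\<^sup>+ \<zeta>. epowr (section_sq F \<zeta>) (p / 2) \<partial>S)
         + ennreal (1 / q) * (epowr (ennreal (1 / d)) q * (\<integral>\<^sup>+ \<zeta>. epowr (Mh \<zeta>) q \<partial>S)))"
      by (simp add: nn_integral_add nn_integral_cmult)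
    also have "\<dots> \<le> ennreal d * (ennreal (1 / (p / 2)) * 1
         + ennreal (1 / q) * (epowr (ennreal (1 / d)) q * epowr (ennreal d) q))"
      by (intro mult_left_mono add_mono F Mhq) auto
    also have "epowr (ennreal (1 / d)) q * epowr (ennreal d) q = 1"
      using d False by (simp flip: epowr_mult ennreal_mult)
    also have "ennreal d * (ennreal (1 / (p / 2)) * 1 + ennreal (1 / q) * 1) = ennreal d"
      using q p by (simp flip: ennreal_plus)
    finally show ?thesis .
  qed
  have "(\<integral>\<^sup>+ \<zeta>. section_sq G \<zeta> / h \<zeta> \<partial>S) \<le> (\<integral>\<^sup>+ \<zeta>. ennreal (sqrt p) * epowr (section_sq G \<zeta>) (p' / 2) \<partial>S)"
  proof (rule nn_integral_mono)
    fix \<zeta>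
    show "section_sq G \<zeta> / h \<zeta> \<le> ennreal (sqrt p) * epowr (section_sq G \<zeta>) (p' / 2)"
    proof (cases "section_sq G \<zeta>")
      case top
      have "h \<zeta> = top" using p by (simp add: h_def top ennreal_mult_top)
      then show ?thesis by (simp add: divide_ennreal_def)
    next
      case (real g)
      show ?thesis
      proof (cases "g = 0")
        case False
        with real have g: "0 < g" by simp
        have "section_sq G \<zeta> / h \<zeta> = ennreal (g / ((1 / sqrt p) * g powr b))"
          unfolding h_def using real g p
          by (simp add: epowr_ennreal divide_ennreal flip: ennreal_mult)
        also have "g / ((1 / sqrt p) * g powr b) = sqrt p * g powr (1 - b)"
          using g by (simp add: powr_diff)
        also have "1 - b = p' / 2" by (simp add: b_def field_simps)
        finally show ?thesis using real p by (simp add: epowr_ennreal flip: ennreal_mult)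
      qed (simp add: real divide_ennreal_def)
    qed
  qed
  also have "\<dots> = ennreal (sqrt p) * (\<integral>\<^sup>+ \<zeta>. epowr (section_sq G \<zeta>) (p' / 2) \<partial>S)"
    by (rule nn_integral_cmult) measurable
  also have "\<dots> \<le> ennreal (sqrt p) * 1"
    by (intro mult_left_mono) (use G in \<open>auto simp: p'_def\<close>)
  finally have second: "(\<integral>\<^sup>+ \<zeta>. section_sq G \<zeta> / h \<zeta> \<partial>S) \<le> ennreal (sqrt p)" by simp
  have "2 * (\<integral>\<^sup>+ x. kernel_op F x * G x \<partial>X) \<le> ennreal d + ennreal A * ennreal (sqrt p)"
    by (rule order_trans[OF pairing_weighted[OF _ _ _ _ Mh(1)]])
       (auto intro!: add_mono mult_left_mono first second)
  also have "\<dots> \<le> 2 * ennreal (A * sqrt p)"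
    using A_nonneg p by (simp add: d_def flip: ennreal_mult ennreal_plus ennreal_numeral)
  finally show ?thesis
    by (simp add: ennreal_mult_le_mult_iff)
qed

lemma pairing_bound_2:
  assumes [measurable]: "F \<in> borel_measurable X" "G \<in> borel_measurable X"
    and F: "(\<integral>\<^sup>+ \<zeta>. section_sq F \<zeta> \<partial>S) \<le> 1" and G: "(\<integral>\<^sup>+ \<zeta>. section_sq G \<zeta> \<partial>S) \<le> 1"
  shows "(\<integral>\<^sup>+ x. kernel_op F x * G x \<partial>X) \<le> ennreal A"
proof -
  have "2 * (\<integral>\<^sup>+ x. kernel_op F x * G x \<partial>X) \<le> (\<integral>\<^sup>+ \<zeta>. section_sq F \<zeta> * ennreal A \<partial>S) + ennreal A * (\<integral>\<^sup>+ \<zeta>. section_sq G \<zeta> / 1 \<partial>S)"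
    by (rule pairing_weighted) (use schur in auto)
  also have "\<dots> = ennreal A * (\<integral>\<^sup>+ \<zeta>. section_sq F \<zeta> \<partial>S) + ennreal A * (\<integral>\<^sup>+ \<zeta>. section_sq G \<zeta> \<partial>S)"
    by (simp add: nn_integral_cmult mult.commute divide_ennreal_def)
  also have "\<dots> \<le> ennreal A * 1 + ennreal A * 1"
    by (intro add_mono mult_left_mono F G) auto
  also have "\<dots> = 2 * ennreal A" by (simp add: mult_2)
  finally show ?thesis by (simp add: ennreal_mult_le_mult_iff)
qed

lemma pairing_bound:
  assumes p: "1 < p" and [measurable]: "F \<in> borel_measurable X" "G \<in> borel_measurable X"
    and F: "(\<integral>\<^sup>+ \<zeta>. epowr (section_sq F \<zeta>) (p / 2) \<partial>S) \<le> 1"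
    and G: "(\<integral>\<^sup>+ \<zeta>. epowr (section_sq G \<zeta>) (conj_exp p / 2) \<partial>S) \<le> 1"
  shows "(\<integral>\<^sup>+ x. kernel_op F x * G x \<partial>X) \<le> ennreal (A * max (sqrt p) (sqrt (conj_exp p)))"
proof -
  consider "p > 2" | "p = 2" | "p < 2" by linarith
  then show ?thesis
  proof cases
    case 1
    then show ?thesis
      by (rule order_trans[OF pairing_bound_gt2[OF _ _ _ F G]])
         (auto intro!: ennreal_leI mult_left_mono A_nonneg)
  next
    case 2
    have "conj_exp p = 2" using 2 by (simp add: conj_exp_def)
    moreover have "A * 1 \<le> A * max (sqrt p) (sqrt (conj_exp p))"
      using 2 A_nonneg by (intro mult_left_mono) (auto simp: le_max_iff_disj)
    ultimately show ?thesis
      using pairing_bound_2[of F G] F G 2 by (auto intro: order_trans[OF _ ennreal_leI])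
  next
    case 3
    (* exchange F and G by symmetry of the kernel *)
    have c: "conj_exp (conj_exp p) = p" "2 < conj_exp p" using p 3 by (auto simp: conj_exp_def field_simps)
    show ?thesis
      unfolding kernel_op_pairing_sym[OF assms(2,3)]
      by (rule order_trans[OF pairing_bound_gt2[OF c(2) _ _ G]])
         (auto intro!: ennreal_leI mult_left_mono A_nonneg simp: c F)
  qed
qed

text \<open>Duality: test the pairing bound with \<open>G = \<Phi> w\<close>, where \<open>w\<close> is the power of \<open>section_sq \<Phi>\<close> for which
  Hoelder's inequality is an equality. The minorant \<open>\<Phi>\<close> of the image of \<open>F\<close> has a bounded
  square function, so that the quantity to be estimated is known to be finite and can be divided out.\<close>

lemma truncated_bound:
  assumes p: "1 < p" and [measurable]: "F \<in> borel_measurable X" "\<Phi> \<in> borel_measurable X"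
    and F: "(\<integral>\<^sup>+ \<zeta>. epowr (section_sq F \<zeta>) (p / 2) \<partial>S) \<le> 1"
    and le: "\<And>x. \<Phi> x \<le> kernel_op F x" and bdd: "\<And>\<zeta>. \<zeta> \<in> space S \<Longrightarrow> section_sq \<Phi> \<zeta> \<le> ennreal c"
  shows "(\<integral>\<^sup>+ \<zeta>. epowr (section_sq \<Phi> \<zeta>) (p / 2) \<partial>S) \<le> epowr (ennreal (A * max (sqrt p) (sqrt (conj_exp p)))) p"
proof -
  define p' where "p' = conj_exp p"
  define I where "I = (\<integral>\<^sup>+ \<zeta>. epowr (section_sq \<Phi> \<zeta>) (p / 2) \<partial>S)"
  define K where "K = A * max (sqrt p) (sqrt (conj_exp p))"
  have p': "0 < p'" "1 - 1 / p' = 1 / p" "(p - 1) * (p' / 2) = p / 2"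
    using p by (auto simp: p'_def conj_exp_def field_simps)
  have "I \<le> (\<integral>\<^sup>+ \<zeta>. epowr (ennreal c) (p / 2) \<partial>S)"
    unfolding I_def by (intro nn_integral_mono epowr_mono bdd) (use p in auto)
  also have "\<dots> < \<infinity>" by (simp add: emeasure_space_1 epowr_def)
  finally have "I \<noteq> \<infinity>" by simp
  then consider "I = 0" | a where "I = ennreal a" "0 < a"
    by (cases I) (auto simp: less_le)
  then show ?thesis
  proof cases
    case 1 then show ?thesis by (simp add: I_def)
  next
    case 2
    (* normalized so that G has norm 1 in the dual space and pairs with \<Phi> to the norm of \<Phi> *)
    define w where "w \<zeta> = ennreal (a powr (- 1 / p')) * epowr (section_sq \<Phi> \<zeta>) ((p - 2) / 2)" for \<zeta>
    have [measurable]: "w \<in> borel_measurable S" unfolding w_def by measurable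
    define G where "G x = \<Phi> x * w (fst x)" for x
    have [measurable]: "G \<in> borel_measurable X" unfolding G_def by measurable
    have real: "\<exists>g\<ge>0. section_sq \<Phi> \<zeta> = ennreal g" if "\<zeta> \<in> space S" for \<zeta>
      using bdd[OF that] by (cases "section_sq \<Phi> \<zeta>") (auto simp: top_unique)
    have sqw: "section_sq \<Phi> \<zeta> * w \<zeta> = ennreal (a powr (- 1 / p')) * epowr (section_sq \<Phi> \<zeta>) (p / 2)" if \<zeta>: "\<zeta> \<in> space S" for \<zeta>
    proof -
      obtain g where g: "0 \<le> g" "section_sq \<Phi> \<zeta> = ennreal g" using real[OF \<zeta>] by auto
      have "g * g powr ((p - 2) / 2) = g powr (p / 2)"
      proof (cases "g = 0")
        case False
        then have "g * g powr ((p - 2) / 2) = g powr 1 * g powr ((p - 2) / 2)" using g by simp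
        also have "\<dots> = g powr (p / 2)" by (subst powr_add[symmetric]) (simp add: field_simps)
        finally show ?thesis .
      qed simp
      then show ?thesis using g by (simp add: w_def epowr_ennreal mult.left_commute flip: ennreal_mult)
    qed
    have sqG: "epowr (section_sq G \<zeta>) (p' / 2) = ennreal (1 / a) * epowr (section_sq \<Phi> \<zeta>) (p / 2)" if \<zeta>: "\<zeta> \<in> space S" for \<zeta>
    proof -
      obtain g where g: "0 \<le> g" "section_sq \<Phi> \<zeta> = ennreal g" using real[OF \<zeta>] by auto
      have "(\<lambda>r. \<Phi> (\<zeta>, r)) \<in> borel_measurable M"
        using measurable_Pair2[OF assms(3) \<zeta>] .
      then have "section_sq G \<zeta> = (section_sq \<Phi> \<zeta> * w \<zeta>) * w \<zeta>"
        by (simp add: section_sq_def G_def power_mult_distrib nn_integral_multc power2_eq_square[of "w \<zeta>"] mult.assoc)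
      also have "\<dots> = ennreal (a powr (- 1 / p')) * ennreal (a powr (- 1 / p')) * ennreal (g powr (p / 2) * g powr ((p - 2) / 2))"
        unfolding sqw[OF \<zeta>] using g by (simp add: w_def epowr_ennreal ennreal_mult mult_ac)
      also have "g powr (p / 2) * g powr ((p - 2) / 2) = g powr (p - 1)"
        by (subst powr_add[symmetric]) (rule arg_cong[where f="\<lambda>x. g powr x"], simp add: field_simps)
      also have "ennreal (a powr (- 1 / p')) * ennreal (a powr (- 1 / p')) = ennreal (a powr (- 2 / p'))"
        by (simp flip: ennreal_mult powr_add)
      finally have "epowr (section_sq G \<zeta>) (p' / 2) = ennreal ((a powr (- 2 / p')) powr (p' / 2)) * ennreal ((g powr (p - 1)) powr (p' / 2))"
        by (simp add: epowr_mult epowr_ennreal)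
      also have "(a powr (- 2 / p')) powr (p' / 2) = 1 / a"
      proof -
        have "(a powr (- 2 / p')) powr (p' / 2) = a powr - 1"
          using p'(1) by (simp only: powr_powr) simp
        then show ?thesis using 2 by (simp add: powr_minus_divide)
      qed
      also have "(g powr (p - 1)) powr (p' / 2) = g powr (p / 2)"
        by (simp only: powr_powr p')
      finally show ?thesis using g by (simp add: epowr_ennreal)
    qed
    have "(\<integral>\<^sup>+ \<zeta>. epowr (section_sq G \<zeta>) (conj_exp p / 2) \<partial>S) = (\<integral>\<^sup>+ \<zeta>. ennreal (1 / a) * epowr (section_sq \<Phi> \<zeta>) (p / 2) \<partial>S)"
      using sqG by (intro nn_integral_cong) (simp add: p'_def)
    also have "\<dots> = ennreal (1 / a) * I"
      unfolding I_def by (rule nn_integral_cmult) measurable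
    also have "\<dots> = 1" using 2 by (simp flip: ennreal_mult)
    finally have G: "(\<integral>\<^sup>+ \<zeta>. epowr (section_sq G \<zeta>) (conj_exp p / 2) \<partial>S) \<le> 1" by simp
    have "(\<integral>\<^sup>+ x. \<Phi> x * G x \<partial>X) = (\<integral>\<^sup>+ \<zeta>. section_sq \<Phi> \<zeta> * w \<zeta> \<partial>S)"
      by (subst nn_integral_sq_weight[symmetric]) (auto simp: G_def power2_eq_square mult.assoc)
    also have "\<dots> = (\<integral>\<^sup>+ \<zeta>. ennreal (a powr (- 1 / p')) * epowr (section_sq \<Phi> \<zeta>) (p / 2) \<partial>S)"
      using sqw by (intro nn_integral_cong)
    also have "\<dots> = ennreal (a powr (- 1 / p')) * I"
      unfolding I_def by (rule nn_integral_cmult) measurable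
    also have "\<dots> = ennreal (a powr (- 1 / p') * a)"
      using 2 by (simp add: ennreal_mult)
    also have "a powr (- 1 / p') * a = a powr (- 1 / p' + 1)"
      using 2 powr_add[of a "- 1 / p'" 1] by simp
    also have "- 1 / p' + 1 = 1 / p" using p' by simp
    finally have "ennreal (a powr (1 / p)) = (\<integral>\<^sup>+ x. \<Phi> x * G x \<partial>X)" by simp
    also have "\<dots> \<le> (\<integral>\<^sup>+ x. kernel_op F x * G x \<partial>X)"
      by (intro nn_integral_mono mult_right_mono le) auto
    also have "\<dots> \<le> ennreal K"
      unfolding K_def by (rule pairing_bound[OF p _ _ F G]) measurable
    finally have "epowr (ennreal (a powr (1 / p))) p \<le> epowr (ennreal K) p"
      using p by (intro epowr_mono) auto
    then show ?thesis
      using 2 p by (simp add: epowr_ennreal powr_powr I_def K_def)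
  qed
qed

text \<open>Exhaust by the truncations \<open>min (kernel_op F) i\<close> restricted to sets of finite measure, and use
  monotone convergence twice, for the inner and for the outer integral.\<close>

lemma kernel_op_bound_normalized:
  assumes p: "1 < p" and [measurable]: "F \<in> borel_measurable X"
    and F: "(\<integral>\<^sup>+ \<zeta>. epowr (section_sq F \<zeta>) (p / 2) \<partial>S) \<le> 1"
  shows "(\<integral>\<^sup>+ \<zeta>. epowr (section_sq (kernel_op F) \<zeta>) (p / 2) \<partial>S)
    \<le> epowr (ennreal (A * max (sqrt p) (sqrt (conj_exp p)))) p"
proof -
  obtain \<Omega> :: "nat \<Rightarrow> 'r set" where \<Omega>: "range \<Omega> \<subseteq> sets M" "(\<Union>i. \<Omega> i) = space M"
    "\<And>i. emeasure M (\<Omega> i) \<noteq> \<infinity>" "incseq \<Omega>"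
    by (rule M.sigma_finite_incseq) blast
  have [measurable]: "\<Omega> i \<in> sets M" for i using \<Omega> by auto
  define \<Phi> where "\<Phi> i x = min (kernel_op F x) (of_nat i) * indicator (\<Omega> i) (snd x)" for i :: nat and x
  have [measurable]: "\<Phi> i \<in> borel_measurable X" for i unfolding \<Phi>_def by measurable
  have mono: "\<Phi> i x \<le> \<Phi> j x" if "i \<le> j" for i j x
    unfolding \<Phi>_def
    using that incseqD[OF \<Omega>(4) that] by (intro mult_mono min.mono) (auto split: split_indicator)
  have sup: "(SUP i. (\<Phi> i x)\<^sup>2) = (kernel_op F x)\<^sup>2" if "snd x \<in> space M" for x
  proof (rule antisym)
    show "(SUP i. (\<Phi> i x)\<^sup>2) \<le> (kernel_op F x)\<^sup>2"
      by (intro SUP_least power_mono) (auto simp: \<Phi>_def split: split_indicator)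
    obtain i0 where i0: "snd x \<in> \<Omega> i0" using \<Omega>(2) \<open>snd x \<in> space M\<close> by auto
    have ge: "(min (kernel_op F x) (of_nat i))\<^sup>2 \<le> (SUP i. (\<Phi> i x)\<^sup>2)" for i
    proof -
      have "snd x \<in> \<Omega> (max i i0)" using i0 incseqD[OF \<Omega>(4), of i0 "max i i0"] by auto
      then have "min (kernel_op F x) (of_nat i) \<le> \<Phi> (max i i0) x"
        by (auto simp: \<Phi>_def min_le_iff_disj)
      then have "(min (kernel_op F x) (of_nat i))\<^sup>2 \<le> (\<Phi> (max i i0) x)\<^sup>2" by (rule power_mono) auto
      also have "\<dots> \<le> (SUP i. (\<Phi> i x)\<^sup>2)" by (rule SUP_upper) auto
      finally show ?thesis .
    qed
    show "(kernel_op F x)\<^sup>2 \<le> (SUP i. (\<Phi> i x)\<^sup>2)"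
    proof (cases "kernel_op F x")
      case (real c)
      obtain i :: nat where "c \<le> real i" using real_arch_simple by blast
      then have "min (kernel_op F x) (of_nat i) = kernel_op F x"
        using real by (auto simp: min_def ennreal_of_nat_eq_real_of_nat)
      with ge[of i] show ?thesis by simp
    next
      case top
      have "of_nat i \<le> (SUP i. (\<Phi> i x)\<^sup>2)" for i
      proof -
        have "(of_nat i :: ennreal) \<le> of_nat (i ^ 2)" by (simp only: of_nat_le_iff) (cases i; simp add: power2_eq_square)
        then show ?thesis using ge[of i] top by simp
      qed
      then have le: "of_nat i \<le> (SUP i. (\<Phi> i x)\<^sup>2)" for i .
      have "(SUP i. (\<Phi> i x)\<^sup>2) = top"
      proof (cases "SUP i. (\<Phi> i x)\<^sup>2")
        case (real d)
        obtain i :: nat where "d < real i" using reals_Archimedean2 by blast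
        then show ?thesis using le[of i] real by (simp add: ennreal_of_nat_eq_real_of_nat)
      qed
      then show ?thesis by (simp only: top_greatest)
    qed
  qed
  have bdd: "section_sq (\<Phi> i) \<zeta> \<le> ennreal (enn2real ((of_nat i)\<^sup>2 * emeasure M (\<Omega> i)))" for i \<zeta>
  proof -
    have "section_sq (\<Phi> i) \<zeta> \<le> (\<integral>\<^sup>+ r. (of_nat i)\<^sup>2 * indicator (\<Omega> i) r \<partial>M)"
      unfolding section_sq_def by (intro nn_integral_mono) (auto simp: \<Phi>_def split: split_indicator intro!: power_mono)
    also have "\<dots> = (of_nat i)\<^sup>2 * emeasure M (\<Omega> i)"
      by (simp add: nn_integral_cmult)
    also have "\<dots> = ennreal (enn2real ((of_nat i)\<^sup>2 * emeasure M (\<Omega> i)))"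
      using \<Omega>(3)[of i] by (intro ennreal_enn2real[symmetric]) (auto simp: ennreal_mult_less_top power_less_top_ennreal less_top of_nat_less_top)
    finally show ?thesis .
  qed
  have trunc: "(\<integral>\<^sup>+ \<zeta>. epowr (section_sq (\<Phi> i) \<zeta>) (p / 2) \<partial>S) \<le> epowr (ennreal (A * max (sqrt p) (sqrt (conj_exp p)))) p" for i
    by (rule truncated_bound[OF p _ _ F _ bdd]) (auto simp: \<Phi>_def split: split_indicator)
  have sqSUP: "section_sq (kernel_op F) \<zeta> = (SUP i. section_sq (\<Phi> i) \<zeta>)" if \<zeta>: "\<zeta> \<in> space S" for \<zeta>
  proof -
    have [measurable]: "(\<lambda>r. \<Phi> i (\<zeta>, r)) \<in> borel_measurable M" for i
      by (rule measurable_Pair2[OF _ \<zeta>]) measurable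
    have "section_sq (kernel_op F) \<zeta> = (\<integral>\<^sup>+ r. (SUP i. (\<Phi> i (\<zeta>, r))\<^sup>2) \<partial>M)"
      unfolding section_sq_def by (intro nn_integral_cong) (simp add: sup)
    also have "\<dots> = (SUP i. section_sq (\<Phi> i) \<zeta>)"
      unfolding section_sq_def
      by (rule nn_integral_monotone_convergence_SUP)
         (auto simp: incseq_def le_fun_def intro!: power_mono mono)
    finally show ?thesis .
  qed
  have "(\<integral>\<^sup>+ \<zeta>. epowr (section_sq (kernel_op F) \<zeta>) (p / 2) \<partial>S) = (\<integral>\<^sup>+ \<zeta>. (SUP i. epowr (section_sq (\<Phi> i) \<zeta>) (p / 2)) \<partial>S)"
    using p by (intro nn_integral_cong) (simp add: sqSUP epowr_SUP)
  also have "\<dots> = (SUP i. \<integral>\<^sup>+ \<zeta>. epowr (section_sq (\<Phi> i) \<zeta>) (p / 2) \<partial>S)"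
    using p by (intro nn_integral_monotone_convergence_SUP)
       (auto simp: incseq_def le_fun_def section_sq_def intro!: epowr_mono nn_integral_mono power_mono mono)
  also have "\<dots> \<le> epowr (ennreal (A * max (sqrt p) (sqrt (conj_exp p)))) p"
    by (intro SUP_least trunc)
  finally show ?thesis .
qed

theorem kernel_op_bound:
  assumes p: "1 < p" and [measurable]: "F \<in> borel_measurable X"
  shows "(\<integral>\<^sup>+ \<zeta>. epowr (section_sq (kernel_op F) \<zeta>) (p / 2) \<partial>S)
    \<le> epowr (ennreal (A * max (sqrt p) (sqrt (conj_exp p)))) p * (\<integral>\<^sup>+ \<zeta>. epowr (section_sq F \<zeta>) (p / 2) \<partial>S)"
    (is "?L \<le> ?K * ?I")
proof -
  have scaled: "?L \<le> ?K * ennreal e" if e: "0 < e" "?I \<le> ennreal e" for e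
  proof -
    (* scale F to norm at most 1; e rather than the integral itself, to allow for a vanishing integral *)
    define t where "t = e powr (- 1 / p)"
    have "t powr p = e powr - 1" using p by (simp only: t_def powr_powr) simp
    then have t: "0 < t" "t powr p = 1 / e" using e by (auto simp: t_def powr_minus_divide)
    have hom: "(\<integral>\<^sup>+ \<zeta>. epowr (section_sq (\<lambda>x. ennreal t * H x) \<zeta>) (p / 2) \<partial>S) = ennreal (1 / e) * (\<integral>\<^sup>+ \<zeta>. epowr (section_sq H \<zeta>) (p / 2) \<partial>S)"
      if [measurable]: "H \<in> borel_measurable X" for H
    proof -
      have "epowr (section_sq (\<lambda>x. ennreal t * H x) \<zeta>) (p / 2) = ennreal (1 / e) * epowr (section_sq H \<zeta>) (p / 2)"
        if \<zeta>: "\<zeta> \<in> space S" for \<zeta>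
      proof -
        have "(\<lambda>r. H (\<zeta>, r)) \<in> borel_measurable M"
          by (rule measurable_Pair2[OF _ \<zeta>]) measurable
        then have "section_sq (\<lambda>x. ennreal t * H x) \<zeta> = (ennreal t)\<^sup>2 * section_sq H \<zeta>"
          by (simp add: section_sq_def power_mult_distrib nn_integral_cmult)
        moreover have "epowr ((ennreal t)\<^sup>2) (p / 2) = ennreal (1 / e)"
        proof -
          have "epowr ((ennreal t)\<^sup>2) (p / 2) = epowr (ennreal t) p"
            by (simp only: epowr_power2[symmetric] epowr_epowr) simp
          then show ?thesis using t by (simp add: epowr_ennreal)
        qed
        ultimately show ?thesis by (simp add: epowr_mult)
      qed
      then show ?thesis
        by (subst nn_integral_cmult[symmetric], measurable) (rule nn_integral_cong, simp)
    qed
    have opt: "kernel_op (\<lambda>x. ennreal t * F x) x = ennreal t * kernel_op F x" if "x \<in> space X" for x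
      using k_section_measurable[OF that]
      by (simp add: kernel_op_def mult.left_commute[of _ "ennreal t"] nn_integral_cmult)
    have "ennreal (1 / e) * ?L = (\<integral>\<^sup>+ \<zeta>. epowr (section_sq (\<lambda>x. ennreal t * kernel_op F x) \<zeta>) (p / 2) \<partial>S)"
      by (rule hom[symmetric]) measurable
    also have "\<dots> = (\<integral>\<^sup>+ \<zeta>. epowr (section_sq (kernel_op (\<lambda>x. ennreal t * F x)) \<zeta>) (p / 2) \<partial>S)"
      unfolding section_sq_def by (intro nn_integral_cong arg_cong2[where f=epowr] refl) (simp add: opt space_pair_measure)
    also have "\<dots> \<le> ?K"
    proof (rule kernel_op_bound_normalized[OF p])
      have "(\<integral>\<^sup>+ \<zeta>. epowr (section_sq (\<lambda>x. ennreal t * F x) \<zeta>) (p / 2) \<partial>S) = ennreal (1 / e) * ?I"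
        by (rule hom) measurable
      also have "\<dots> \<le> ennreal (1 / e) * ennreal e"
        by (intro mult_left_mono e) auto
      also have "\<dots> = 1" using e by (simp flip: ennreal_mult)
      finally show "(\<integral>\<^sup>+ \<zeta>. epowr (section_sq (\<lambda>x. ennreal t * F x) \<zeta>) (p / 2) \<partial>S) \<le> 1" .
    qed measurable
    finally have "ennreal e * (ennreal (1 / e) * ?L) \<le> ennreal e * ?K"
      by (intro mult_left_mono) auto
    then show ?thesis using e
      by (simp flip: mult.assoc ennreal_mult) (simp add: mult.commute)
  qed
  define K where "K = A * max (sqrt p) (sqrt (conj_exp p))"
  have K: "0 < K" using A_pos p unfolding K_def by (intro mult_pos_pos) (auto simp: less_max_iff_disj)
  show ?thesis
  proof (cases ?I)
    case top
    have "ennreal K \<noteq> 0" using K by (simp add: not_le)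
    then have "?K \<noteq> 0" unfolding K_def[symmetric] by (simp only: epowr_eq_0_iff not_False_eq_True)
    then show ?thesis by (simp add: top ennreal_mult_top)
  next
    case (real i)
    show ?thesis
    proof (cases "i = 0")
      case True
      have "?L \<le> 0"
      proof (rule ennreal_le_epsilon)
        fix e :: real assume "0 < e"
        have "?L \<le> ?K * ennreal (e / K powr p)"
          by (rule scaled) (use \<open>0 < e\<close> K real True in auto)
        also have "\<dots> = ennreal e"
          using K \<open>0 < e\<close> by (simp add: K_def[symmetric] epowr_ennreal flip: ennreal_mult)
        finally show "?L \<le> 0 + ennreal e" by simp
      qed
      then show ?thesis by simp
    next
      case False
      then show ?thesis using scaled[of i] real by simp
    qed
  qed
qed

end

section \<open>The maximal function for a quasi-metric\<close>

text \<open>A probability space with a quasi-metric of diameter at most \<open>2\<close> whose balls of radius \<open>t\<close> have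
  measure \<open>O(t\<^sup>N)\<close>. The quasi-metric need only behave on a set \<open>\<Omega>\<close> of full measure, since the surface
  measure lives on the whole of \<open>\<complex>\<^sup>n\<close>. An upper bound for the measure of balls suffices because the
  maximal function divides by \<open>t\<^sup>N\<close> and not by the measure of the ball.\<close>

locale cap_space = prob_space S for S :: "'s measure" +
  fixes \<Omega> :: "'s set" and d :: "'s \<Rightarrow> 's \<Rightarrow> real" and N :: nat and C :: real
  assumes \<Omega>_sets [measurable]: "\<Omega> \<in> sets S"
    and AE_\<Omega>: "AE x in S. x \<in> \<Omega>"
    and d_measurable [measurable]: "(\<lambda>(x, y). d x y) \<in> borel_measurable (S \<Otimes>\<^sub>M S)"
    and d_sym: "d x y = d y x"
    and d_le_2: "x \<in> \<Omega> \<Longrightarrow> y \<in> \<Omega> \<Longrightarrow> d x y \<le> 2"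
    and d_quasi_triangle: "x \<in> \<Omega> \<Longrightarrow> y \<in> \<Omega> \<Longrightarrow> z \<in> \<Omega> \<Longrightarrow> d x z \<le> 2 * (d x y + d y z)"
    and C_nonneg: "0 \<le> C"
    and emeasure_cap: "x \<in> \<Omega> \<Longrightarrow> 0 < t \<Longrightarrow> emeasure S {y\<in>\<Omega>. d x y < t} \<le> ennreal (C * t ^ N)"
begin

definition cap :: "'s \<Rightarrow> real \<Rightarrow> 's set" where
  "cap x t = {y\<in>\<Omega>. d x y < t}"

text \<open>Dyadic radii make the maximal function a countable supremum, hence measurable; they start at \<open>4\<close>,
  beyond the diameter.\<close>

definition radius :: "nat \<Rightarrow> real" where
  "radius k = 4 / 2 ^ k"

definition maximal_fun :: "('s \<Rightarrow> ennreal) \<Rightarrow> 's \<Rightarrow> ennreal" where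
  "maximal_fun h x = (SUP k. ennreal (1 / radius k ^ N) * (\<integral>\<^sup>+ y. h y * indicator (cap x (radius k)) y \<partial>S))"

lemma radius_pos [simp]: "0 < radius k" "0 \<le> radius k" "radius k \<noteq> 0" by (simp_all add: radius_def)

lemma \<Omega>_subset: "\<Omega> \<subseteq> space S" using sets.sets_into_space[OF \<Omega>_sets] .

lemma cap_in_sets [measurable]: "x \<in> \<Omega> \<Longrightarrow> cap x t \<in> sets S"
proof -
  assume "x \<in> \<Omega>"
  then have [measurable]: "d x \<in> borel_measurable S"
    using measurable_Pair2[OF d_measurable, of x] \<Omega>_subset by auto
  have "cap x t = {y \<in> space S. y \<in> \<Omega> \<and> d x y < t}" using \<Omega>_subset by (auto simp: cap_def)
  also have "\<dots> \<in> sets S" by measurable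
  finally show ?thesis .
qed

lemma cap_integral_measurable [measurable]:
  assumes [measurable]: "h \<in> borel_measurable S"
  shows "(\<lambda>x. \<integral>\<^sup>+ y. h y * indicator (cap x t) y \<partial>S) \<in> borel_measurable S"
proof -
  have "(\<lambda>x. \<integral>\<^sup>+ y. h y * (if y \<in> \<Omega> \<and> d x y < t then 1 else 0) \<partial>S) \<in> borel_measurable S"
    by measurable
  then show ?thesis by (simp add: cap_def indicator_def of_bool_def)
qed

lemma maximal_fun_measurable [measurable]:
  assumes [measurable]: "h \<in> borel_measurable S"
  shows "maximal_fun h \<in> borel_measurable S"
  unfolding maximal_fun_def by measurable

lemma superlevel_sets [measurable]:
  assumes [measurable]: "h \<in> borel_measurable S"
  shows "{x\<in>\<Omega>. a < maximal_fun h x} \<in> sets S"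
proof -
  have "{x\<in>\<Omega>. a < maximal_fun h x} = {x\<in>space S. x \<in> \<Omega> \<and> a < maximal_fun h x}"
    using \<Omega>_subset by auto
  also have "\<dots> \<in> sets S" by measurable
  finally show ?thesis .
qed

lemma disjoint_caps_integral_le:
  assumes [measurable]: "h \<in> borel_measurable S"
    and D: "finite D" "fst ` D \<subseteq> \<Omega>" "disjoint_family_on (\<lambda>(x, k). cap x (radius k)) D"
  shows "(\<Sum>(x, k)\<in>D. \<integral>\<^sup>+ y. h y * indicator (cap x (radius k)) y \<partial>S) \<le> (\<integral>\<^sup>+ y. h y \<partial>S)"
proof -
  have "(\<Sum>(x, k)\<in>D. \<integral>\<^sup>+ y. h y * indicator (cap x (radius k)) y \<partial>S)
      = (\<integral>\<^sup>+ y. (\<Sum>(x, k)\<in>D. h y * indicator (cap x (radius k)) y) \<partial>S)"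
    using D(2) by (subst nn_integral_sum) (auto simp: case_prod_beta image_subset_iff)
  also have "\<dots> \<le> (\<integral>\<^sup>+ y. h y \<partial>S)"
  proof (rule nn_integral_mono)
    fix y
    have "(\<Sum>(x, k)\<in>D. h y * indicator (cap x (radius k)) y) = h y * indicator (\<Union>(x, k)\<in>D. cap x (radius k)) y"
    proof -
      have "(indicator (\<Union>(x, k)\<in>D. cap x (radius k)) y :: ennreal) = (\<Sum>(x, k)\<in>D. indicator (cap x (radius k)) y)"
        using indicator_UN_disjoint[OF D(1,3), of y] by (simp add: case_prod_beta)
      then show ?thesis by (simp add: sum_distrib_left case_prod_beta)
    qed
    also have "\<dots> \<le> h y" by (simp split: split_indicator)
    finally show "(\<Sum>(x, k)\<in>D. h y * indicator (cap x (radius k)) y) \<le> h y" .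
  qed
  finally show ?thesis .
qed

text \<open>Vitali's greedy selection, one dyadic radius at a time from the largest down: to the caps already
  selected add a disjoint family of caps of the next radius of maximal cardinality. Cardinalities are
  bounded, because each cap carries a fixed amount of the finite integral of \<open>h\<close>. Every cap not
  selected then meets a selected one of at least its own radius.\<close>

lemma vitali_caps:
  assumes [measurable]: "h \<in> borel_measurable S" and h: "(\<integral>\<^sup>+ y. h y \<partial>S) < \<infinity>" and l: "0 < l"
  defines "B \<equiv> \<lambda>K. {(x, k). x \<in> \<Omega> \<and> k < K \<and> ennreal (l * radius k ^ N) < (\<integral>\<^sup>+ y. h y * indicator (cap x (radius k)) y \<partial>S)}"
  shows "\<exists>D. finite D \<and> D \<subseteq> B K \<and> disjoint_family_on (\<lambda>(x, k). cap x (radius k)) D \<and>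
    (\<forall>(x, k)\<in>B K. \<exists>(y, j)\<in>D. j \<le> k \<and> cap x (radius k) \<inter> cap y (radius j) \<noteq> {})"
proof (induction K)
  case 0
  show ?case by (rule exI[of _ "{}"]) (auto simp: B_def disjoint_family_on_def)
next
  case (Suc K)
  then obtain D where D: "finite D" "D \<subseteq> B K" "disjoint_family_on (\<lambda>(x, k). cap x (radius k)) D"
    and cover': "\<forall>(x, k)\<in>B K. \<exists>(y, j)\<in>D. j \<le> k \<and> cap x (radius k) \<inter> cap y (radius j) \<noteq> {}"
    by (elim exE conjE) (rule that)
  have cover: "\<exists>(y, j)\<in>D. j \<le> k \<and> cap x (radius k) \<inter> cap y (radius j) \<noteq> {}" if "(x, k) \<in> B K" for x k
    using bspec[OF cover' that] by simp
  define P where "P E \<longleftrightarrow> finite E \<and> E \<subseteq> {(x, k)\<in>B (Suc K). k = K} \<and>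
    disjoint_family_on (\<lambda>(x, k). cap x (radius k)) (D \<union> E)" for E
  define m where "m = l * radius K ^ N"
  have m: "0 < m" using l by (simp add: m_def)
  obtain H where H: "(\<integral>\<^sup>+ y. h y \<partial>S) = ennreal H" "0 \<le> H" using h by (cases "\<integral>\<^sup>+ y. h y \<partial>S") auto
  (* each cap of E carries more than m of the total H *)
  have bound: "card E \<le> nat \<lceil>H / m\<rceil>" if "P E" for E
  proof -
    have E: "finite E" "E \<subseteq> {(x, k)\<in>B (Suc K). k = K}" "disjoint_family_on (\<lambda>(x, k). cap x (radius k)) E"
      using that by (auto simp: P_def disjoint_family_on_def)
    have "of_nat (card E) * ennreal m = (\<Sum>(x, k)\<in>E. ennreal m)" by simp
    also have "\<dots> \<le> (\<Sum>(x, k)\<in>E. \<integral>\<^sup>+ y. h y * indicator (cap x (radius k)) y \<partial>S)"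
      using E(2) by (intro sum_mono) (auto simp: B_def m_def less_imp_le)
    also have "\<dots> \<le> ennreal H"
      using E by (subst H(1)[symmetric], intro disjoint_caps_integral_le) (auto simp: B_def)
    finally have "real (card E) * m \<le> H"
      using m H by (simp add: ennreal_of_nat_eq_real_of_nat flip: ennreal_mult)
    then have "real (card E) \<le> H / m" using m by (simp add: field_simps)
    then show ?thesis by linarith
  qed
  have "P {}" using D by (simp add: P_def)
  then obtain E where E: "P E" and max: "\<And>E'. P E' \<Longrightarrow> card E' \<le> card E"
    using ex_has_greatest_nat[of P "{}" card "Suc (nat \<lceil>H / m\<rceil>)"] bound
    by (auto simp: less_Suc_eq_le)
  have BS: "B (Suc K) = B K \<union> {(x, k)\<in>B (Suc K). k = K}"
    by (auto simp: B_def less_Suc_eq)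
  have "\<exists>(y, j)\<in>D \<union> E. j \<le> k \<and> cap x (radius k) \<inter> cap y (radius j) \<noteq> {}" if xk: "(x, k) \<in> B (Suc K)" for x k
  proof (cases "(x, k) \<in> B K")
    case True
    then show ?thesis using cover[OF True] by blast
  next
    case False
    then have k: "k = K" using xk by (auto simp: B_def)
    show ?thesis
    proof (rule ccontr)
      (* otherwise the cap could be added to E, against maximality *)
      assume *: "\<not> ?thesis"
      have jK: "j \<le> K" if "(y, j) \<in> D \<union> E" for y j
        using that D(2) E by (auto simp: P_def B_def)
      have dis: "cap x (radius K) \<inter> cap y (radius j) = {}" if "(y, j) \<in> D \<union> E" for y j
        using * jK[OF that] that k by blast
      have ne: "cap x (radius K) \<noteq> {}"
      proof
        assume "cap x (radius K) = {}"
        then show False using xk k by (simp add: B_def)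
      qed
      then have "(x, K) \<notin> D \<union> E" using dis[of x K] by auto
      moreover have "P (insert (x, K) E)"
        using E xk k dis unfolding P_def
        by (auto simp: disjoint_family_on_def)
      ultimately show False using max[of "insert (x, K) E"] E by (auto simp: P_def)
    qed
  qed
  then have "\<forall>(x, k)\<in>B (Suc K). \<exists>(y, j)\<in>D \<union> E. j \<le> k \<and> cap x (radius k) \<inter> cap y (radius j) \<noteq> {}"
    by blast
  moreover have "finite (D \<union> E)" "disjoint_family_on (\<lambda>(x, k). cap x (radius k)) (D \<union> E)"
    using D(1) E by (simp_all add: P_def)
  moreover have "D \<union> E \<subseteq> B (Suc K)"
  proof -
    have "B K \<subseteq> B (Suc K)" by (auto simp: B_def)
    moreover have "E \<subseteq> B (Suc K)" using E by (auto simp: P_def)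
    ultimately show ?thesis using D(2) by (meson Un_least subset_trans)
  qed
  ultimately show ?case by (intro exI[of _ "D \<union> E"] conjI)
qed

text \<open>The constant in the quasi-triangle inequality is \<open>2\<close>, so if a cap meets another one whose radius \<open>r\<close> is at
  least its own, then the two centers have distance less than \<open>2 (r + r)\<close>; hence the selected caps, enlarged by a factor
  above four, cover the superlevel set.\<close>

lemma weak_type:
  assumes [measurable]: "h \<in> borel_measurable S" and l: "0 < l"
  shows "ennreal l * emeasure S {x\<in>\<Omega>. ennreal l < maximal_fun h x} \<le> ennreal (C * 5 ^ N) * (\<integral>\<^sup>+ y. h y \<partial>S)"
proof (cases "(\<integral>\<^sup>+ y. h y \<partial>S) < \<infinity>")
  case False
  show ?thesis
  proof (cases "C = 0")
    case True
    have "emeasure S {y\<in>\<Omega>. d x y < 3} \<le> 0" if "x \<in> \<Omega>" for x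
      using emeasure_cap[OF that, of 3] True by simp
    moreover have "{y\<in>\<Omega>. d x y < 3} = \<Omega>" if "x \<in> \<Omega>" for x
      using d_le_2[OF that] by force
    moreover have "emeasure S \<Omega> = 1" using emeasure_eq_1_AE[OF \<Omega>_sets AE_\<Omega>] .
    ultimately have "\<Omega> = {}" by force
    then show ?thesis by simp
  next
    case nz: False
    then have "ennreal (C * 5 ^ N) * (\<integral>\<^sup>+ y. h y \<partial>S) = top"
      using False C_nonneg by (simp add: ennreal_mult_eq_top_iff less_top[symmetric])
    then show ?thesis by (simp only: top_greatest)
  qed
next
  case True
  define E where "E K = {x\<in>\<Omega>. \<exists>k<K. ennreal (l * radius k ^ N) < (\<integral>\<^sup>+ y. h y * indicator (cap x (radius k)) y \<partial>S)}" for K :: nat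
  have [measurable]: "E K \<in> sets S" for K
  proof -
    have "E K = {x\<in>space S. x \<in> \<Omega> \<and> (\<exists>k\<in>{..<K}. ennreal (l * radius k ^ N) < (\<integral>\<^sup>+ y. h y * indicator (cap x (radius k)) y \<partial>S))}"
      using \<Omega>_subset by (auto simp: E_def)
    also have "\<dots> \<in> sets S" by measurable
    finally show ?thesis .
  qed
  (* E K: the level is exceeded at one of the first K radii, which makes the selection finite *)
  have un: "{x\<in>\<Omega>. ennreal l < maximal_fun h x} = (\<Union>K. E K)"
  proof -
    have "ennreal l < ennreal (1 / radius k ^ N) * I \<longleftrightarrow> ennreal (l * radius k ^ N) < I" for k I
    proof (cases I)
      case (real i)
      then show ?thesis using l by (simp add: ennreal_less_iff field_simps flip: ennreal_mult)
    next
      case top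
      have "ennreal (1 / radius k ^ N) * top = top" by (simp add: ennreal_mult_top)
      then show ?thesis using top by simp
    qed
    then show ?thesis
      by (auto simp: maximal_fun_def E_def less_SUP_iff)
  qed
  have "emeasure S (E K) \<le> ennreal (C * 5 ^ N / l) * (\<integral>\<^sup>+ y. h y \<partial>S)" for K
  proof -
    let ?I = "\<lambda>x k. \<integral>\<^sup>+ y. h y * indicator (cap x (radius k)) y \<partial>S"
    obtain D where D: "finite D" "disjoint_family_on (\<lambda>(x, k). cap x (radius k)) D"
      and DB: "\<And>x k. (x, k) \<in> D \<Longrightarrow> x \<in> \<Omega> \<and> ennreal (l * radius k ^ N) < ?I x k"
      and cover: "\<And>x k. x \<in> \<Omega> \<Longrightarrow> k < K \<Longrightarrow> ennreal (l * radius k ^ N) < ?I x k \<Longrightarrow>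
         \<exists>(y, j)\<in>D. j \<le> k \<and> cap x (radius k) \<inter> cap y (radius j) \<noteq> {}"
    proof -
      from vitali_caps[OF assms(1) True l, of K] obtain D
        where D: "finite D" "disjoint_family_on (\<lambda>(x, k). cap x (radius k)) D"
        and DB: "D \<subseteq> {(x, k). x \<in> \<Omega> \<and> k < K \<and> ennreal (l * radius k ^ N) < ?I x k}"
        and cover: "\<forall>(x, k)\<in>{(x, k). x \<in> \<Omega> \<and> k < K \<and> ennreal (l * radius k ^ N) < ?I x k}.
           \<exists>(y, j)\<in>D. j \<le> k \<and> cap x (radius k) \<inter> cap y (radius j) \<noteq> {}"
        by (elim exE conjE) (rule that)
      show ?thesis
        by (rule that[OF D]) (use DB bspec[OF cover] in auto)
    qed
    have sub: "E K \<subseteq> (\<Union>(y, j)\<in>D. cap y (5 * radius j))"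
    proof
      fix x assume "x \<in> E K"
      then obtain k where x: "x \<in> \<Omega>" "k < K" "ennreal (l * radius k ^ N) < ?I x k" by (auto simp: E_def)
      from cover[OF x] obtain y j z where yj: "(y, j) \<in> D" "j \<le> k" and z: "z \<in> cap x (radius k)" "z \<in> cap y (radius j)"
        by blast
      have "radius k \<le> radius j" using yj(2) by (auto simp: radius_def intro!: divide_left_mono power_increasing)
      moreover have "d y x \<le> 2 * (d y z + d z x)"
        using DB[OF yj(1)] x z by (intro d_quasi_triangle) (auto simp: cap_def)
      ultimately have "d y x \<le> 2 * (d y z + d x z)" "d x z < radius j" "d y z < radius j"
        using z by (auto simp: cap_def d_sym[of z x])
      then have "d y x < 5 * radius j" using radius_pos[of j] by (smt (verit))
      then show "x \<in> (\<Union>(y, j)\<in>D. cap y (5 * radius j))" using yj x by (auto simp: cap_def)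
    qed
    have "emeasure S (E K) \<le> emeasure S (\<Union>(y, j)\<in>D. cap y (5 * radius j))"
      using DB by (intro emeasure_mono[OF sub] sets.finite_UN D) auto
    also have "\<dots> \<le> (\<Sum>(y, j)\<in>D. emeasure S (cap y (5 * radius j)))"
    proof -
      have "(\<lambda>(y, j). cap y (5 * radius j)) ` D \<subseteq> sets S" using DB by auto
      from emeasure_subadditive_finite[OF D(1) this] show ?thesis by (simp add: case_prod_beta)
    qed
    also have "\<dots> \<le> (\<Sum>(y, j)\<in>D. ennreal (C * 5 ^ N / l) * ?I y j)"
    proof (rule sum_mono, clarify)
      fix y j assume yj: "(y, j) \<in> D"
      have "emeasure S (cap y (5 * radius j)) \<le> ennreal (C * (5 * radius j) ^ N)"
        using emeasure_cap[of y "5 * radius j"] DB[OF yj] by (simp add: cap_def)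
      also have "\<dots> = ennreal (C * 5 ^ N / l) * ennreal (l * radius j ^ N)"
        using l C_nonneg by (simp add: power_mult_distrib less_imp_le flip: ennreal_mult)
      also have "\<dots> \<le> ennreal (C * 5 ^ N / l) * ?I y j"
        using DB[OF yj] by (intro mult_left_mono) auto
      finally show "emeasure S (cap y (5 * radius j)) \<le> ennreal (C * 5 ^ N / l) * ?I y j" .
    qed
    also have "\<dots> = ennreal (C * 5 ^ N / l) * (\<Sum>(y, j)\<in>D. ?I y j)"
      by (simp add: sum_distrib_left case_prod_beta)
    also have "\<dots> \<le> ennreal (C * 5 ^ N / l) * (\<integral>\<^sup>+ y. h y \<partial>S)"
      using DB D by (intro mult_left_mono disjoint_caps_integral_le) auto
    finally show ?thesis .
  qed
  moreover have "incseq E" by (auto simp: incseq_def E_def intro: less_le_trans)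
  ultimately have "emeasure S (\<Union>K. E K) \<le> ennreal (C * 5 ^ N / l) * (\<integral>\<^sup>+ y. h y \<partial>S)"
    by (subst SUP_emeasure_incseq[symmetric]) (auto intro: SUP_least)
  then have "ennreal l * emeasure S (\<Union>K. E K) \<le> ennreal l * (ennreal (C * 5 ^ N / l) * (\<integral>\<^sup>+ y. h y \<partial>S))"
    by (rule mult_left_mono) simp
  also have "\<dots> = ennreal (C * 5 ^ N) * (\<integral>\<^sup>+ y. h y \<partial>S)"
    using l C_nonneg by (simp flip: mult.assoc ennreal_mult)
  finally show ?thesis by (simp add: un)
qed

text \<open>The part of \<open>h\<close> below the level \<open>l\<close> contributes at most \<open>C l\<close> to any average. This replaces the
  \<open>L\<^sup>\<infinity>\<close> endpoint in the interpolation below.\<close>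

lemma maximal_fun_truncate:
  assumes [measurable]: "h \<in> borel_measurable S" and x: "x \<in> \<Omega>" and l: "0 \<le> l"
  shows "maximal_fun h x \<le> maximal_fun (\<lambda>y. h y * indicator {y. ennreal l < h y} y) x + ennreal (C * l)"
  unfolding maximal_fun_def
proof (rule SUP_least)
  fix k
  have [measurable]: "cap x t \<in> sets S" for t using x by simp
  let ?c = "ennreal (1 / radius k ^ N)"
  let ?h = "\<lambda>y. h y * indicator {y. ennreal l < h y} y"
  have "?c * (\<integral>\<^sup>+ y. h y * indicator (cap x (radius k)) y \<partial>S)
      \<le> ?c * (\<integral>\<^sup>+ y. ?h y * indicator (cap x (radius k)) y + ennreal l * indicator (cap x (radius k)) y \<partial>S)"
    by (intro mult_left_mono nn_integral_mono) (auto split: split_indicator)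
  also have "\<dots> = ?c * (\<integral>\<^sup>+ y. ?h y * indicator (cap x (radius k)) y \<partial>S) + ?c * (ennreal l * emeasure S (cap x (radius k)))"
    by (simp add: nn_integral_add nn_integral_cmult distrib_left)
  also have "\<dots> \<le> ?c * (\<integral>\<^sup>+ y. ?h y * indicator (cap x (radius k)) y \<partial>S) + ?c * (ennreal l * ennreal (C * radius k ^ N))"
    using emeasure_cap[OF x, of "radius k"] by (intro add_left_mono mult_left_mono) (auto simp: cap_def)
  also have "?c * (ennreal l * ennreal (C * radius k ^ N)) = ennreal (C * l)"
    using l C_nonneg by (simp add: less_imp_le mult.commute flip: ennreal_mult)
  also have "?c * (\<integral>\<^sup>+ y. ?h y * indicator (cap x (radius k)) y \<partial>S)
      \<le> (SUP k. ennreal (1 / radius k ^ N) * (\<integral>\<^sup>+ y. ?h y * indicator (cap x (radius k)) y \<partial>S))"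
    by (rule SUP_upper) simp
  finally show "?c * (\<integral>\<^sup>+ y. h y * indicator (cap x (radius k)) y \<partial>S)
     \<le> (SUP k. ennreal (1 / radius k ^ N) * (\<integral>\<^sup>+ y. ?h y * indicator (cap x (radius k)) y \<partial>S)) + ennreal (C * l)"
    by (simp add: add_right_mono)
qed

definition maximal_const :: real where
  "maximal_const = (C + 1) * (C * 5 ^ N + 1)"

text \<open>Marcinkiewicz interpolation between the weak type inequality and the trivial bound for bounded
  functions. If \<open>(C + 1) t < Mh\<close>, then the maximal function of the part of \<open>h\<close> above the level \<open>t\<close>
  exceeds \<open>t\<close>; insert this in the layer cake formula. The interpolation itself bounds the \<open>q\<close>-th power
  of the norm by \<open>q / (q - 1)\<close> and \<open>q\<close>-th powers of constants. Replacing
  \<open>q / (q - 1)\<close> by its \<open>q\<close>-th power is harmless as \<open>q \<rightarrow> 1\<close> and makes the bound homogeneous.\<close>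

lemma strong_type:
  assumes q: "1 < q" and [measurable]: "h \<in> borel_measurable S"
  shows "(\<integral>\<^sup>+ x. epowr (maximal_fun h x) q \<partial>S)
    \<le> epowr (ennreal (maximal_const * (q / (q - 1)))) q * (\<integral>\<^sup>+ x. epowr (h x) q \<partial>S)"
proof -
  interpret SL: pair_sigma_finite S lborel
    by unfold_locales
  define D where "D = C * 5 ^ N"
  define c where "c = C + 1"
  have c: "0 < c" "0 \<le> D" using C_nonneg by (auto simp: c_def D_def)
  let ?M = "maximal_fun h"
  let ?a = "\<lambda>t::real. ennreal (q * t powr (q - 1))"
  have scale: "ennreal t < ennreal (1 / c) * m \<longleftrightarrow> ennreal (c * t) < m" if "0 < t" for t m
  proof (cases m)
    case (real i)
    then show ?thesis using that c by (simp add: ennreal_less_iff field_simps flip: ennreal_mult)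
  next
    case top
    have "ennreal (1 / c) * top = top" using c by (simp add: ennreal_mult_top)
    then show ?thesis using top by simp
  qed
  have weak: "emeasure S {x\<in>\<Omega>. ennreal (c * t) < ?M x} \<le> ennreal (D / t) * (\<integral>\<^sup>+ x. h x * indicator {x. ennreal t < h x} x \<partial>S)"
    if t: "0 < t" for t
  proof -
    let ?h = "\<lambda>x. h x * indicator {x. ennreal t < h x} x"
    have "ennreal t < maximal_fun ?h x" if "x \<in> \<Omega>" "ennreal (c * t) < ?M x" for x
    proof (rule ccontr)
      assume "\<not> ennreal t < maximal_fun ?h x"
      then have "?M x \<le> ennreal t + ennreal (C * t)"
        using maximal_fun_truncate[OF assms(2) that(1), of t] t
        by (auto intro: order_trans add_right_mono simp: not_less)
      also have "\<dots> = ennreal (c * t)" using t C_nonneg by (simp add: c_def algebra_simps flip: ennreal_plus)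
      finally show False using that by simp
    qed
    then have "emeasure S {x\<in>\<Omega>. ennreal (c * t) < ?M x} \<le> emeasure S {x\<in>\<Omega>. ennreal t < maximal_fun ?h x}"
      by (intro emeasure_mono superlevel_sets) auto
    then have "emeasure S {x\<in>\<Omega>. ennreal (c * t) < ?M x} \<le> ennreal (1 / t) * (ennreal t * emeasure S {x\<in>\<Omega>. ennreal t < maximal_fun ?h x})"
      using t by (simp flip: mult.assoc ennreal_mult)
    also have "\<dots> \<le> ennreal (1 / t) * (ennreal D * (\<integral>\<^sup>+ x. ?h x \<partial>S))"
      unfolding D_def by (intro mult_left_mono weak_type t) auto
    also have "\<dots> = ennreal (D / t) * (\<integral>\<^sup>+ x. ?h x \<partial>S)"
      using t c by (simp flip: mult.assoc ennreal_mult)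
    finally show ?thesis .
  qed
  have "(\<integral>\<^sup>+ x. epowr (?M x) q \<partial>S) = (\<integral>\<^sup>+ x. epowr (ennreal c) q * epowr (ennreal (1 / c) * ?M x) q \<partial>S)"
  proof (rule nn_integral_cong)
    fix x
    have "?M x = ennreal c * (ennreal (1 / c) * ?M x)" using c by (simp flip: mult.assoc ennreal_mult)
    then show "epowr (?M x) q = epowr (ennreal c) q * epowr (ennreal (1 / c) * ?M x) q"
      by (metis epowr_mult)
  qed
  also have "\<dots> = epowr (ennreal c) q * (\<integral>\<^sup>+ x. epowr (ennreal (1 / c) * ?M x) q \<partial>S)"
    by (rule nn_integral_cmult) measurable
  also have "(\<integral>\<^sup>+ x. epowr (ennreal (1 / c) * ?M x) q \<partial>S)
     = (\<integral>\<^sup>+ x. \<integral>\<^sup>+ t. ?a t * indicator {t. 0 < t \<and> ennreal t < ennreal (1 / c) * ?M x} t \<partial>lborel \<partial>S)"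
    using q by (intro nn_integral_cong epowr_layer_cake) auto
  also have "\<dots> = (\<integral>\<^sup>+ x. \<integral>\<^sup>+ t. (if 0 < t \<and> ennreal (c * t) < ?M x \<and> x \<in> \<Omega> then ?a t else 0) \<partial>lborel \<partial>S)"
    by (rule nn_integral_cong_AE, rule eventually_mono[OF AE_\<Omega>], rule nn_integral_cong)
       (auto simp: scale split: split_indicator)
  also have "\<dots> = (\<integral>\<^sup>+ t. \<integral>\<^sup>+ x. (if 0 < t \<and> ennreal (c * t) < ?M x \<and> x \<in> \<Omega> then ?a t else 0) \<partial>S \<partial>lborel)"
    by (rule SL.Fubini'[symmetric]) measurable
  also have "\<dots> \<le> (\<integral>\<^sup>+ t. \<integral>\<^sup>+ x. (if 0 < t \<and> ennreal t < h x then ennreal (D * q * t powr (q - 2)) * h x else 0) \<partial>S \<partial>lborel)"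
  proof (rule nn_integral_mono)
    fix t :: real
    show "(\<integral>\<^sup>+ x. (if 0 < t \<and> ennreal (c * t) < ?M x \<and> x \<in> \<Omega> then ?a t else 0) \<partial>S)
      \<le> (\<integral>\<^sup>+ x. (if 0 < t \<and> ennreal t < h x then ennreal (D * q * t powr (q - 2)) * h x else 0) \<partial>S)"
    proof (cases "0 < t")
      case t: True
      have "(\<integral>\<^sup>+ x. (if 0 < t \<and> ennreal (c * t) < ?M x \<and> x \<in> \<Omega> then ?a t else 0) \<partial>S)
          = (\<integral>\<^sup>+ x. ?a t * indicator {x\<in>\<Omega>. ennreal (c * t) < ?M x} x \<partial>S)"
        using t by (intro nn_integral_cong) (auto split: split_indicator)
      also have "\<dots> = ?a t * emeasure S {x\<in>\<Omega>. ennreal (c * t) < ?M x}"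
        by (intro nn_integral_cmult_indicator superlevel_sets) simp
      also have "\<dots> \<le> ?a t * (ennreal (D / t) * (\<integral>\<^sup>+ x. h x * indicator {x. ennreal t < h x} x \<partial>S))"
        by (intro mult_left_mono weak t) auto
      also have "\<dots> = ennreal (q * t powr (q - 1) * (D / t)) * (\<integral>\<^sup>+ x. h x * indicator {x. ennreal t < h x} x \<partial>S)"
        using t q c by (subst ennreal_mult[of "q * t powr (q - 1)" "D / t"]) (auto simp: mult.assoc)
      also have "q * t powr (q - 1) * (D / t) = D * q * t powr (q - 2)"
      proof -
        have "t powr (q - 1) = t powr (q - 2) * t" using t powr_add[of t "q - 2" 1] by simp
        then show ?thesis using t by simp
      qed
      also have "ennreal (D * q * t powr (q - 2)) * (\<integral>\<^sup>+ x. h x * indicator {x. ennreal t < h x} x \<partial>S)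
         = (\<integral>\<^sup>+ x. (if 0 < t \<and> ennreal t < h x then ennreal (D * q * t powr (q - 2)) * h x else 0) \<partial>S)"
        using t by (subst nn_integral_cmult[symmetric], measurable) (rule nn_integral_cong, simp split: split_indicator)
      finally show ?thesis .
    qed simp
  qed
  also have "\<dots> = (\<integral>\<^sup>+ x. \<integral>\<^sup>+ t. (if 0 < t \<and> ennreal t < h x then ennreal (D * q * t powr (q - 2)) * h x else 0) \<partial>lborel \<partial>S)"
    by (rule SL.Fubini') measurable
  also have "\<dots> = (\<integral>\<^sup>+ x. ennreal (D * q / (q - 1)) * epowr (h x) q \<partial>S)"
  proof (rule nn_integral_cong)
    fix x
    have "(\<integral>\<^sup>+ t. (if 0 < t \<and> ennreal t < h x then ennreal (D * q * t powr (q - 2)) * h x else 0) \<partial>lborel)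
       = (\<integral>\<^sup>+ t. (ennreal (D * q / (q - 1)) * h x) * (ennreal ((q - 1) * t powr (q - 1 - 1)) * indicator {t. 0 < t \<and> ennreal t < h x} t) \<partial>lborel)"
    proof (rule nn_integral_cong)
      fix t :: real
      have "ennreal (D * q * t powr (q - 2)) = ennreal (D * q / (q - 1)) * ennreal ((q - 1) * t powr (q - 1 - 1))"
        using q c by (simp flip: ennreal_mult)
      then show "(if 0 < t \<and> ennreal t < h x then ennreal (D * q * t powr (q - 2)) * h x else 0)
         = (ennreal (D * q / (q - 1)) * h x) * (ennreal ((q - 1) * t powr (q - 1 - 1)) * indicator {t. 0 < t \<and> ennreal t < h x} t)"
        by (auto split: split_indicator simp: mult_ac)
    qed
    also have "\<dots> = ennreal (D * q / (q - 1)) * h x * epowr (h x) (q - 1)"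
      using q by (subst nn_integral_cmult) (auto simp: epowr_layer_cake)
    also have "\<dots> = ennreal (D * q / (q - 1)) * epowr (h x) q"
      using epowr_add[of "h x" 1 "q - 1"] by (simp add: mult.assoc)
    finally show "(\<integral>\<^sup>+ t. (if 0 < t \<and> ennreal t < h x then ennreal (D * q * t powr (q - 2)) * h x else 0) \<partial>lborel)
       = ennreal (D * q / (q - 1)) * epowr (h x) q" .
  qed
  also have "\<dots> = ennreal (D * q / (q - 1)) * (\<integral>\<^sup>+ x. epowr (h x) q \<partial>S)"
    by (rule nn_integral_cmult) measurable
  finally have "(\<integral>\<^sup>+ x. epowr (?M x) q \<partial>S) \<le> (epowr (ennreal c) q * ennreal (D * q / (q - 1))) * (\<integral>\<^sup>+ x. epowr (h x) q \<partial>S)"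
    by (simp add: mult.assoc mult_left_mono)
  also have "\<dots> \<le> epowr (ennreal (maximal_const * (q / (q - 1)))) q * (\<integral>\<^sup>+ x. epowr (h x) q \<partial>S)"
  proof (rule mult_right_mono)
    (* a number that is at least 1 is at most its q-th power *)
    have y1: "1 \<le> (D + 1) * (q / (q - 1))" 
      using q c mult_mono[of 1 "D + 1" 1 "q / (q - 1)"] by simp
    have "D * q / (q - 1) \<le> (D + 1) * (q / (q - 1))" using q by (simp add: field_simps)
    also have "\<dots> \<le> ((D + 1) * (q / (q - 1))) powr q"
    proof -
      have "0 \<le> (D + 1) * (q / (q - 1))" using y1 by linarith
      then show ?thesis using powr_mono[OF less_imp_le[OF q] y1] by (simp only: powr_one)
    qed
    finally have "epowr (ennreal c) q * ennreal (D * q / (q - 1)) \<le> epowr (ennreal c) q * epowr (ennreal ((D + 1) * (q / (q - 1)))) q"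
      using y1 by (intro mult_left_mono) (auto simp: epowr_ennreal intro: ennreal_leI)
    also have "\<dots> = epowr (ennreal c * ennreal ((D + 1) * (q / (q - 1)))) q" by (simp only: epowr_mult)
    also have "ennreal c * ennreal ((D + 1) * (q / (q - 1))) = ennreal (maximal_const * (q / (q - 1)))"
      using c y1 by (subst ennreal_mult[symmetric]) (auto simp: maximal_const_def c_def D_def mult.assoc)
    finally show "epowr (ennreal c) q * ennreal (D * q / (q - 1)) \<le> epowr (ennreal (maximal_const * (q / (q - 1)))) q" .
  qed simp
  finally show ?thesis .
qed

text \<open>Passing from arbitrary to dyadic radii costs \<open>2\<^sup>N\<close>. A cap of radius \<open>4\<close> or more is all of \<open>\<Omega>\<close>, which is
  also the largest dyadic cap.\<close>

lemma cap_integral_le: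
  assumes x: "x \<in> \<Omega>" and t: "0 < t"
  shows "(\<integral>\<^sup>+ y. h y * indicator (cap x t) y \<partial>S) \<le> ennreal ((2 * t) ^ N) * maximal_fun h x"
proof -
  obtain k where k: "cap x t \<subseteq> cap x (radius k)" "radius k \<le> 2 * t"
  proof (cases "t < 4")
    case True
    define k where "k = (LEAST k. radius k \<le> 2 * t)"
    obtain m where "inverse (2 ^ m) < t / 2"
      using real_arch_pow_inv[of "t / 2" "1 / 2"] t by (auto simp: power_one_over inverse_eq_divide)
    then have "radius m \<le> 2 * t" by (simp add: radius_def inverse_eq_divide)
    then have k1: "radius k \<le> 2 * t" unfolding k_def by (rule LeastI)
    have "t \<le> radius k"
    proof (cases k)
      case (Suc j)
      then have "\<not> radius j \<le> 2 * t" using not_less_Least[of j "\<lambda>k. radius k \<le> 2 * t"] by (simp add: k_def)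
      then show ?thesis using Suc by (simp add: radius_def field_simps)
    qed (use True in \<open>simp add: radius_def\<close>)
    then have "cap x t \<subseteq> cap x (radius k)" by (auto simp: cap_def)
    with k1 show ?thesis by (rule that[rotated])
  next
    case False
    have "cap x t \<subseteq> cap x (radius 0)" using d_le_2[OF x] by (force simp: cap_def radius_def)
    then show ?thesis by (rule that) (use False in \<open>simp add: radius_def\<close>)
  qed
  let ?I = "\<integral>\<^sup>+ y. h y * indicator (cap x (radius k)) y \<partial>S"
  have "(\<integral>\<^sup>+ y. h y * indicator (cap x t) y \<partial>S) \<le> ?I"
    using k(1) by (intro nn_integral_mono mult_left_mono) (auto split: split_indicator)
  also have "\<dots> = ennreal (radius k ^ N) * (ennreal (1 / radius k ^ N) * ?I)"
    by (simp add: less_imp_le flip: mult.assoc ennreal_mult)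
  also have "\<dots> \<le> ennreal ((2 * t) ^ N) * maximal_fun h x"
    unfolding maximal_fun_def
    by (intro mult_mono ennreal_leI power_mono k(2) SUP_upper) (auto simp: less_imp_le)
  finally show ?thesis .
qed

end

section \<open>Polar coordinates\<close>

text \<open>The Borel version of \<^const>\<open>ball_measure\<close>, as a measure on all of \<open>\<complex>\<^sup>n\<close>: products and images of Borel
  measures are easier to handle than restrictions of completed ones, and both integrate Borel functions
  in the same way.\<close>

definition borel_ball_measure :: "(complex ^ 'n) measure" where
  "borel_ball_measure = uniform_measure lborel (ball 0 1)"

lemma ball_volume:
  "emeasure lborel (ball 0 1 :: (complex ^ 'n) set) \<noteq> 0"
  "emeasure lborel (ball 0 1 :: (complex ^ 'n) set) \<noteq> top"
  "emeasure lborel (ball 0 1 :: (complex ^ 'n) set) < top"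
  using emeasure_lborel_ball_finite[of "0 :: complex ^ 'n" 1] content_ball_pos[of 1 "0 :: complex ^ 'n"]
  by (auto simp: measure_def)

lemma sets_borel_ball_measure [simp, measurable_cong]:
  "sets (borel_ball_measure :: (complex ^ 'n) measure) = sets borel"
  by (simp add: borel_ball_measure_def)

lemma space_borel_ball_measure [simp]: "space (borel_ball_measure :: (complex ^ 'n) measure) = UNIV"
  by (simp add: borel_ball_measure_def)

lemma prob_space_borel_ball_measure: "prob_space (borel_ball_measure :: (complex ^ 'n) measure)"
  unfolding borel_ball_measure_def by (rule prob_space_uniform_measure) (use ball_volume in auto)

lemma ball_measure_eq: "(ball_measure :: (complex ^ 'n) measure) =
   density (lebesgue_on (ball 0 1)) (\<lambda>x. indicator (ball 0 1) x / emeasure lborel (ball 0 1 :: (complex ^ 'n) set))"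
  by (simp add: ball_measure_def uniform_measure_def emeasure_restrict_space)

lemma nn_integral_ball_measure:
  fixes f :: "complex ^ 'n \<Rightarrow> ennreal"
  assumes f [measurable]: "f \<in> borel_measurable borel"
  shows "(\<integral>\<^sup>+ x. f x \<partial>ball_measure) = (\<integral>\<^sup>+ x. f x \<partial>borel_ball_measure)"
proof -
  let ?V = "emeasure lborel (ball 0 1 :: (complex ^ 'n) set)"
  have [measurable]: "f \<in> borel_measurable (lebesgue_on (ball 0 1))"
    by (intro measurable_restrict_space1 measurable_completion) simp
  have [measurable]: "(\<lambda>x :: complex ^ 'n. indicator (ball 0 1) x / ?V) \<in> borel_measurable (lebesgue_on (ball 0 1))"
    unfolding divide_ennreal_def
    by (intro measurable_restrict_space1 measurable_completion borel_measurable_times_ennreal borel_measurable_indicator) auto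
  have "(\<integral>\<^sup>+ x. f x \<partial>ball_measure) = (\<integral>\<^sup>+ x. indicator (ball 0 1) x / ?V * f x \<partial>lebesgue_on (ball 0 1))"
    unfolding ball_measure_eq by (subst nn_integral_density) auto
  also have "\<dots> = (\<integral>\<^sup>+ x. indicator (ball 0 1) x / ?V * f x \<partial>lborel)"
    by (subst nn_integral_restrict_space)
       (auto simp: nn_integral_completion intro!: nn_integral_cong split: split_indicator)
  also have "\<dots> = (\<integral>\<^sup>+ x. f x \<partial>borel_ball_measure)"
    unfolding borel_ball_measure_def uniform_measure_def
    by (subst nn_integral_density) (auto simp: divide_ennreal_def intro!: borel_measurable_times_ennreal borel_measurable_indicator)
  finally show ?thesis .
qed

lemma emeasure_borel_ball_measure:
  fixes A :: "(complex ^ 'n) set"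
  assumes "A \<in> sets borel"
  shows "emeasure borel_ball_measure A = emeasure lborel (ball 0 1 \<inter> A) / emeasure lborel (ball 0 1 :: (complex ^ 'n) set)"
  unfolding borel_ball_measure_def using assms by (intro emeasure_uniform_measure) auto

lemma sphere_measure_eq: "sphere_measure = distr borel_ball_measure borel (sgn :: complex ^ 'n \<Rightarrow> complex ^ 'n)"
proof (rule measure_eqI)
  fix A :: "(complex ^ 'n) set" assume "A \<in> sets sphere_measure"
  then have A [measurable]: "A \<in> sets borel" by (simp add: sphere_measure_def)
  have "emeasure sphere_measure A = (\<integral>\<^sup>+ x. indicator A x \<partial>sphere_measure)"
    by (rule nn_integral_indicator[symmetric]) (simp add: sphere_measure_def)
  also have "\<dots> = (\<integral>\<^sup>+ x. indicator A (sgn x) \<partial>ball_measure)"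
    unfolding sphere_measure_def by (rule nn_integral_distr[OF sgn_measurable_ball_measure]) simp
  also have "\<dots> = (\<integral>\<^sup>+ x. indicator A (sgn x) \<partial>borel_ball_measure)"
    by (rule nn_integral_ball_measure) measurable
  also have "\<dots> = (\<integral>\<^sup>+ x. indicator A x \<partial>distr borel_ball_measure borel (sgn :: complex ^ 'n \<Rightarrow> complex ^ 'n))"
    by (rule nn_integral_distr[symmetric]) auto
  also have "\<dots> = emeasure (distr borel_ball_measure borel (sgn :: complex ^ 'n \<Rightarrow> complex ^ 'n)) A"
    by (rule nn_integral_indicator) simp
  finally show "emeasure sphere_measure A = emeasure (distr borel_ball_measure borel (sgn :: complex ^ 'n \<Rightarrow> complex ^ 'n)) A" .
qed (simp add: sphere_measure_def)

lemma sets_sphere_measure [simp, measurable_cong]: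
  "sets (sphere_measure :: (complex ^ 'n) measure) = sets borel"
  by (simp add: sphere_measure_def)

lemma space_sphere_measure [simp]: "space (sphere_measure :: (complex ^ 'n) measure) = UNIV"
  by (simp add: sphere_measure_def)

lemma emeasure_lborel_scale:
  fixes A :: "(complex ^ 'n) set"
  assumes [measurable]: "A \<in> sets borel" and t: "0 < t"
  shows "emeasure lborel {z. (1 / t) *\<^sub>R z \<in> A} = ennreal (t ^ (2 * CARD('n))) * emeasure lborel A"
proof -
  have "emeasure lborel {z. (1 / t) *\<^sub>R z \<in> A} =
     emeasure (density (distr lborel borel (\<lambda>x. 0 + t *\<^sub>R x)) (\<lambda>_. \<bar>t\<bar> ^ DIM(complex ^ 'n))) {z. (1 / t) *\<^sub>R z \<in> A}"
    using t by (subst lborel_affine[of t 0]) auto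
  also have "\<dots> = ennreal (t ^ (2 * CARD('n))) * emeasure (distr lborel borel (\<lambda>x. t *\<^sub>R x)) {z. (1 / t) *\<^sub>R z \<in> A}"
    using t by (subst emeasure_density) (auto simp: nn_integral_cmult_indicator mult.commute[of 2])
  also have "emeasure (distr lborel borel (\<lambda>x. t *\<^sub>R x)) {z. (1 / t) *\<^sub>R z \<in> A} = emeasure lborel A"
    using t by (subst emeasure_distr) auto
  finally show ?thesis .
qed

text \<open>The measure of the inner integral in \<^const>\<open>Lp2_norm\<close>. Every neighbourhood of \<open>r = 1\<close> has infinite
  mass if \<open>n > 0\<close>, logarithmically.\<close>

definition radial_measure :: "nat \<Rightarrow> real measure" where
  "radial_measure n = density lborel (\<lambda>r. ennreal (2 * real n * r ^ (2 * n - 1) / (1 - r\<^sup>2)) * indicator {0..<1} r)"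

lemma sets_radial_measure [simp, measurable_cong]: "sets (radial_measure n) = sets borel"
  by (simp add: radial_measure_def)

lemma space_radial_measure [simp]: "space (radial_measure n) = UNIV"
  by (simp add: radial_measure_def)

lemma AE_radial_measure: "AE r in radial_measure n. 0 \<le> r \<and> r < 1"
  unfolding radial_measure_def by (subst AE_density) (auto split: split_indicator)

lemma sigma_finite_radial_measure: "sigma_finite_measure (radial_measure n)"
  unfolding radial_measure_def
  by (subst sigma_finite_measure.sigma_finite_iff_density_finite[OF sigma_finite_lborel]) (auto simp: ennreal_mult_eq_top_iff split: split_indicator)

text \<open>The finite radial factor of \<open>\<nu>\<close> itself; \<^const>\<open>radial_measure\<close> is this with density
  \<open>1 / (1 - r\<^sup>2)\<close>.\<close>

definition polar_radial :: "nat \<Rightarrow> real measure" where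
  "polar_radial n = density lborel (\<lambda>r. ennreal (2 * real n * r ^ (2 * n - 1)) * indicator {0..1} r)"

lemma sets_polar_radial [simp, measurable_cong]: "sets (polar_radial n) = sets borel"
  by (simp add: polar_radial_def)

lemma space_polar_radial [simp]: "space (polar_radial n) = UNIV"
  by (simp add: polar_radial_def)

lemma emeasure_polar_radial:
  assumes n: "0 < n"
  shows "emeasure (polar_radial n) {t<..} = (if t < 0 then 1 else if t < 1 then ennreal (1 - t ^ (2 * n)) else 0)"
proof -
  define s where "s = max 0 (min t 1)"
  have s: "0 \<le> s" "s \<le> 1" by (auto simp: s_def)
  have "emeasure (polar_radial n) {t<..} = (\<integral>\<^sup>+ r. ennreal (2 * real n * r ^ (2 * n - 1)) * indicator {0..1} r * indicator {t<..} r \<partial>lborel)"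
    unfolding polar_radial_def by (subst emeasure_density) auto
  also have "\<dots> = (\<integral>\<^sup>+ r. ennreal (2 * real n * r ^ (2 * n - 1)) * indicator {s..1} r \<partial>lborel)"
    by (rule nn_integral_cong_AE, rule eventually_mono[OF eventually_conj[OF AE_lborel_singleton[of t] AE_lborel_singleton[of 1]]])
       (auto simp: s_def split: split_indicator)
  also have "\<dots> = ennreal (1 ^ (2 * n) - s ^ (2 * n))"
  proof (rule nn_integral_FTC_Icc)
    fix x assume "x \<in> {s..1}"
    show "((\<lambda>r. r ^ (2 * n)) has_real_derivative 2 * real n * x ^ (2 * n - 1)) (at x)"
      using DERIV_pow[of "2 * n" x] by simp
  qed (use s in auto)
  finally show ?thesis using n by (auto simp: s_def min_def max_def)
qed

lemma finite_measure_polar_radial: "0 < n \<Longrightarrow> finite_measure (polar_radial n)"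
proof (rule finite_measureI)
  assume "0 < n"
  have "emeasure (polar_radial n) (space (polar_radial n)) = (\<integral>\<^sup>+ r. ennreal (2 * real n * r ^ (2 * n - 1)) * indicator {0..1} r \<partial>lborel)"
    unfolding polar_radial_def by (subst emeasure_density) auto
  also have "\<dots> \<le> (\<integral>\<^sup>+ r. ennreal (2 * real n) * indicator {0..1::real} r \<partial>lborel)"
  proof (rule nn_integral_mono)
    fix r :: real
    show "ennreal (2 * real n * r ^ (2 * n - 1)) * indicator {0..1} r \<le> ennreal (2 * real n) * indicator {0..1} r"
    proof (cases "0 \<le> r \<and> r \<le> 1")
      case True
      then have "2 * real n * r ^ (2 * n - 1) \<le> 2 * real n"
        by (intro mult_left_le power_le_one) auto
      then show ?thesis by (intro mult_right_mono ennreal_leI) auto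
    qed (auto simp: indicator_def)
  qed
  also have "\<dots> = ennreal (2 * real n)" by (subst nn_integral_cmult_indicator) auto
  also have "\<dots> < \<infinity>" by simp
  finally show "emeasure (polar_radial n) (space (polar_radial n)) \<noteq> \<infinity>" by simp
qed

text \<open>The cone over \<open>B\<close> up to radius \<open>t\<close> is a dilate of the full cone by the factor \<open>t\<close>, so its measure
  scales like \<open>t\<close> to the power \<open>2 n\<close>, the real dimension.\<close>

lemma emeasure_ball_annulus:
  fixes B :: "(complex ^ 'n) set"
  assumes B [measurable]: "B \<in> sets borel"
  shows "emeasure borel_ball_measure {z. t < norm z \<and> sgn z \<in> B}
     = emeasure (polar_radial (CARD('n))) {t<..} * emeasure sphere_measure B"
proof -
  interpret prob_space "borel_ball_measure :: (complex ^ 'n) measure" by (rule prob_space_borel_ball_measure)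
  let ?n = "CARD('n)" and ?b = "borel_ball_measure :: (complex ^ 'n) measure"
  have S: "emeasure sphere_measure B = emeasure ?b {z. sgn z \<in> B}"
    unfolding sphere_measure_eq by (subst emeasure_distr) (auto simp: vimage_def)
  have [measurable]: "{z. sgn z \<in> B} \<in> sets borel" by measurable
  have pos: "emeasure ?b {z. t < norm z \<and> sgn z \<in> B} = ennreal (1 - t ^ (2 * ?n)) * emeasure ?b {z. sgn z \<in> B}"
    if t: "0 < t" "t < 1"
  proof -
    have eq: "ball 0 1 \<inter> {z. norm z < t \<and> sgn z \<in> B} = {z. (1 / t) *\<^sub>R z \<in> ball 0 1 \<inter> {z. sgn z \<in> B}}"
      using t by (auto simp: sgn_scaleR field_simps)
    have sc: "emeasure ?b {z. norm z < t \<and> sgn z \<in> B} = ennreal (t ^ (2 * ?n)) * emeasure ?b {z. sgn z \<in> B}"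
      using t by (subst (1 2) emeasure_borel_ball_measure, measurable, unfold eq, subst emeasure_lborel_scale)
        (auto simp: ennreal_times_divide)
    have "emeasure ?b {z. norm z = t} = 0"
    proof -
      have "emeasure lborel (sphere (0 :: complex ^ 'n) t) = 0"
        using negligible_sphere[of "0 :: complex ^ 'n" t] by (simp add: negligible_iff_null_sets null_sets_def)
      moreover have "emeasure lborel (ball 0 1 \<inter> {z :: complex ^ 'n. norm z = t})
          \<le> emeasure lborel (sphere (0 :: complex ^ 'n) t)"
        by (intro emeasure_mono) auto
      ultimately have "emeasure lborel (ball 0 1 \<inter> {z :: complex ^ 'n. norm z = t}) \<le> 0" by simp
      then show ?thesis by (simp add: emeasure_borel_ball_measure)
    qed
    then have "emeasure ?b {z. norm z \<le> t \<and> sgn z \<in> B} = emeasure ?b {z. norm z < t \<and> sgn z \<in> B}"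
    proof (intro emeasure_eq_AE)
      assume "emeasure ?b {z. norm z = t} = 0"
      then have "AE z in ?b. norm z \<noteq> t" by (intro AE_I[of _ _ "{z. norm z = t}"]) auto
      then show "AE z in ?b. z \<in> {z. norm z \<le> t \<and> sgn z \<in> B} \<longleftrightarrow> z \<in> {z. norm z < t \<and> sgn z \<in> B}"
        by (rule eventually_mono) auto
    qed auto
    with sc have sc': "measure ?b {z. norm z \<le> t \<and> sgn z \<in> B} = t ^ (2 * ?n) * measure ?b {z. sgn z \<in> B}"
      using t by (simp add: measure_def enn2real_mult)
    have "measure ?b {z. t < norm z \<and> sgn z \<in> B} = measure ?b ({z. sgn z \<in> B} - {z. norm z \<le> t \<and> sgn z \<in> B})"
      by (rule arg_cong[where f="measure ?b"]) auto
    also have "\<dots> = measure ?b {z. sgn z \<in> B} - measure ?b {z. norm z \<le> t \<and> sgn z \<in> B}"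
      by (intro finite_measure_Diff) auto
    also have "\<dots> = (1 - t ^ (2 * ?n)) * measure ?b {z. sgn z \<in> B}" by (simp add: sc' algebra_simps)
    finally show ?thesis
      using t power_le_one[of t "2 * ?n"] by (simp add: emeasure_eq_measure ennreal_mult)
  qed
  have zero: "emeasure ?b {0} = 0"
    by (simp add: emeasure_borel_ball_measure)
  consider "t < 0" | "t = 0" | "0 < t" "t < 1" | "1 \<le> t" by linarith
  then show ?thesis
  proof cases
    case 1
    then have "{z :: complex ^ 'n. t < norm z \<and> sgn z \<in> B} = {z. sgn z \<in> B}" by (auto intro: less_le_trans)
    then show ?thesis using 1 by (simp add: emeasure_polar_radial S)
  next
    case 2
    have "emeasure ?b {z. t < norm z \<and> sgn z \<in> B} = emeasure ?b {z. sgn z \<in> B}"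
      using zero by (intro emeasure_eq_AE) (auto simp: 2 intro!: AE_I[of _ _ "{0}"])
    then show ?thesis using 2 by (simp add: emeasure_polar_radial S zero_power)
  next
    case 3
    then show ?thesis by (simp add: emeasure_polar_radial S pos)
  next
    case 4
    then have "ball 0 1 \<inter> {z :: complex ^ 'n. t < norm z \<and> sgn z \<in> B} = {}" by auto
    then show ?thesis using 4 by (simp add: emeasure_polar_radial S emeasure_borel_ball_measure)
  qed
qed

text \<open>By uniqueness of product measures it suffices to compare rectangles, and in the radial factor
  half-lines suffice.\<close>

lemma polar_measure_eq:
  "polar_radial (CARD('n)) \<Otimes>\<^sub>M sphere_measure
     = distr borel_ball_measure (borel \<Otimes>\<^sub>M borel) (\<lambda>z :: complex ^ 'n. (norm z, sgn z))"
proof (rule pair_measure_eqI)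
  let ?n = "CARD('n)" and ?b = "borel_ball_measure :: (complex ^ 'n) measure"
  interpret P: finite_measure "polar_radial ?n" by (rule finite_measure_polar_radial) simp
  interpret B: prob_space ?b by (rule prob_space_borel_ball_measure)
  interpret S: prob_space "sphere_measure :: (complex ^ 'n) measure" by (rule prob_space_sphere_measure)
  show "sigma_finite_measure (polar_radial ?n)" "sigma_finite_measure (sphere_measure :: (complex ^ 'n) measure)"
    by unfold_locales
  show "sets (polar_radial ?n \<Otimes>\<^sub>M (sphere_measure :: (complex ^ 'n) measure))
     = sets (distr ?b (borel \<Otimes>\<^sub>M borel) (\<lambda>z. (norm z, sgn z)))"
    by (simp cong: sets_pair_measure_cong)
  fix A and B :: "(complex ^ 'n) set"
  assume "A \<in> sets (polar_radial ?n)" "B \<in> sets sphere_measure"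
  then have [measurable]: "A \<in> sets borel" "B \<in> sets borel" by simp_all
  define P1 where "P1 = density (polar_radial ?n) (\<lambda>_. emeasure sphere_measure B)"
  define P2 where "P2 = distr (density ?b (indicator {z. sgn z \<in> B})) borel (norm :: complex ^ 'n \<Rightarrow> real)"
  have e1: "emeasure P1 C = emeasure (polar_radial ?n) C * emeasure sphere_measure B" if "C \<in> sets borel" for C
    unfolding P1_def using that
    by (subst emeasure_density) (auto simp: nn_integral_multc mult.commute)
  have e2: "emeasure P2 C = emeasure ?b {z. norm z \<in> C \<and> sgn z \<in> B}" if [measurable]: "C \<in> sets borel" for C
  proof -
    have "emeasure P2 C = emeasure (density ?b (indicator {z. sgn z \<in> B})) {z. norm z \<in> C}"
      unfolding P2_def by (subst emeasure_distr) (auto simp: vimage_def)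
    also have "\<dots> = (\<integral>\<^sup>+ z. indicator {z. sgn z \<in> B} z * indicator {z. norm z \<in> C} z \<partial>?b)"
      by (rule emeasure_density) measurable
    also have "\<dots> = (\<integral>\<^sup>+ z. indicator {z. norm z \<in> C \<and> sgn z \<in> B} z \<partial>?b)"
      by (intro nn_integral_cong) (auto split: split_indicator)
    also have "\<dots> = emeasure ?b {z. norm z \<in> C \<and> sgn z \<in> B}"
      by (rule nn_integral_indicator) measurable
    finally show ?thesis .
  qed
  have "P1 = P2"
  proof (rule measure_eqI_lessThan)
    show "sets P1 = sets borel" "sets P2 = sets borel" by (simp_all add: P1_def P2_def)
    fix x :: real
    show "emeasure P1 {x<..} < \<infinity>"
      using P.emeasure_finite S.emeasure_finite
      by (subst e1) (auto simp: ennreal_mult_eq_top_iff less_top[symmetric])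
    show "emeasure P1 {x<..} = emeasure P2 {x<..}"
      by (simp add: e1 e2 emeasure_ball_annulus)
  qed
  then have "emeasure P1 A = emeasure P2 A" by simp
  then show "emeasure (polar_radial ?n) A * emeasure sphere_measure B
     = emeasure (distr ?b (borel \<Otimes>\<^sub>M borel) (\<lambda>z. (norm z, sgn z))) (A \<times> B)"
    by (subst emeasure_distr) (auto simp: e1 e2 vimage_def)
qed

lemma polar_integral:
  fixes f :: "complex ^ 'n \<Rightarrow> ennreal"
  assumes [measurable]: "f \<in> borel_measurable borel"
  shows "(\<integral>\<^sup>+ z. f z \<partial>borel_ball_measure)
    = (\<integral>\<^sup>+ \<zeta>. \<integral>\<^sup>+ r. ennreal (1 - r\<^sup>2) * f (r *\<^sub>R \<zeta>) \<partial>radial_measure (CARD('n)) \<partial>sphere_measure)"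
proof -
  let ?n = "CARD('n)"
  interpret P: finite_measure "polar_radial ?n" by (rule finite_measure_polar_radial) simp
  interpret S: prob_space "sphere_measure :: (complex ^ 'n) measure" by (rule prob_space_sphere_measure)
  interpret SP: pair_sigma_finite "sphere_measure :: (complex ^ 'n) measure" "polar_radial ?n" by unfold_locales
  interpret PS: pair_sigma_finite "polar_radial ?n" "sphere_measure :: (complex ^ 'n) measure" by unfold_locales
  have "(\<integral>\<^sup>+ z. f z \<partial>borel_ball_measure) = (\<integral>\<^sup>+ z. f (norm z *\<^sub>R sgn z) \<partial>borel_ball_measure)"
  proof (rule nn_integral_cong)
    fix z :: "complex ^ 'n"
    show "f z = f (norm z *\<^sub>R sgn z)" by (cases "z = 0") (simp_all add: sgn_div_norm)
  qed
  also have "\<dots> = (\<integral>\<^sup>+ x. f (fst x *\<^sub>R snd x) \<partial>distr borel_ball_measure (borel \<Otimes>\<^sub>M borel) (\<lambda>z :: complex ^ 'n. (norm z, sgn z)))"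
    by (subst nn_integral_distr) auto
  also have "\<dots> = (\<integral>\<^sup>+ x. f (fst x *\<^sub>R snd x) \<partial>(polar_radial ?n \<Otimes>\<^sub>M sphere_measure))"
    by (simp only: polar_measure_eq)
  also have "\<dots> = (\<integral>\<^sup>+ \<zeta>. \<integral>\<^sup>+ r. f (r *\<^sub>R \<zeta>) \<partial>polar_radial ?n \<partial>sphere_measure)"
    by (subst PS.nn_integral_snd[symmetric]) auto
  also have "\<dots> = (\<integral>\<^sup>+ \<zeta>. \<integral>\<^sup>+ r. ennreal (1 - r\<^sup>2) * f (r *\<^sub>R \<zeta>) \<partial>radial_measure ?n \<partial>sphere_measure)"
  proof (rule nn_integral_cong)
    fix \<zeta> :: "complex ^ 'n"
    have "(\<integral>\<^sup>+ r. f (r *\<^sub>R \<zeta>) \<partial>polar_radial ?n)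
       = (\<integral>\<^sup>+ r. ennreal (2 * real ?n * r ^ (2 * ?n - 1)) * indicator {0..1} r * f (r *\<^sub>R \<zeta>) \<partial>lborel)"
      unfolding polar_radial_def by (subst nn_integral_density) auto
    also have "\<dots> = (\<integral>\<^sup>+ r. ennreal (2 * real ?n * r ^ (2 * ?n - 1) / (1 - r\<^sup>2)) * indicator {0..<1} r * (ennreal (1 - r\<^sup>2) * f (r *\<^sub>R \<zeta>)) \<partial>lborel)"
    proof (rule nn_integral_cong_AE, rule eventually_mono[OF AE_lborel_singleton[of 1]])
      fix r :: real assume r: "r \<noteq> 1"
      show "ennreal (2 * real ?n * r ^ (2 * ?n - 1)) * indicator {0..1} r * f (r *\<^sub>R \<zeta>)
        = ennreal (2 * real ?n * r ^ (2 * ?n - 1) / (1 - r\<^sup>2)) * indicator {0..<1} r * (ennreal (1 - r\<^sup>2) * f (r *\<^sub>R \<zeta>))"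
      proof (cases "0 \<le> r \<and> r < 1")
        case True
        then have r2: "r\<^sup>2 < 1" by (simp add: power_less_one_iff abs_square_less_1)
        then have "ennreal (2 * real ?n * r ^ (2 * ?n - 1) / (1 - r\<^sup>2)) * ennreal (1 - r\<^sup>2) = ennreal (2 * real ?n * r ^ (2 * ?n - 1))"
          using True by (subst ennreal_mult[symmetric]) auto
        then show ?thesis using True by (simp flip: mult.assoc)
      next
        case False
        then show ?thesis using r by (auto simp: indicator_def)
      qed
    qed
    also have "\<dots> = (\<integral>\<^sup>+ r. ennreal (1 - r\<^sup>2) * f (r *\<^sub>R \<zeta>) \<partial>radial_measure ?n)"
      unfolding radial_measure_def by (subst nn_integral_density) auto
    finally show "(\<integral>\<^sup>+ r. f (r *\<^sub>R \<zeta>) \<partial>polar_radial ?n)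
       = (\<integral>\<^sup>+ r. ennreal (1 - r\<^sup>2) * f (r *\<^sub>R \<zeta>) \<partial>radial_measure ?n)" .
  qed
  finally show ?thesis .
qed

lemma AE_sphere: "AE \<zeta> in (sphere_measure :: (complex ^ 'n) measure). norm \<zeta> = 1"
proof -
  have "AE z in (borel_ball_measure :: (complex ^ 'n) measure). z \<noteq> 0"
    by (rule AE_I[of _ _ "{0}"]) (auto simp: emeasure_borel_ball_measure)
  then have "AE z in (borel_ball_measure :: (complex ^ 'n) measure). norm (sgn z) = 1"
    by (rule eventually_mono) (simp add: norm_sgn)
  then show ?thesis unfolding sphere_measure_eq by (subst AE_distr_iff) auto
qed

section \<open>The Koranyi quasi-metric on the sphere\<close>

lemma hprod_cnj: "cnj (hprod z w) = hprod w z"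
  by (simp add: hprod_def mult.commute)

lemma hprod_diff_left: "hprod (a - b) c = hprod a c - hprod b c"
  by (simp add: hprod_def algebra_simps sum_subtractf)

lemma hprod_add_left: "hprod (a + b) c = hprod a c + hprod b c"
  by (simp add: hprod_def algebra_simps sum.distrib)

lemma hprod_smult_left: "hprod (c *s z) w = c * hprod z w"
  by (simp add: hprod_def sum_distrib_left mult.assoc)

lemma hprod_smult_right: "hprod z (c *s w) = cnj c * hprod z w"
  by (simp add: hprod_def sum_distrib_left mult_ac)

lemma hprod_scaleR_left: "hprod (r *\<^sub>R z) w = of_real r * hprod z w"
  unfolding hprod_def by (simp add: scaleR_sum_right flip: scaleR_conv_of_real)

lemma hprod_scaleR_right: "hprod z (r *\<^sub>R w) = of_real r * hprod z w"
  unfolding hprod_def by (simp add: scaleR_sum_right flip: scaleR_conv_of_real)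

lemma Re_hprod: "Re (hprod z w) = z \<bullet> w"
  by (simp add: hprod_def inner_vec_def inner_complex_def)

lemma Im_hprod: "Im (hprod z w) = z \<bullet> (\<i> *s w)"
  by (simp add: Re_hprod[symmetric] hprod_smult_right)

lemma hprod_self: "hprod z z = of_real ((norm z)\<^sup>2)"
proof -
  have "Im (hprod z z) = 0" by (simp add: hprod_def)
  then show ?thesis by (simp add: complex_eq_iff Re_hprod power2_norm_eq_inner)
qed

lemma norm_smult: "norm (c *s (z :: complex ^ 'n)) = cmod c * norm z"
  by (simp add: norm_vec_def norm_mult L2_set_right_distrib)

text \<open>Rotating \<open>z\<close> by a unimodular scalar makes the Hermitian product real, where the real Cauchy--Schwarz
  inequality applies.\<close>

lemma norm_hprod_le: "cmod (hprod z w) \<le> norm z * norm w"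
proof (cases "hprod z w = 0")
  case False
  define c where "c = cnj (sgn (hprod z w))"
  have "cmod c = 1" using False by (simp add: c_def norm_sgn)
  have "c * hprod z w = of_real (cmod (hprod z w))"
    using False complex_norm_square[of "hprod z w"] by (simp add: c_def sgn_eq field_simps power2_eq_square)
  then have "cmod (hprod z w) = (c *s z) \<bullet> w"
    by (simp add: Re_hprod[symmetric] hprod_smult_left)
  also have "\<dots> \<le> norm (c *s z) * norm w" by (rule norm_cauchy_schwarz)
  finally show ?thesis by (simp add: norm_smult \<open>cmod c = 1\<close>)
qed simp

lemma hprod_measurable [measurable (raw)]:
  assumes [measurable]: "f \<in> borel_measurable M" "g \<in> borel_measurable M"
  shows "(\<lambda>x. hprod (f x) (g x)) \<in> borel_measurable M"
proof -
  have [measurable]: "(\<lambda>z :: complex ^ 'b. z $ j) \<in> borel_measurable borel" for j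
    by (intro borel_measurable_continuous_onI continuous_intros)
  have [measurable]: "cnj \<in> borel_measurable borel"
    by (intro borel_measurable_continuous_onI continuous_intros)
  show ?thesis unfolding hprod_def by measurable
qed

lemma norm_proj_complement:
  assumes "norm e = 1"
  shows "(norm (z - hprod z e *s e))\<^sup>2 = (norm z)\<^sup>2 - (cmod (hprod z e))\<^sup>2"
proof -
  define v where "v = hprod z e *s e"
  have "z \<bullet> v = (cmod (hprod z e))\<^sup>2"
    by (simp add: v_def Re_hprod[symmetric] hprod_smult_right cmod_power2) (simp add: power2_eq_square)
  moreover have "norm v = cmod (hprod z e)" by (simp add: v_def norm_smult assms)
  moreover have "(norm (z - v))\<^sup>2 = (norm z)\<^sup>2 - 2 * (z \<bullet> v) + (norm v)\<^sup>2"
    by (simp add: power2_norm_eq_inner inner_diff inner_commute)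
  ultimately show ?thesis by (simp add: v_def)
qed

text \<open>The Cauchy--Schwarz inequality for the components of \<open>z\<close> and \<open>w\<close> orthogonal to \<open>e\<close>.\<close>

lemma hprod_minus_projection_le:
  assumes e: "norm e = 1"
  shows "cmod (hprod z w - hprod z e * cnj (hprod w e)) \<le> norm (z - hprod z e *s e) * norm (w - hprod w e *s e)"
proof -
  define z' where "z' = z - hprod z e *s e"
  define w' where "w' = w - hprod w e *s e"
  have ee: "hprod e e = 1" using e by (simp add: hprod_self)
  have ze: "hprod z' e = 0" by (simp add: z'_def hprod_diff_left hprod_smult_left ee)
  have "hprod w' z' = hprod w z' - hprod w e * cnj (hprod z' e)"
    by (simp add: w'_def hprod_diff_left hprod_smult_left hprod_cnj)
  then have "hprod z' w' = hprod z' w" using ze by (metis complex_cnj_zero diff_zero hprod_cnj mult_zero_right)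
  also have "\<dots> = hprod z w - hprod z e * cnj (hprod w e)"
    by (simp add: z'_def hprod_diff_left hprod_smult_left hprod_cnj)
  finally show ?thesis using norm_hprod_le[of z' w'] by (simp add: z'_def w'_def)
qed

lemma one_minus_cmod_square_le:
  assumes "cmod c \<le> 1"
  shows "1 - (cmod c)\<^sup>2 \<le> 2 * cmod (1 - c)"
proof -
  have "1 - (cmod c)\<^sup>2 = (1 - cmod c) * (1 + cmod c)" by (simp add: power2_eq_square algebra_simps)
  also have "\<dots> \<le> (1 - cmod c) * 2" using assms by (intro mult_left_mono) auto
  also have "\<dots> \<le> 2 * cmod (1 - c)" using norm_triangle_ineq2[of 1 c] by simp
  finally show ?thesis .
qed

text \<open>The nonisotropic quasi-metric on the sphere: its caps of radius \<open>\<delta>\<close> have extent \<open>\<delta>\<close> in the complex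
  direction of the center and \<open>\<surd>\<delta>\<close> in the others.\<close>

definition koranyi :: "complex ^ 'n \<Rightarrow> complex ^ 'n \<Rightarrow> real" where
  "koranyi z w = cmod (1 - hprod z w)"

lemma koranyi_sym: "koranyi z w = koranyi w z"
  unfolding koranyi_def by (metis complex_cnj_diff complex_cnj_one complex_mod_cnj hprod_cnj)

text \<open>Split \<open>x\<close> and \<open>z\<close> into their components along \<open>y\<close> and orthogonal to \<open>y\<close>. The orthogonal parts have
  squared norm at most twice the quasi-distance to \<open>y\<close>, and they enter only through a product.\<close>

lemma koranyi_quasi_triangle:
  assumes "norm x = 1" "norm y = 1" "norm z = 1"
  shows "koranyi x z \<le> 2 * (koranyi x y + koranyi y z)"
proof -
  define a where "a = hprod x y"
  define b where "b = hprod z y"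
  define x' where "x' = x - a *s y"
  define z' where "z' = z - b *s y"
  have a: "cmod (1 - a) = koranyi x y" by (simp add: a_def koranyi_def)
  have b: "cmod (1 - b) = koranyi y z" by (simp add: b_def koranyi_def[symmetric] koranyi_sym[of z y])
  have ab1: "cmod a \<le> 1" "cmod b \<le> 1" using norm_hprod_le[of x y] norm_hprod_le[of z y] assms by (simp_all add: a_def b_def)
  have x'2: "(norm x')\<^sup>2 \<le> 2 * koranyi x y"
    using norm_proj_complement[OF assms(2), of x] one_minus_cmod_square_le[OF ab1(1)] a assms by (simp add: x'_def a_def)
  have z'2: "(norm z')\<^sup>2 \<le> 2 * koranyi y z"
    using norm_proj_complement[OF assms(2), of z] one_minus_cmod_square_le[OF ab1(2)] b assms by (simp add: z'_def b_def)
  have "koranyi x z = cmod ((1 - a) + a * (1 - cnj b) - (hprod x z - a * cnj b))"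
    by (simp add: koranyi_def algebra_simps)
  also have "\<dots> \<le> cmod (1 - a) + cmod (a * (1 - cnj b)) + cmod (hprod x z - a * cnj b)"
    by (meson norm_triangle_ineq4 norm_triangle_ineq order_trans add_right_mono)
  also have "cmod (a * (1 - cnj b)) = cmod a * cmod (1 - b)"
    by (metis complex_cnj_diff complex_cnj_one complex_mod_cnj norm_mult)
  also have "\<dots> \<le> cmod (1 - b)" using ab1 by (intro mult_left_le_one_le) auto
  also have "cmod (hprod x z - a * cnj b) \<le> norm x' * norm z'"
    unfolding a_def b_def x'_def z'_def by (rule hprod_minus_projection_le[OF assms(2)])
  also have "\<dots> \<le> ((norm x')\<^sup>2 + (norm z')\<^sup>2) / 2"
    using sum_squares_bound[of "norm x'" "norm z'"] by simp
  also have "\<dots> \<le> koranyi x y + koranyi y z" using x'2 z'2 by simp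
  finally show ?thesis using a b by simp
qed

text \<open>An upper bound for the volume of a box in arbitrary orthonormal directions, by averaging instead of
  rotating. Translating the set by \<open>t b\<close> does not change the constraints in the directions other than
  \<open>b\<close>, and for a given point \<open>z\<close> the set of \<open>t \<in> [0, 1]\<close> for which \<open>z\<close> lies in the translate is
  contained in an interval of length \<open>2 w b\<close>. Each direction enlarges the radius of the ball by one.\<close>

lemma emeasure_slab_le:
  fixes B :: "'a::euclidean_space set"
  assumes "finite B" "pairwise orthogonal B" "\<And>b. b \<in> B \<Longrightarrow> norm b = 1" "\<And>b. b \<in> B \<Longrightarrow> 0 \<le> w b"
  shows "emeasure lborel {z \<in> ball 0 R. \<forall>b\<in>B. \<bar>z \<bullet> b\<bar> < w b}
    \<le> ennreal (\<Prod>b\<in>B. 2 * w b) * emeasure lborel (ball (0::'a) (R + card B))"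
  using assms
proof (induction B arbitrary: R rule: finite_induct)
  case empty
  have "{z \<in> ball (0::'a) R. \<forall>b\<in>{}. \<bar>z \<bullet> b\<bar> < w b} = ball 0 R" by auto
  then show ?case by simp
next
  case (insert b F)
  define A where "A = {z \<in> ball 0 R. \<forall>b\<in>insert b F. \<bar>z \<bullet> b\<bar> < w b}"
  (* the set after dropping the constraint in the direction b; it contains all translates by t b *)
  define A' where "A' = {z \<in> ball 0 (R + 1). \<forall>b\<in>F. \<bar>z \<bullet> b\<bar> < w b}"
  have op: "open A" "open A'"
    unfolding A_def A'_def using insert.hyps
    by (auto simp: Collect_conj_eq Collect_ball_eq intro!: open_Int open_INT open_Collect_less continuous_intros)
  then have [measurable]: "A \<in> sets borel" "A' \<in> sets borel" by auto
  have b: "norm b = 1" "b \<bullet> b = 1" using insert.prems(2)[of b] by (auto simp: norm_eq_1)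
  have bF: "b \<bullet> c = 0" if "c \<in> F" for c
    using insert.prems(1) insert.hyps that by (auto simp: pairwise_def orthogonal_def)
  have trans: "(\<integral>\<^sup>+ z. indicator A (z - t *\<^sub>R b) \<partial>lborel) = emeasure lborel A" for t
  proof -
    have "emeasure lborel A = (\<integral>\<^sup>+ z. indicator A z \<partial>distr lborel borel ((+) (- t *\<^sub>R b)))"
      by (subst lborel_distr_plus) simp
    also have "\<dots> = (\<integral>\<^sup>+ z. indicator A (z - t *\<^sub>R b) \<partial>lborel)"
      by (subst nn_integral_distr) (auto simp: algebra_simps)
    finally show ?thesis by simp
  qed
  have "emeasure lborel A = (\<integral>\<^sup>+ t. emeasure lborel A * indicator {0..1::real} t \<partial>lborel)"
    by (subst nn_integral_cmult_indicator) auto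
  also have "\<dots> = (\<integral>\<^sup>+ t. \<integral>\<^sup>+ z. indicator A (z - t *\<^sub>R b) * indicator {0..1} t \<partial>lborel \<partial>lborel)"
    by (intro nn_integral_cong) (subst nn_integral_multc, auto simp: trans)
  also have "\<dots> = (\<integral>\<^sup>+ z. \<integral>\<^sup>+ t. indicator A (z - t *\<^sub>R b) * indicator {0..1} t \<partial>lborel \<partial>lborel)"
    by (rule lborel_pair.Fubini') measurable
  also have "\<dots> \<le> (\<integral>\<^sup>+ z. ennreal (2 * w b) * indicator A' z \<partial>lborel)"
  proof (rule nn_integral_mono)
    fix z
    show "(\<integral>\<^sup>+ t. indicator A (z - t *\<^sub>R b) * indicator {0..1} t \<partial>lborel) \<le> ennreal (2 * w b) * indicator A' z"
    proof (cases "z \<in> A'")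
      case True
      have "(\<integral>\<^sup>+ t. indicator A (z - t *\<^sub>R b) * indicator {0..1} t \<partial>lborel) \<le> (\<integral>\<^sup>+ t. indicator {z \<bullet> b - w b..z \<bullet> b + w b} t \<partial>lborel)"
        by (intro nn_integral_mono) (auto simp: A_def inner_diff_left b split: split_indicator)
      also have "\<dots> = ennreal (2 * w b)" using insert.prems(3)[of b] by simp
      finally show ?thesis using True by simp
    next
      case False
      have "indicator A (z - t *\<^sub>R b) * indicator {0..1} t = (0 :: ennreal)" for t
      proof (rule ccontr)
        assume "indicator A (z - t *\<^sub>R b) * indicator {0..1} t \<noteq> (0 :: ennreal)"
        then have t: "z - t *\<^sub>R b \<in> A" "0 \<le> t" "t \<le> 1" by (auto split: split_indicator_asm)
        have "norm z \<le> norm (z - t *\<^sub>R b) + norm (t *\<^sub>R b)" by (metis add.commute norm_triangle_sub)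
        also have "\<dots> < R + 1" using t b by (auto simp: A_def intro!: add_less_le_mono)
        finally have "norm z < R + 1" .
        moreover have "\<bar>z \<bullet> c\<bar> < w c" if "c \<in> F" for c
          using t(1) that bF[OF that] by (auto simp: A_def inner_diff_left)
        ultimately show False using False by (simp add: A'_def)
      qed
      then have "(\<integral>\<^sup>+ t. indicator A (z - t *\<^sub>R b) * indicator {0..1} t \<partial>lborel) = 0"
        by (simp only: nn_integral_const mult_zero_left)
      then show ?thesis by simp
    qed
  qed
  also have "\<dots> = ennreal (2 * w b) * emeasure lborel A'"
    by (subst nn_integral_cmult_indicator) auto
  also have "\<dots> \<le> ennreal (2 * w b) * (ennreal (\<Prod>b\<in>F. 2 * w b) * emeasure lborel (ball (0::'a) (R + 1 + card F)))"
    unfolding A'_def using insert.prems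
    by (intro mult_left_mono insert.IH) (auto simp: pairwise_insert)
  also have "\<dots> = ennreal (\<Prod>b\<in>insert b F. 2 * w b) * emeasure lborel (ball (0::'a) (R + card (insert b F)))"
    using insert.hyps insert.prems by (simp add: ennreal_mult prod_nonneg mult.assoc add_ac)
  finally show ?case unfolding A_def .
qed

definition cap_const :: "'n::finite itself \<Rightarrow> real" where
  "cap_const _ = 8 ^ CARD('n) * enn2real (emeasure lborel (ball (0 :: complex ^ 'n) (2 * real CARD('n)))
     / emeasure lborel (ball (0 :: complex ^ 'n) 1))"

lemma cap_const_nonneg: "0 \<le> cap_const TYPE('n::finite)"
  by (simp add: cap_const_def)

text \<open>The cone over a cap with center \<open>\<eta>\<close> lies in a box of half-width \<open>\<delta>\<close> in the direction \<open>\<i> \<eta>\<close> and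
  \<open>\<surd>(2 \<delta>)\<close> in the \<open>2 n - 2\<close> directions orthogonal to \<open>\<eta>\<close> and \<open>\<i> \<eta>\<close>. The direction \<open>\<eta>\<close> is
  bounded by the unit ball alone, since the cone reaches from the origin to the sphere.\<close>

lemma emeasure_cap_le:
  fixes \<eta> :: "complex ^ 'n"
  assumes \<eta>: "norm \<eta> = 1" and \<delta>: "0 < \<delta>"
  shows "emeasure sphere_measure {\<zeta> \<in> sphere 0 1. koranyi \<eta> \<zeta> < \<delta>} \<le> ennreal (cap_const TYPE('n) * \<delta> ^ CARD('n))"
proof -
  let ?n = "CARD('n)"
  define U where "U = {x. \<forall>y\<in>span {\<eta>, \<i> *s \<eta>}. orthogonal y x}"
  have orth: "orthogonal \<eta> (\<i> *s \<eta>)"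
    using \<eta> by (simp add: orthogonal_def Re_hprod[symmetric] hprod_smult_right hprod_self)
  have ne: "\<eta> \<noteq> 0" "\<i> *s \<eta> \<noteq> 0" using \<eta> norm_smult[of \<i> \<eta>] by auto
  then have "\<eta> \<noteq> \<i> *s \<eta>" using orth by (auto simp: orthogonal_self)
  have "independent {\<eta>, \<i> *s \<eta>}"
    by (rule pairwise_orthogonal_independent) (use orth ne in \<open>auto simp: pairwise_insert orthogonal_commute\<close>)
  then have "dim (span {\<eta>, \<i> *s \<eta>}) = 2"
    using \<open>\<eta> \<noteq> \<i> *s \<eta>\<close> by (simp add: dim_eq_card_independent)
  moreover have "dim {y \<in> UNIV. \<forall>x\<in>span {\<eta>, \<i> *s \<eta>}. orthogonal x y} + dim (span {\<eta>, \<i> *s \<eta>}) = dim (UNIV :: (complex ^ 'n) set)"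
    by (rule dim_subspace_orthogonal_to_vectors) auto
  ultimately have dimU: "dim U = 2 * ?n - 2" by (simp add: U_def)
  have "subspace U" unfolding U_def by (rule subspace_orthogonal_to_vectors)
  then obtain B where B: "B \<subseteq> U" "pairwise orthogonal B" "\<And>x. x \<in> B \<Longrightarrow> norm x = 1" "independent B" "card B = dim U"
    by (rule orthonormal_basis_subspace) blast
  have BU: "b \<bullet> \<eta> = 0" "b \<bullet> (\<i> *s \<eta>) = 0" if "b \<in> B" for b
  proof -
    have "orthogonal y b" if "y \<in> {\<eta>, \<i> *s \<eta>}" for y
      using B(1) \<open>b \<in> B\<close> span_base[OF that] by (auto simp: U_def)
    from this[of \<eta>] this[of "\<i> *s \<eta>"] show "b \<bullet> \<eta> = 0" "b \<bullet> (\<i> *s \<eta>) = 0"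
      by (simp_all add: orthogonal_def inner_commute[of b])
  qed
  have finB: "finite B" using B(4) independent_imp_finite by blast
  have notin: "\<i> *s \<eta> \<notin> B" using BU(2)[of "\<i> *s \<eta>"] ne by auto
  (* half-widths of the box containing the cone A over the cap *)
  define w where "w b = (if b = \<i> *s \<eta> then \<delta> else sqrt (2 * \<delta>))" for b
  define A where "A = {z \<in> ball 0 1. cmod (1 - hprod \<eta> (sgn z)) < \<delta>}"
  have A_sub: "A \<subseteq> {z \<in> ball 0 1. \<forall>b\<in>insert (\<i> *s \<eta>) B. \<bar>z \<bullet> b\<bar> < w b}"
  proof (intro subsetI CollectI conjI ballI)
    fix z assume z: "z \<in> A"
    then show "z \<in> ball 0 1" by (simp add: A_def)
    have nz: "norm z < 1" using z by (simp add: A_def)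
    define h where "h = hprod (sgn z) \<eta>"
    have h: "cmod (1 - h) < \<delta>" using z koranyi_sym[of \<eta> "sgn z"] by (simp add: A_def h_def koranyi_def)
    have zs: "z = norm z *\<^sub>R sgn z" by (cases "z = 0") (simp_all add: sgn_div_norm)
    have hz: "hprod z \<eta> = of_real (norm z) * h" unfolding h_def by (subst zs) (simp only: hprod_scaleR_left)
    have ns: "norm (sgn z) \<le> 1" by (simp add: norm_sgn)
    have h1: "cmod h \<le> 1" using norm_hprod_le[of "sgn z" \<eta>] ns \<eta> by (simp add: h_def)
    fix b assume b: "b \<in> insert (\<i> *s \<eta>) B"
    show "\<bar>z \<bullet> b\<bar> < w b"
    proof (cases "b = \<i> *s \<eta>")
      case True
      have "\<bar>z \<bullet> b\<bar> = norm z * \<bar>Im h\<bar>" using hz by (simp add: True Im_hprod[symmetric] abs_mult)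
      also have "\<dots> \<le> \<bar>Im (1 - h)\<bar>" using nz by (simp add: mult_left_le_one_le)
      also have "\<dots> \<le> cmod (1 - h)" by (rule abs_Im_le_cmod)
      finally show ?thesis using h True by (simp add: w_def)
    next
      case False
      then have bB: "b \<in> B" using b by simp
      have "(hprod z \<eta> *s \<eta>) \<bullet> b = 0"
      proof -
        have "hprod b \<eta> = 0" using BU[OF bB] by (simp add: complex_eq_iff Re_hprod Im_hprod)
        then have "hprod \<eta> b = 0" using hprod_cnj[of b \<eta>] by simp
        then show ?thesis by (simp add: Re_hprod[symmetric] hprod_smult_left)
      qed
      then have "\<bar>z \<bullet> b\<bar> = \<bar>(z - hprod z \<eta> *s \<eta>) \<bullet> b\<bar>" by (simp add: inner_diff_left)
      also have "\<dots> \<le> norm (z - hprod z \<eta> *s \<eta>)"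
        using Cauchy_Schwarz_ineq2[of "z - hprod z \<eta> *s \<eta>" b] B(3)[OF bB] by simp
      also have "\<dots> < sqrt (2 * \<delta>)"
      proof (rule real_less_rsqrt)
        have "(norm (z - hprod z \<eta> *s \<eta>))\<^sup>2 = (norm z)\<^sup>2 * (1 - (cmod h)\<^sup>2)"
          by (subst norm_proj_complement[OF \<eta>]) (simp add: hz norm_mult power_mult_distrib algebra_simps)
        also have "\<dots> \<le> 1 - (cmod h)\<^sup>2"
          using nz h1 by (intro mult_left_le_one_le) (auto simp: power_le_one)
        also have "\<dots> \<le> 2 * cmod (1 - h)" by (rule one_minus_cmod_square_le[OF h1])
        finally show "(norm (z - hprod z \<eta> *s \<eta>))\<^sup>2 < 2 * \<delta>" using h by simp
      qed
      finally show ?thesis using False by (simp add: w_def)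
    qed
  qed
  have op: "{z \<in> ball 0 1. \<forall>b\<in>insert (\<i> *s \<eta>) B. \<bar>z \<bullet> b\<bar> < w b} \<in> sets lborel"
  proof -
    have "open {z \<in> ball 0 1. \<forall>b\<in>insert (\<i> *s \<eta>) B. \<bar>z \<bullet> b\<bar> < w b}"
      using finB by (auto simp: Collect_conj_eq Collect_ball_eq intro!: open_Int open_INT open_Collect_less continuous_intros)
    then show ?thesis by auto
  qed
  have "emeasure lborel A \<le> emeasure lborel {z \<in> ball 0 1. \<forall>b\<in>insert (\<i> *s \<eta>) B. \<bar>z \<bullet> b\<bar> < w b}"
    by (rule emeasure_mono[OF A_sub op])
  also have "\<dots> \<le> ennreal (\<Prod>b\<in>insert (\<i> *s \<eta>) B. 2 * w b) * emeasure lborel (ball (0::complex ^ 'n) (1 + real (card (insert (\<i> *s \<eta>) B))))"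
  proof (rule emeasure_slab_le)
    show "pairwise orthogonal (insert (\<i> *s \<eta>) B)"
      using B(2) BU by (auto simp: pairwise_insert orthogonal_def inner_commute[of "\<i> *s \<eta>"])
  qed (use finB B(3) \<delta> \<eta> in \<open>auto simp: w_def norm_smult\<close>)
  also have "(\<Prod>b\<in>insert (\<i> *s \<eta>) B. 2 * w b) = 2 * \<delta> * (8 * \<delta>) ^ (?n - 1)"
  proof -
    have "(\<Prod>b\<in>B. 2 * w b) = (\<Prod>b\<in>B. 2 * sqrt (2 * \<delta>))"
      using notin by (intro prod.cong) (auto simp: w_def)
    also have "\<dots> = ((2 * sqrt (2 * \<delta>)) ^ 2) ^ (?n - 1)"
    proof -
      have "card B = 2 * (?n - 1)" by (simp add: B(5) dimU diff_mult_distrib2)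
      then show ?thesis by (simp only: prod_constant power_mult)
    qed
    also have "(2 * sqrt (2 * \<delta>)) ^ 2 = 8 * \<delta>" using \<delta> by (simp add: power_mult_distrib)
    finally show ?thesis using notin finB by (simp add: w_def)
  qed
  also have "1 + real (card (insert (\<i> *s \<eta>) B)) = 2 * real ?n"
  proof -
    have "1 \<le> ?n" using zero_less_card_finite[where 'a='n] by linarith
    then show ?thesis using notin finB by (simp add: B(5) dimU of_nat_diff)
  qed
  also have "ennreal (2 * \<delta> * (8 * \<delta>) ^ (?n - 1)) \<le> ennreal (8 ^ ?n * \<delta> ^ ?n)"
  proof (rule ennreal_leI)
    have "2 * \<delta> * (8 * \<delta>) ^ (?n - 1) \<le> (8 * \<delta>) * (8 * \<delta>) ^ (?n - 1)"
      using \<delta> by (intro mult_right_mono) auto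
    also have "\<dots> = (8 * \<delta>) ^ Suc (?n - 1)" by (simp only: power_Suc)
    also have "Suc (?n - 1) = ?n" using zero_less_card_finite[where 'a='n] by linarith
    also have "(8 * \<delta>) ^ ?n = 8 ^ ?n * \<delta> ^ ?n" by (simp only: power_mult_distrib)
    finally show "2 * \<delta> * (8 * \<delta>) ^ (?n - 1) \<le> 8 ^ ?n * \<delta> ^ ?n" .
  qed
  finally have vol: "emeasure lborel A \<le> ennreal (8 ^ ?n * \<delta> ^ ?n) * emeasure lborel (ball (0::complex ^ 'n) (2 * real ?n))"
    by (simp add: mult_right_mono)
  have [measurable]: "{\<zeta>. cmod (1 - hprod \<eta> \<zeta>) < \<delta>} \<in> sets borel" by measurable
  have "emeasure sphere_measure {\<zeta> \<in> sphere 0 1. koranyi \<eta> \<zeta> < \<delta>} \<le> emeasure sphere_measure {\<zeta>. cmod (1 - hprod \<eta> \<zeta>) < \<delta>}"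
    by (intro emeasure_mono) (auto simp: koranyi_def)
  also have "\<dots> = emeasure borel_ball_measure {z. cmod (1 - hprod \<eta> (sgn z)) < \<delta>}"
    unfolding sphere_measure_eq by (subst emeasure_distr) (auto simp: vimage_def)
  also have "\<dots> = emeasure lborel A / emeasure lborel (ball (0 :: complex ^ 'n) 1)"
  proof -
    have "A = ball 0 1 \<inter> {z. cmod (1 - hprod \<eta> (sgn z)) < \<delta>}" by (auto simp: A_def)
    then show ?thesis by (subst emeasure_borel_ball_measure) simp_all
  qed
  also have "\<dots> \<le> (ennreal (8 ^ ?n * \<delta> ^ ?n) * emeasure lborel (ball (0::complex ^ 'n) (2 * real ?n))) / emeasure lborel (ball (0 :: complex ^ 'n) 1)"
    by (rule divide_right_mono_ennreal[OF vol])
  also have "\<dots> = ennreal (8 ^ ?n * \<delta> ^ ?n) * (emeasure lborel (ball (0::complex ^ 'n) (2 * real ?n)) / emeasure lborel (ball (0 :: complex ^ 'n) 1))"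
    by (simp add: ennreal_times_divide)
  also have "\<dots> = ennreal (8 ^ ?n * \<delta> ^ ?n) * ennreal (enn2real (emeasure lborel (ball (0::complex ^ 'n) (2 * real ?n)) / emeasure lborel (ball (0 :: complex ^ 'n) 1)))"
    using ball_volume[where 'n='n] emeasure_lborel_ball_finite[of "0::complex ^ 'n" "2 * real ?n"]
    by (subst ennreal_enn2real) (auto simp: ennreal_divide_eq_top_iff less_top[symmetric])
  also have "\<dots> = ennreal (cap_const TYPE('n) * \<delta> ^ ?n)"
    using \<delta> by (subst ennreal_mult[symmetric]) (auto simp: cap_const_def mult_ac)
  finally show ?thesis .
qed

lemma koranyi_ball_in_borel [measurable]:
  "{\<eta> \<in> sphere 0 1. koranyi \<zeta> \<eta> < t} \<in> sets (borel :: (complex ^ 'n) measure)"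
proof -
  have "{\<eta> \<in> sphere 0 1. koranyi \<zeta> \<eta> < t} = {\<eta> :: complex ^ 'n. norm \<eta> = 1 \<and> cmod (1 - hprod \<zeta> \<eta>) < t}"
    by (auto simp: koranyi_def)
  also have "\<dots> \<in> sets borel" by measurable
  finally show ?thesis .
qed

lemma cap_space_sphere:
  "cap_space (sphere_measure :: (complex ^ 'n) measure) (sphere 0 1) koranyi CARD('n) (cap_const TYPE('n))"
proof -
  interpret prob_space "sphere_measure :: (complex ^ 'n) measure" by (rule prob_space_sphere_measure)
  show ?thesis
  proof
    show "sphere 0 1 \<in> sets (sphere_measure :: (complex ^ 'n) measure)" by simp
    show "AE x :: complex ^ 'n in sphere_measure. x \<in> sphere 0 1" using AE_sphere by simp
    show "(\<lambda>(x, y). koranyi x y) \<in> borel_measurable (sphere_measure \<Otimes>\<^sub>M (sphere_measure :: (complex ^ 'n) measure))"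
      unfolding koranyi_def by measurable
    show "koranyi x y = koranyi y x" for x y :: "complex ^ 'n" by (rule koranyi_sym)
    show "koranyi x y \<le> 2" if "x \<in> sphere 0 1" "y \<in> sphere 0 1" for x y :: "complex ^ 'n"
      using norm_triangle_ineq4[of 1 "hprod x y"] norm_hprod_le[of x y] that by (simp add: koranyi_def)
    show "koranyi x z \<le> 2 * (koranyi x y + koranyi y z)"
      if "x \<in> sphere 0 1" "y \<in> sphere 0 1" "z \<in> sphere 0 1" for x y z :: "complex ^ 'n"
      using that by (intro koranyi_quasi_triangle) auto
    show "0 \<le> cap_const TYPE('n)" by (rule cap_const_nonneg)
    show "emeasure sphere_measure {y \<in> sphere 0 1. koranyi x y < t} \<le> ennreal (cap_const TYPE('n) * t ^ CARD('n))"
      if "x \<in> sphere 0 1" "0 < t" for x :: "complex ^ 'n" and t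
      using that by (intro emeasure_cap_le) auto
  qed
qed

section \<open>Integral estimates for the kernel\<close>

text \<open>Replacing \<open>u\<close> by \<open>s u\<close> changes \<open>1 - u\<close> by at most \<open>1 - s\<close>, and that is itself at most
  \<open>\<bar>1 - s u\<bar>\<close>.\<close>

lemma one_minus_scaled:
  assumes "cmod u \<le> 1" "0 \<le> s" "s < 1"
  shows "1 - s \<le> cmod (1 - of_real s * u)" "cmod (1 - u) \<le> 2 * cmod (1 - of_real s * u)"
proof -
  have "cmod (of_real s * u) \<le> s" using assms by (simp add: norm_mult mult_left_le)
  then show 1: "1 - s \<le> cmod (1 - of_real s * u)"
    using norm_triangle_ineq2[of 1 "of_real s * u"] by simp
  have "1 - u = (1 - of_real s * u) - of_real (1 - s) * u" by (simp add: algebra_simps)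
  then have "cmod (1 - u) \<le> cmod (1 - of_real s * u) + cmod (of_real (1 - s) * u)"
    by (metis norm_triangle_ineq4)
  also have "cmod (of_real (1 - s) * u) \<le> 1 - s"
    using assms by (simp add: norm_mult mult_left_le del: of_real_diff)
  finally show "cmod (1 - u) \<le> 2 * cmod (1 - of_real s * u)" using 1 by simp
qed

text \<open>Writes an inverse power of a distance as a superposition of indicators of balls, so that bounds for
  balls become bounds for the kernel.\<close>

lemma inverse_power_layer:
  assumes D: "0 < D" and m: "0 < m"
  shows "ennreal (1 / D ^ m) = (\<integral>\<^sup>+ t. ennreal (real m / t ^ Suc m) * indicator {D..} t \<partial>lborel)"
proof -
  have "(\<integral>\<^sup>+ t. ennreal (real m / t ^ Suc m) * indicator {D..} t \<partial>lborel) = ennreal (0 - (- 1 / D ^ m))"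
  proof (rule nn_integral_FTC_atLeast)
    fix t assume t: "D \<le> t"
    then have t0: "0 < t" using D by linarith
    show "((\<lambda>t. - 1 / t ^ m) has_real_derivative real m / t ^ Suc m) (at t)"
    proof -
      obtain k where k: "m = Suc k" using m by (cases m) auto
      have "((\<lambda>t. - 1 / t ^ m) has_real_derivative (real m * t ^ (m - 1)) / (t ^ m * t ^ m)) (at t)"
        using t0 by (auto intro!: derivative_eq_intros simp: field_simps)
      also have "(real m * t ^ (m - 1)) / (t ^ m * t ^ m) = real m / t ^ Suc m"
        using t0 by (simp add: k field_simps)
      finally show ?thesis .
    qed
    show "0 \<le> real m / t ^ Suc m" using t0 by simp
  next
    show "((\<lambda>t::real. - 1 / t ^ m) \<longlongrightarrow> 0) at_top"
      by (rule tendsto_divide_0[OF tendsto_const]) (simp add: filterlim_at_top_imp_at_infinity filterlim_pow_at_top filterlim_ident m)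
  qed measurable
  then show ?thesis by simp
qed

text \<open>Since the quasi-distance is at most twice \<open>\<bar>1 - s \<langle>\<zeta>, \<eta>\<rangle>\<bar>\<close>, the layer at height \<open>t\<close> is contained in a cap
  of radius \<open>3 t\<close>, and there is no layer below \<open>1 - s\<close>. The decay \<open>t\<close> to the power \<open>- (n + 3)\<close> against
  caps of size \<open>t\<^sup>n\<close> leaves \<open>t powr (- 3)\<close>, integrated from \<open>1 - s\<close>.\<close>

lemma kernel_integral_le:
  fixes h :: "complex ^ 'n \<Rightarrow> ennreal"
  assumes [measurable]: "h \<in> borel_measurable borel" and \<zeta>: "norm \<zeta> = 1" and s: "0 \<le> s" "s < 1"
    and B: "\<And>t. 0 < t \<Longrightarrow> (\<integral>\<^sup>+ \<eta>. h \<eta> * indicator {\<eta> \<in> sphere 0 1. koranyi \<zeta> \<eta> < t} \<eta> \<partial>sphere_measure) \<le> ennreal (t ^ CARD('n)) * B"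
  shows "(\<integral>\<^sup>+ \<eta>. h \<eta> * ennreal (1 / cmod (1 - of_real s * hprod \<zeta> \<eta>) ^ (CARD('n) + 2)) \<partial>sphere_measure)
     \<le> ennreal ((real CARD('n) + 2) * 3 ^ CARD('n) / 2 / (1 - s)\<^sup>2) * B"
proof -
  let ?n = "CARD('n)" and ?\<sigma> = "sphere_measure :: (complex ^ 'n) measure"
  interpret prob_space ?\<sigma> by (rule prob_space_sphere_measure)
  interpret SL: pair_sigma_finite ?\<sigma> lborel by unfold_locales
  define D where "D \<eta> = cmod (1 - of_real s * hprod \<zeta> \<eta>)" for \<eta>
  have [measurable]: "D \<in> borel_measurable borel" unfolding D_def by measurable
  define f where "f t = real (?n + 2) / t ^ Suc (?n + 2)" for t :: real
  have [measurable]: "f \<in> borel_measurable borel" unfolding f_def by measurable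
  (* no layer below 1 - s, and layers are contained in caps of comparable radius *)
  have Dge: "1 - s \<le> D \<eta>" "koranyi \<zeta> \<eta> \<le> 2 * D \<eta>" if "norm \<eta> = 1" for \<eta>
    using one_minus_scaled[of "hprod \<zeta> \<eta>" s] norm_hprod_le[of \<zeta> \<eta>] s \<zeta> that by (simp_all add: D_def koranyi_def)
  have "(\<integral>\<^sup>+ \<eta>. h \<eta> * ennreal (1 / D \<eta> ^ (?n + 2)) \<partial>?\<sigma>)
     = (\<integral>\<^sup>+ \<eta>. \<integral>\<^sup>+ t. h \<eta> * (ennreal (f t) * (if norm \<eta> = 1 \<and> D \<eta> \<le> t then 1 else 0)) \<partial>lborel \<partial>?\<sigma>)"
  proof (rule nn_integral_cong_AE, rule eventually_mono[OF AE_sphere])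
    fix \<eta> :: "complex ^ 'n" assume \<eta>: "norm \<eta> = 1"
    have "0 < D \<eta>" using Dge[OF \<eta>] s by linarith
    then have "ennreal (1 / D \<eta> ^ (?n + 2)) = (\<integral>\<^sup>+ t. ennreal (f t) * indicator {D \<eta>..} t \<partial>lborel)"
      unfolding f_def by (rule inverse_power_layer) simp
    also have "\<dots> = (\<integral>\<^sup>+ t. ennreal (f t) * (if norm \<eta> = 1 \<and> D \<eta> \<le> t then 1 else 0) \<partial>lborel)"
      using \<eta> by (intro nn_integral_cong) (auto split: split_indicator)
    finally show "h \<eta> * ennreal (1 / D \<eta> ^ (?n + 2)) = (\<integral>\<^sup>+ t. h \<eta> * (ennreal (f t) * (if norm \<eta> = 1 \<and> D \<eta> \<le> t then 1 else 0)) \<partial>lborel)"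
      by (subst nn_integral_cmult) simp_all
  qed
  also have "\<dots> = (\<integral>\<^sup>+ t. \<integral>\<^sup>+ \<eta>. h \<eta> * (ennreal (f t) * (if norm \<eta> = 1 \<and> D \<eta> \<le> t then 1 else 0)) \<partial>?\<sigma> \<partial>lborel)"
    by (rule SL.Fubini'[symmetric]) measurable
  also have "\<dots> \<le> (\<integral>\<^sup>+ t. (ennreal ((real ?n + 2) * 3 ^ ?n / 2) * B) * (ennreal (real 2 / t ^ Suc 2) * indicator {1 - s..} t) \<partial>lborel)"
  proof (rule nn_integral_mono)
    fix t :: real
    show "(\<integral>\<^sup>+ \<eta>. h \<eta> * (ennreal (f t) * (if norm \<eta> = 1 \<and> D \<eta> \<le> t then 1 else 0)) \<partial>?\<sigma>)
      \<le> (ennreal ((real ?n + 2) * 3 ^ ?n / 2) * B) * (ennreal (real 2 / t ^ Suc 2) * indicator {1 - s..} t)"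
    proof (cases "1 - s \<le> t")
      case False
      have "h \<eta> * (ennreal (f t) * (if norm \<eta> = 1 \<and> D \<eta> \<le> t then 1 else 0)) = 0" for \<eta>
        using Dge(1)[of \<eta>] False by auto
      then have "(\<integral>\<^sup>+ \<eta>. h \<eta> * (ennreal (f t) * (if norm \<eta> = 1 \<and> D \<eta> \<le> t then 1 else 0)) \<partial>?\<sigma>) = 0"
        by (simp only: nn_integral_const mult_zero_left)
      then show ?thesis by (simp only: zero_le)
    next
      case True
      then have t: "0 < t" using s by linarith
      have "(\<integral>\<^sup>+ \<eta>. h \<eta> * (ennreal (f t) * (if norm \<eta> = 1 \<and> D \<eta> \<le> t then 1 else 0)) \<partial>?\<sigma>)
         \<le> (\<integral>\<^sup>+ \<eta>. ennreal (f t) * (h \<eta> * indicator {\<eta> \<in> sphere 0 1. koranyi \<zeta> \<eta> < 3 * t} \<eta>) \<partial>?\<sigma>)"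
      proof (rule nn_integral_mono)
        fix \<eta>
        show "h \<eta> * (ennreal (f t) * (if norm \<eta> = 1 \<and> D \<eta> \<le> t then 1 else 0))
          \<le> ennreal (f t) * (h \<eta> * indicator {\<eta> \<in> sphere 0 1. koranyi \<zeta> \<eta> < 3 * t} \<eta>)"
        proof (cases "norm \<eta> = 1 \<and> D \<eta> \<le> t")
          case True
          then have "koranyi \<zeta> \<eta> < 3 * t" using Dge(2)[of \<eta>] t by auto
          then show ?thesis using True by (simp add: mult.commute)
        qed auto
      qed
      also have "\<dots> = ennreal (f t) * (\<integral>\<^sup>+ \<eta>. h \<eta> * indicator {\<eta> \<in> sphere 0 1. koranyi \<zeta> \<eta> < 3 * t} \<eta> \<partial>?\<sigma>)"
        by (rule nn_integral_cmult) measurable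
      also have "\<dots> \<le> ennreal (f t) * (ennreal ((3 * t) ^ ?n) * B)"
        using t by (intro mult_left_mono B) auto
      also have "\<dots> = ennreal (f t * (3 * t) ^ ?n) * B"
        using t by (subst ennreal_mult) (auto simp: f_def mult.assoc)
      also have "f t * (3 * t) ^ ?n = ((real ?n + 2) * 3 ^ ?n / 2) * (real 2 / t ^ Suc 2)"
        using t by (simp add: f_def field_simps power_mult_distrib power_add numeral_3_eq_3)
      also have "ennreal \<dots> * B = (ennreal ((real ?n + 2) * 3 ^ ?n / 2) * B) * (ennreal (real 2 / t ^ Suc 2) * indicator {1 - s..} t)"
        using t True by (subst ennreal_mult) (auto simp: mult_ac)
      finally show ?thesis .
    qed
  qed
  also have "\<dots> = (ennreal ((real ?n + 2) * 3 ^ ?n / 2) * B) * ennreal (1 / (1 - s) ^ 2)"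
    using s by (subst nn_integral_cmult, measurable, subst inverse_power_layer[of "1 - s" 2]) auto
  also have "\<dots> = ennreal ((real ?n + 2) * 3 ^ ?n / 2 / (1 - s)\<^sup>2) * B"
    by (subst mult.commute, subst mult.assoc[symmetric], subst ennreal_mult[symmetric]) (auto simp: field_simps)
  finally show ?thesis by (simp add: D_def)
qed

lemma radial_measure_integral:
  assumes [measurable]: "g \<in> borel_measurable borel"
  shows "(\<integral>\<^sup>+ r. g r \<partial>radial_measure n) = (\<integral>\<^sup>+ r. ennreal (2 * real n * r ^ (2 * n - 1) / (1 - r\<^sup>2)) * g r * indicator {0..<1} r \<partial>lborel)"
  unfolding radial_measure_def
  by (subst nn_integral_density) (auto intro!: nn_integral_cong simp: mult_ac)

text \<open>The factor \<open>1 - s\<^sup>2\<close> cancels the singularity of the measure; the rest has an explicit primitive.\<close>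

lemma radial_kernel_integral_le:
  assumes r: "0 \<le> r" "r < 1"
  shows "(\<integral>\<^sup>+ s. ennreal ((1 - s\<^sup>2) / (1 - r * s)\<^sup>2) \<partial>radial_measure n) \<le> ennreal (2 * real n / (1 - r))"
proof -
  have "(\<integral>\<^sup>+ s. ennreal ((1 - s\<^sup>2) / (1 - r * s)\<^sup>2) \<partial>radial_measure n)
     = (\<integral>\<^sup>+ s. ennreal (2 * real n * s ^ (2 * n - 1) / (1 - s\<^sup>2)) * ennreal ((1 - s\<^sup>2) / (1 - r * s)\<^sup>2) * indicator {0..<1} s \<partial>lborel)"
    by (rule radial_measure_integral) measurable
  also have "\<dots> \<le> (\<integral>\<^sup>+ s. ennreal (2 * real n / (1 - r * s)\<^sup>2) * indicator {0..1} s \<partial>lborel)"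
  proof (rule nn_integral_mono)
    fix s :: real
    show "ennreal (2 * real n * s ^ (2 * n - 1) / (1 - s\<^sup>2)) * ennreal ((1 - s\<^sup>2) / (1 - r * s)\<^sup>2) * indicator {0..<1} s
      \<le> ennreal (2 * real n / (1 - r * s)\<^sup>2) * indicator {0..1} s"
    proof (cases "0 \<le> s \<and> s < 1")
      case True
      then have s2: "s\<^sup>2 < 1" by (simp add: abs_square_less_1)
      have "ennreal (2 * real n * s ^ (2 * n - 1) / (1 - s\<^sup>2)) * ennreal ((1 - s\<^sup>2) / (1 - r * s)\<^sup>2)
          = ennreal (2 * real n * s ^ (2 * n - 1) / (1 - r * s)\<^sup>2)"
        using s2 True by (subst ennreal_mult[symmetric]) auto
      also have "\<dots> \<le> ennreal (2 * real n / (1 - r * s)\<^sup>2)"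
        using True by (intro ennreal_leI divide_right_mono mult_left_le power_le_one) auto
      finally show ?thesis using True by simp
    qed (auto simp: indicator_def)
  qed
  also have "\<dots> = ennreal (2 * real n * (1 / (1 - r * 1)) - 2 * real n * (0 / (1 - r * 0)))"
  proof (rule nn_integral_FTC_Icc)
    fix s assume s: "s \<in> {0..1::real}"
    have "r * s \<le> r" using r s by (simp add: mult_left_le)
    then have "1 - r * s \<noteq> 0" using r by linarith
    then show "((\<lambda>s. 2 * real n * (s / (1 - r * s))) has_real_derivative 2 * real n / (1 - r * s)\<^sup>2) (at s)"
      by (auto intro!: derivative_eq_intros simp: field_simps power2_eq_square)
  qed auto
  finally show ?thesis by simp
qed

text \<open>A majorant, up to the factor \<open>2\<close>, of the kernel of \<open>(1 - \<bar>z\<bar>\<^sup>2) (I + R / n) \<B>\<close> in the polar coordinates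
  \<open>(\<zeta>, r)\<close>, with respect to \<^const>\<open>sphere_measure\<close> and \<^const>\<open>radial_measure\<close>. The factor \<open>1 - s\<^sup>2\<close>
  comes from the change of measure and makes the kernel symmetric.\<close>

definition bergman_kernel :: "(complex ^ 'n) \<times> real \<Rightarrow> (complex ^ 'n) \<times> real \<Rightarrow> ennreal" where
  "bergman_kernel x y = ennreal ((1 - (snd x)\<^sup>2) * (1 - (snd y)\<^sup>2)
     / cmod (1 - of_real (snd x * snd y) * hprod (fst x) (fst y)) ^ (CARD('n) + 2))"

lemma bergman_kernel_sym: "bergman_kernel x y = bergman_kernel y x"
proof -
  have "cmod (1 - of_real (snd x * snd y) * hprod (fst x) (fst y)) = cmod (cnj (1 - of_real (snd x * snd y) * hprod (fst x) (fst y)))"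
    by (simp only: complex_mod_cnj)
  also have "\<dots> = cmod (1 - of_real (snd y * snd x) * hprod (fst y) (fst x))"
    by (simp add: hprod_cnj mult.commute)
  finally show ?thesis by (simp add: bergman_kernel_def mult.commute)
qed

lemma bergman_kernel_measurable [measurable (raw)]:
  assumes [measurable]: "f \<in> borel_measurable M" "g \<in> borel_measurable M" "f' \<in> borel_measurable M" "g' \<in> borel_measurable M"
  shows "(\<lambda>x. bergman_kernel (f x, f' x) (g x, g' x)) \<in> borel_measurable M"
  unfolding bergman_kernel_def by measurable

definition kernel_const :: "nat \<Rightarrow> real" where
  "kernel_const n = 2 * real n * (real n + 2) * 3 ^ n"

text \<open>After the integration over the sphere there remains \<open>(1 - r\<^sup>2) (1 - s\<^sup>2) / (1 - r s)\<^sup>2\<close>, whose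
  radial integral is \<open>O(1)\<close> uniformly in \<open>r\<close>. With \<open>h = 1\<close> this is the Schur test, and in general it
  gives the domination by the maximal function.\<close>

lemma bergman_kernel_integral_le:
  fixes h :: "complex ^ 'n \<Rightarrow> ennreal"
  assumes [measurable]: "h \<in> borel_measurable borel" and \<zeta>: "norm \<zeta> = 1" and r: "0 \<le> r" "r < 1"
    and B: "\<And>t. 0 < t \<Longrightarrow> (\<integral>\<^sup>+ \<eta>. h \<eta> * indicator {\<eta> \<in> sphere 0 1. koranyi \<zeta> \<eta> < t} \<eta> \<partial>sphere_measure) \<le> ennreal (t ^ CARD('n)) * B"
  shows "(\<integral>\<^sup>+ y. bergman_kernel (\<zeta>, r) y * h (fst y) \<partial>(sphere_measure \<Otimes>\<^sub>M radial_measure (CARD('n))))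
     \<le> ennreal (kernel_const (CARD('n))) * B"
proof -
  let ?n = "CARD('n)" and ?\<sigma> = "sphere_measure :: (complex ^ 'n) measure" and ?\<mu> = "radial_measure (CARD('n))"
  interpret prob_space ?\<sigma> by (rule prob_space_sphere_measure)
  interpret R: sigma_finite_measure ?\<mu> by (rule sigma_finite_radial_measure)
  interpret P: pair_sigma_finite ?\<sigma> ?\<mu> by unfold_locales
  define c where "c = (real ?n + 2) * 3 ^ ?n / 2"
  have c: "0 \<le> c" by (simp add: c_def)
  have r2: "r\<^sup>2 < 1" using r by (simp add: abs_square_less_1)
  have [measurable]: "bergman_kernel (\<zeta>, r) \<in> borel_measurable (?\<sigma> \<Otimes>\<^sub>M ?\<mu>)"
    unfolding bergman_kernel_def by measurable
  have "(\<integral>\<^sup>+ y. bergman_kernel (\<zeta>, r) y * h (fst y) \<partial>(?\<sigma> \<Otimes>\<^sub>M ?\<mu>))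
     = (\<integral>\<^sup>+ s. \<integral>\<^sup>+ \<eta>. bergman_kernel (\<zeta>, r) (\<eta>, s) * h \<eta> \<partial>?\<sigma> \<partial>?\<mu>)"
    by (subst P.nn_integral_snd[symmetric]) (auto simp: case_prod_beta)
  also have "\<dots> \<le> (\<integral>\<^sup>+ s. (ennreal ((1 - r\<^sup>2) * c) * B) * ennreal ((1 - s\<^sup>2) / (1 - r * s)\<^sup>2) \<partial>?\<mu>)"
  proof (rule nn_integral_mono_AE, rule eventually_mono[OF AE_radial_measure])
    fix s :: real assume s: "0 \<le> s \<and> s < 1"
    have s2: "s\<^sup>2 < 1" using s by (simp add: abs_square_less_1)
    have "r * s \<le> r" using s r by (simp add: mult_left_le)
    then have rs: "0 \<le> r * s" "r * s < 1" using r s by auto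
    have "(\<integral>\<^sup>+ \<eta>. bergman_kernel (\<zeta>, r) (\<eta>, s) * h \<eta> \<partial>?\<sigma>)
       = (\<integral>\<^sup>+ \<eta>. ennreal ((1 - r\<^sup>2) * (1 - s\<^sup>2)) * (h \<eta> * ennreal (1 / cmod (1 - of_real (r * s) * hprod \<zeta> \<eta>) ^ (?n + 2))) \<partial>?\<sigma>)"
    proof (rule nn_integral_cong)
      fix \<eta>
      have "bergman_kernel (\<zeta>, r) (\<eta>, s) = ennreal ((1 - r\<^sup>2) * (1 - s\<^sup>2)) * ennreal (1 / cmod (1 - of_real (r * s) * hprod \<zeta> \<eta>) ^ (?n + 2))"
        using r2 s2 by (subst ennreal_mult[symmetric]) (auto simp: bergman_kernel_def)
      then show "bergman_kernel (\<zeta>, r) (\<eta>, s) * h \<eta> = ennreal ((1 - r\<^sup>2) * (1 - s\<^sup>2)) * (h \<eta> * ennreal (1 / cmod (1 - of_real (r * s) * hprod \<zeta> \<eta>) ^ (?n + 2)))"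
        by (simp only: mult_ac)
    qed
    also have "\<dots> = ennreal ((1 - r\<^sup>2) * (1 - s\<^sup>2)) * (\<integral>\<^sup>+ \<eta>. h \<eta> * ennreal (1 / cmod (1 - of_real (r * s) * hprod \<zeta> \<eta>) ^ (?n + 2)) \<partial>?\<sigma>)"
      by (rule nn_integral_cmult) measurable
    also have "\<dots> \<le> ennreal ((1 - r\<^sup>2) * (1 - s\<^sup>2)) * (ennreal (c / (1 - r * s)\<^sup>2) * B)"
      unfolding c_def by (intro mult_left_mono kernel_integral_le \<zeta> rs B) auto
    also have "\<dots> = ennreal ((1 - r\<^sup>2) * (1 - s\<^sup>2) * (c / (1 - r * s)\<^sup>2)) * B"
      using r2 s2 c by (subst (2) ennreal_mult) (auto simp: mult.assoc)
    also have "(1 - r\<^sup>2) * (1 - s\<^sup>2) * (c / (1 - r * s)\<^sup>2) = ((1 - r\<^sup>2) * c) * ((1 - s\<^sup>2) / (1 - r * s)\<^sup>2)"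
      by simp
    also have "ennreal \<dots> * B = (ennreal ((1 - r\<^sup>2) * c) * B) * ennreal ((1 - s\<^sup>2) / (1 - r * s)\<^sup>2)"
      using r2 s2 c by (subst ennreal_mult) (auto simp: mult_ac)
    finally show "(\<integral>\<^sup>+ \<eta>. bergman_kernel (\<zeta>, r) (\<eta>, s) * h \<eta> \<partial>?\<sigma>)
       \<le> (ennreal ((1 - r\<^sup>2) * c) * B) * ennreal ((1 - s\<^sup>2) / (1 - r * s)\<^sup>2)" .
  qed
  also have "\<dots> = (ennreal ((1 - r\<^sup>2) * c) * B) * (\<integral>\<^sup>+ s. ennreal ((1 - s\<^sup>2) / (1 - r * s)\<^sup>2) \<partial>?\<mu>)"
    by (rule nn_integral_cmult) measurable
  also have "\<dots> \<le> (ennreal ((1 - r\<^sup>2) * c) * B) * ennreal (2 * real ?n / (1 - r))"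
    by (intro mult_left_mono radial_kernel_integral_le r) auto
  also have "\<dots> = ennreal ((1 - r\<^sup>2) * c * (2 * real ?n / (1 - r))) * B"
    using r2 c r by (subst (2) ennreal_mult) (auto simp: mult_ac)
  also have "\<dots> \<le> ennreal (kernel_const ?n) * B"
  proof (intro mult_right_mono ennreal_leI)
    have "(1 - r\<^sup>2) * c * (2 * real ?n / (1 - r)) = (1 + r) * (2 * real ?n * c)"
      using r by (simp add: power2_eq_square field_simps)
    also have "\<dots> \<le> 2 * (2 * real ?n * c)" using r c by (intro mult_right_mono) auto
    also have "\<dots> = kernel_const ?n" by (simp add: kernel_const_def c_def)
    finally show "(1 - r\<^sup>2) * c * (2 * real ?n / (1 - r)) \<le> kernel_const ?n" .
  qed simp
  finally show ?thesis .
qed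

definition bound_const :: "'n::finite itself \<Rightarrow> real" where
  "bound_const _ = kernel_const (CARD('n)) * 2 ^ CARD('n) * cap_space.maximal_const (CARD('n)) (cap_const TYPE('n))"

lemma maximal_kernel_bergman:
  "maximal_kernel (sphere_measure :: (complex ^ 'n) measure) (radial_measure (CARD('n))) bergman_kernel (bound_const TYPE('n))"
proof -
  let ?n = "CARD('n)" and ?\<sigma> = "sphere_measure :: (complex ^ 'n) measure" and ?\<mu> = "radial_measure (CARD('n))"
  interpret caps: cap_space ?\<sigma> "sphere 0 1" koranyi ?n "cap_const TYPE('n)" by (rule cap_space_sphere)
  interpret R: sigma_finite_measure ?\<mu> by (rule sigma_finite_radial_measure)
  interpret P: pair_sigma_finite ?\<sigma> ?\<mu> by unfold_locales
  let ?K = "kernel_const ?n" and ?m = caps.maximal_const and ?C = "cap_const TYPE('n)"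
  have K: "0 < ?K" by (simp add: kernel_const_def)
  have m: "1 \<le> ?m" "?C \<le> ?m"
  proof -
    have "?C + 1 \<le> (?C + 1) * (?C * 5 ^ ?n + 1)"
      using cap_const_nonneg[where 'n='n] by (simp add: mult_le_cancel_left1)
    then show "1 \<le> ?m" "?C \<le> ?m" using cap_const_nonneg[where 'n='n] unfolding caps.maximal_const_def by argo+
  qed
  have AE_X: "AE x in ?\<sigma> \<Otimes>\<^sub>M ?\<mu>. norm (fst x) = 1 \<and> 0 \<le> snd x \<and> snd x < 1"
  proof (rule P.AE_pair_measure)
    show "{x \<in> space (?\<sigma> \<Otimes>\<^sub>M ?\<mu>). norm (fst x) = 1 \<and> 0 \<le> snd x \<and> snd x < 1} \<in> sets (?\<sigma> \<Otimes>\<^sub>M ?\<mu>)"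
      by measurable
    show "AE x in ?\<sigma>. AE y in ?\<mu>. norm (fst (x, y)) = 1 \<and> 0 \<le> snd (x, y) \<and> snd (x, y) < 1"
      by (rule eventually_mono[OF AE_sphere], rule eventually_mono[OF AE_radial_measure]) auto
  qed
  show ?thesis
  proof (unfold_locales)
    show "(\<lambda>(x, y). bergman_kernel x y) \<in> borel_measurable ((?\<sigma> \<Otimes>\<^sub>M ?\<mu>) \<Otimes>\<^sub>M (?\<sigma> \<Otimes>\<^sub>M ?\<mu>))"
      unfolding bergman_kernel_def by measurable
    show "bergman_kernel x y = bergman_kernel y x" for x y :: "(complex ^ 'n) \<times> real" by (rule bergman_kernel_sym)
    show "0 < bound_const TYPE('n)" using K m by (simp add: bound_const_def)
    show "AE x in ?\<sigma> \<Otimes>\<^sub>M ?\<mu>. (\<integral>\<^sup>+ y. bergman_kernel x y \<partial>(?\<sigma> \<Otimes>\<^sub>M ?\<mu>)) \<le> ennreal (bound_const TYPE('n))"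
    proof (rule eventually_mono[OF AE_X])
      fix x :: "(complex ^ 'n) \<times> real" assume x: "norm (fst x) = 1 \<and> 0 \<le> snd x \<and> snd x < 1"
      have "(\<integral>\<^sup>+ y. bergman_kernel (fst x, snd x) y * (\<lambda>_. 1) (fst y) \<partial>(?\<sigma> \<Otimes>\<^sub>M ?\<mu>)) \<le> ennreal ?K * ennreal ?C"
      proof (rule bergman_kernel_integral_le)
        fix t :: real assume t: "0 < t"
        have "(\<integral>\<^sup>+ \<eta>. 1 * indicator {\<eta> \<in> sphere 0 1. koranyi (fst x) \<eta> < t} \<eta> \<partial>?\<sigma>) = emeasure ?\<sigma> {\<eta> \<in> sphere 0 1. koranyi (fst x) \<eta> < t}"
          by simp
        also have "\<dots> \<le> ennreal (?C * t ^ ?n)" using x t by (intro emeasure_cap_le) auto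
        finally show "(\<integral>\<^sup>+ \<eta>. 1 * indicator {\<eta> \<in> sphere 0 1. koranyi (fst x) \<eta> < t} \<eta> \<partial>?\<sigma>) \<le> ennreal (t ^ ?n) * ennreal ?C"
          using t cap_const_nonneg[where 'n='n] by (simp add: ennreal_mult mult.commute)
      qed (use x in auto)
      also have "\<dots> \<le> ennreal (bound_const TYPE('n))"
      proof -
        have "?K * ?C \<le> ?K * (2 ^ ?n * ?m)"
          using K m mult_mono[of 1 "2 ^ ?n" ?C ?m] cap_const_nonneg[where 'n='n] by (intro mult_left_mono) auto
        then show ?thesis using K cap_const_nonneg[where 'n='n]
          by (simp add: bound_const_def mult.assoc ennreal_leI flip: ennreal_mult)
      qed
      finally show "(\<integral>\<^sup>+ y. bergman_kernel x y \<partial>(?\<sigma> \<Otimes>\<^sub>M ?\<mu>)) \<le> ennreal (bound_const TYPE('n))" by simp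
    qed
  next
    fix q :: real and h :: "complex ^ 'n \<Rightarrow> ennreal"
    assume q: "1 < q" and h: "h \<in> borel_measurable ?\<sigma>"
    have [measurable]: "h \<in> borel_measurable borel" using h by simp
    define a where "a = ?K * 2 ^ ?n"
    have a: "0 < a" using K by (simp add: a_def)
    define Mh where "Mh \<zeta> = ennreal a * caps.maximal_fun h \<zeta>" for \<zeta>
    have [measurable]: "caps.maximal_fun h \<in> borel_measurable ?\<sigma>" by (rule caps.maximal_fun_measurable[OF h])
    have "AE x in ?\<sigma> \<Otimes>\<^sub>M ?\<mu>. (\<integral>\<^sup>+ y. bergman_kernel x y * h (fst y) \<partial>(?\<sigma> \<Otimes>\<^sub>M ?\<mu>)) \<le> Mh (fst x)"
    proof (rule eventually_mono[OF AE_X])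
      fix x :: "(complex ^ 'n) \<times> real" assume x: "norm (fst x) = 1 \<and> 0 \<le> snd x \<and> snd x < 1"
      have "(\<integral>\<^sup>+ y. bergman_kernel (fst x, snd x) y * h (fst y) \<partial>(?\<sigma> \<Otimes>\<^sub>M ?\<mu>))
         \<le> ennreal ?K * (ennreal (2 ^ ?n) * caps.maximal_fun h (fst x))"
      proof (rule bergman_kernel_integral_le)
        fix t :: real assume t: "0 < t"
        show "(\<integral>\<^sup>+ \<eta>. h \<eta> * indicator {\<eta> \<in> sphere 0 1. koranyi (fst x) \<eta> < t} \<eta> \<partial>?\<sigma>)
          \<le> ennreal (t ^ ?n) * (ennreal (2 ^ ?n) * caps.maximal_fun h (fst x))"
          using caps.cap_integral_le[of "fst x" t h] x t
          by (simp add: caps.cap_def power_mult_distrib ennreal_mult mult_ac)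
      qed (use x in auto)
      then show "(\<integral>\<^sup>+ y. bergman_kernel x y * h (fst y) \<partial>(?\<sigma> \<Otimes>\<^sub>M ?\<mu>)) \<le> Mh (fst x)"
        using K by (simp add: Mh_def a_def ennreal_mult mult.assoc)
    qed
    moreover have "(\<integral>\<^sup>+ \<zeta>. epowr (Mh \<zeta>) q \<partial>?\<sigma>) \<le> epowr (ennreal (bound_const TYPE('n) * (q / (q - 1)))) q * (\<integral>\<^sup>+ \<zeta>. epowr (h \<zeta>) q \<partial>?\<sigma>)"
    proof -
      have "(\<integral>\<^sup>+ \<zeta>. epowr (Mh \<zeta>) q \<partial>?\<sigma>) = epowr (ennreal a) q * (\<integral>\<^sup>+ \<zeta>. epowr (caps.maximal_fun h \<zeta>) q \<partial>?\<sigma>)"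
        unfolding Mh_def epowr_mult by (rule nn_integral_cmult) measurable
      also have "\<dots> \<le> epowr (ennreal a) q * (epowr (ennreal (?m * (q / (q - 1)))) q * (\<integral>\<^sup>+ \<zeta>. epowr (h \<zeta>) q \<partial>?\<sigma>))"
        by (intro mult_left_mono caps.strong_type q h) auto
      also have "\<dots> = epowr (ennreal a * ennreal (?m * (q / (q - 1)))) q * (\<integral>\<^sup>+ \<zeta>. epowr (h \<zeta>) q \<partial>?\<sigma>)"
        by (simp add: epowr_mult mult.assoc)
      also have "ennreal a * ennreal (?m * (q / (q - 1))) = ennreal (bound_const TYPE('n) * (q / (q - 1)))"
        using a m q by (subst ennreal_mult[symmetric]) (auto simp: bound_const_def a_def)
      finally show ?thesis .
    qed
    ultimately show "\<exists>Mh \<in> borel_measurable ?\<sigma>.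
        (AE x in ?\<sigma> \<Otimes>\<^sub>M ?\<mu>. (\<integral>\<^sup>+ y. bergman_kernel x y * h (fst y) \<partial>(?\<sigma> \<Otimes>\<^sub>M ?\<mu>)) \<le> Mh (fst x)) \<and>
        (\<integral>\<^sup>+ \<zeta>. epowr (Mh \<zeta>) q \<partial>?\<sigma>) \<le> epowr (ennreal (bound_const TYPE('n) * (q / (q - 1)))) q * (\<integral>\<^sup>+ \<zeta>. epowr (h \<zeta>) q \<partial>?\<sigma>)"
      by (intro bexI[of _ Mh] conjI) (simp_all add: Mh_def[abs_def])
  qed
qed

section \<open>Derivatives of the Bergman transform\<close>

lemma borel_measurable_ball_measure:
  fixes f :: "complex ^ 'n \<Rightarrow> 'b::topological_space"
  assumes "f \<in> measurable borel M"
  shows "f \<in> measurable ball_measure M"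
proof -
  have "f \<in> measurable (lebesgue_on (ball 0 1)) M"
    by (intro measurable_restrict_space1 measurable_completion) (use assms in simp)
  then show ?thesis by (simp add: ball_measure_def measurable_def)
qed

lemma space_ball_measure [simp]: "space (ball_measure :: (complex ^ 'n) measure) = ball 0 1"
  by (simp add: ball_measure_def)

text \<open>The \<open>i\<close>-th derivative of \<open>(1 - u) powi (- m)\<close>.\<close>

definition pow_kernel :: "nat \<Rightarrow> nat \<Rightarrow> complex \<Rightarrow> complex" where
  "pow_kernel m i u = (\<Prod>k<i. of_nat (m + k)) / (1 - u) ^ (m + i)"

lemma pow_kernel_measurable [measurable]: "pow_kernel m i \<in> borel_measurable borel"
  unfolding pow_kernel_def by measurable

lemma has_field_derivative_pow_kernel:
  assumes "u \<noteq> 1"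
  shows "(pow_kernel m i has_field_derivative pow_kernel m (Suc i) u) (at u within S)"
proof -
  have nz: "1 - u \<noteq> 0" using assms by simp
  have "((\<lambda>u. c / (1 - u) ^ j) has_field_derivative (c * of_nat j) / (1 - u) ^ Suc j) (at u within S)" for c :: complex and j
  proof (cases j)
    case (Suc l)
    have "((\<lambda>u. c / (1 - u) ^ j) has_field_derivative (c * of_nat j * (1 - u) ^ l) / ((1 - u) ^ Suc l * (1 - u) ^ Suc l)) (at u within S)"
    proof -
      have "((\<lambda>u. 1 - u) has_field_derivative 0 - 1) (at u within S)"
        by (intro DERIV_diff DERIV_const DERIV_ident)
      then have "((\<lambda>u. (1 - u) ^ j) has_field_derivative of_nat j * ((0 - 1) * (1 - u) ^ (j - Suc 0))) (at u within S)"
        by (rule DERIV_power)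
      then have "((\<lambda>u. c / (1 - u) ^ j) has_field_derivative
          (0 * (1 - u) ^ j - c * (of_nat j * ((0 - 1) * (1 - u) ^ (j - Suc 0)))) / ((1 - u) ^ j * (1 - u) ^ j)) (at u within S)"
        using nz by (intro DERIV_divide DERIV_const) auto
      then show ?thesis using Suc by (simp del: of_nat_Suc add: mult.assoc)
    qed
    also have "(c * of_nat j * (1 - u) ^ l) / ((1 - u) ^ Suc l * (1 - u) ^ Suc l) = (c * of_nat j) / (1 - u) ^ Suc j"
      using nz Suc by (simp add: divide_simps del: of_nat_Suc)
    finally show ?thesis .
  qed (auto intro!: derivative_eq_intros)
  from this[of "\<Prod>k<i. of_nat (m + k)" "m + i"] show ?thesis
    unfolding pow_kernel_def[abs_def] by simp
qed

lemma norm_pow_kernel_le: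
  assumes "cmod u \<le> q" "q < 1"
  shows "cmod (pow_kernel m i u) \<le> (\<Prod>k<i. real (m + k)) / (1 - q) ^ (m + i)"
proof -
  have "1 - q \<le> cmod (1 - u)" using norm_triangle_ineq2[of 1 u] assms by simp
  then have "(1 - q) ^ (m + i) \<le> cmod (1 - u) ^ (m + i)" using assms by (intro power_mono) auto
  moreover have "0 < (1 - q) ^ (m + i)" using assms by simp
  moreover have "cmod (\<Prod>k<i. of_nat (m + k)) = (\<Prod>k<i. real (m + k))"
    by (simp add: prod_norm[symmetric] del: of_nat_add)
  ultimately show ?thesis
    unfolding pow_kernel_def norm_divide norm_power
    by (auto intro!: divide_left_mono mult_pos_pos prod_nonneg)
qed

text \<open>A quadratic remainder, uniform on a disc of radius less than one: this is all that differentiation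
  under the Bergman integral needs.\<close>

lemma pow_kernel_taylor:
  assumes "cmod u \<le> q" "cmod v \<le> q" "q < 1"
  shows "cmod (pow_kernel m 0 v - pow_kernel m 0 u - pow_kernel m 1 u * (v - u))
     \<le> (\<Prod>k<2. real (m + k)) / (1 - q) ^ (m + 2) * (cmod (v - u))\<^sup>2"
proof -
  have "cmod (pow_kernel m 0 v - (\<Sum>i\<le>1. pow_kernel m i u * (v - u) ^ i / fact i))
     \<le> (\<Prod>k<2. real (m + k)) / (1 - q) ^ (m + 2) * cmod (v - u) ^ Suc 1 / fact 1"
  proof (rule complex_Taylor[of "cball 0 q"])
    fix i x assume "x \<in> cball (0 :: complex) q"
    then have "x \<noteq> 1" using assms(3) by auto
    then show "(pow_kernel m i has_field_derivative pow_kernel m (Suc i) x) (at x within cball 0 q)"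
      by (rule has_field_derivative_pow_kernel)
  next
    fix x assume "x \<in> cball (0 :: complex) q"
    then show "cmod (pow_kernel m (Suc 1) x) \<le> (\<Prod>k<2. real (m + k)) / (1 - q) ^ (m + 2)"
      using norm_pow_kernel_le[of x q m "Suc 1"] assms(3) by (simp add: numeral_2_eq_2)
  qed (use assms in auto)
  then show ?thesis by (simp add: numeral_2_eq_2 diff_diff_eq)
qed

text \<open>The complex derivative in the \<open>j\<close>-th coordinate is the Frechet derivative along a complex line,
  where complex linearity identifies it with multiplication by a number.\<close>

lemma partial_deriv_eq:
  fixes f :: "complex ^ 'n \<Rightarrow> complex"
  assumes f: "(f has_derivative f') (at z)" and lin: "\<And>c v. f' (c *s v) = c * f' v"
  shows "partial_deriv j f z = f' (axis j 1)"
proof -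
  have g: "(\<lambda>t. \<chi> i. if i = j then t else z $ i) = (\<lambda>t. (z - (z $ j) *s axis j 1) + t *s axis j 1)"
    by (auto simp: vec_eq_iff axis_def)
  have "bounded_linear (\<lambda>t::complex. t *s axis j 1 :: complex ^ 'n)"
    by (intro linear_conv_bounded_linear[THEN iffD1] linearI) (auto simp: vec_eq_iff axis_def algebra_simps)
  then have "((\<lambda>t. (z - (z $ j) *s axis j 1) + t *s axis j 1) has_derivative (\<lambda>t. 0 + t *s axis j 1)) (at (z $ j))"
    by (intro has_derivative_add has_derivative_const bounded_linear_imp_has_derivative)
  moreover have "(f has_derivative f') (at ((z - (z $ j) *s axis j 1) + (z $ j) *s axis j 1))" using f by simp
  ultimately have "((\<lambda>t. f ((z - (z $ j) *s axis j 1) + t *s axis j 1)) has_derivative (\<lambda>t. f' (0 + t *s axis j 1))) (at (z $ j))"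
    by (rule has_derivative_compose)
  then have "((\<lambda>t. f (\<chi> i. if i = j then t else z $ i)) has_field_derivative f' (axis j 1)) (at (z $ j))"
  proof -
    have "(\<lambda>t. f' (0 + t *s axis j 1)) = (*) (f' (axis j 1))" by (auto simp: lin)
    with \<open>(_ has_derivative (\<lambda>t. f' (0 + t *s axis j 1))) _\<close> show ?thesis
      unfolding g[THEN fun_cong] has_field_derivative_def by simp
  qed
  then show ?thesis unfolding partial_deriv_def by (rule DERIV_imp_deriv)
qed

lemma radial_deriv_eq:
  fixes f :: "complex ^ 'n \<Rightarrow> complex"
  assumes f: "(f has_derivative f') (at z)" and lin: "\<And>c v. f' (c *s v) = c * f' v"
  shows "radial_deriv f z = f' z"
proof -
  interpret f': bounded_linear f' by (rule has_derivative_bounded_linear[OF f])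
  have "f' z = f' (\<Sum>j\<in>UNIV. (z $ j) *s axis j 1)"
    by (rule arg_cong[where f = f']) (simp add: vec_eq_iff axis_def if_distrib[of "\<lambda>x. _ * x"] cong: if_cong)
  also have "\<dots> = (\<Sum>j\<in>UNIV. z $ j * f' (axis j 1))" by (simp add: f'.sum lin)
  also have "\<dots> = radial_deriv f z" unfolding radial_deriv_def by (simp add: partial_deriv_eq[OF f lin])
  finally show ?thesis by simp
qed

text \<open>Integrability is enough to differentiate under the integral sign, since for fixed \<open>z\<close> in the ball the
  Bergman kernel is bounded in \<open>w\<close>.\<close>

locale integrable_on_ball =
  fixes \<phi> :: "complex ^ 'n \<Rightarrow> complex"
  assumes integrable: "integrable ball_measure \<phi>"
begin

lemma integrable_times_bounded:
  assumes g: "g \<in> borel_measurable borel" and K: "\<And>w. norm w < 1 \<Longrightarrow> cmod (g w) \<le> K"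
  shows "integrable ball_measure (\<lambda>w. \<phi> w * g w)"
proof (rule Bochner_Integration.integrable_bound)
  show "integrable ball_measure (\<lambda>w. K *\<^sub>R \<phi> w)" using integrable by simp
  show "(\<lambda>w. \<phi> w * g w) \<in> borel_measurable ball_measure"
    using integrable borel_measurable_ball_measure[OF g] by (intro borel_measurable_times) auto
  have "0 \<le> K" using order_trans[OF norm_ge_zero K[of 0]] by simp
  then show "AE w in ball_measure. cmod (\<phi> w * g w) \<le> cmod (K *\<^sub>R \<phi> w)"
    by (intro AE_I2) (simp add: norm_mult mult.commute[of K] mult_left_mono K)
qed

lemma norm_hprod_ball:
  assumes "norm w < 1"
  shows "cmod (hprod h w) \<le> norm h"
  using norm_hprod_le[of h w] mult_left_le[of "norm w" "norm h"] assms by simp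

lemma integrable_kernel:
  assumes z: "norm z < 1"
  shows "integrable ball_measure (\<lambda>w. \<phi> w * (pow_kernel m i (hprod z w) * hprod h w ^ l))"
proof (rule integrable_times_bounded)
  show "(\<lambda>w. pow_kernel m i (hprod z w) * hprod h w ^ l) \<in> borel_measurable borel" by measurable
  fix w :: "complex ^ 'n" assume w: "norm w < 1"
  have "cmod (pow_kernel m i (hprod z w)) \<le> (\<Prod>k<i. real (m + k)) / (1 - norm z) ^ (m + i)"
    by (rule norm_pow_kernel_le[OF norm_hprod_ball[OF w] z])
  moreover have "cmod (hprod h w ^ l) \<le> norm h ^ l"
    using norm_hprod_ball[OF w] by (simp add: norm_power power_mono)
  ultimately show "cmod (pow_kernel m i (hprod z w) * hprod h w ^ l) \<le> (\<Prod>k<i. real (m + k)) / (1 - norm z) ^ (m + i) * norm h ^ l"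
    unfolding norm_mult by (rule mult_mono) (use z in \<open>auto intro!: divide_nonneg_nonneg prod_nonneg\<close>)
qed

lemma integrable_bergman_integrand: "norm z < 1 \<Longrightarrow> integrable ball_measure (bergman_integrand \<phi> z)"
  using integrable_kernel[of z "CARD('n) + 1" 0 0 0]
  by (simp add: bergman_integrand_def[abs_def] pow_kernel_def)

definition bergman_deriv :: "complex ^ 'n \<Rightarrow> complex ^ 'n \<Rightarrow> complex" where
  "bergman_deriv z h = (\<integral>w. \<phi> w * (pow_kernel (CARD('n) + 1) 1 (hprod z w) * hprod h w) \<partial>ball_measure)"

lemma bergman_deriv_smult: "bergman_deriv z (c *s h) = c * bergman_deriv z h"
  unfolding bergman_deriv_def by (subst integral_mult_right_zero[symmetric]) (simp add: hprod_smult_left mult_ac)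

text \<open>The second order Taylor estimate holds for all \<open>w\<close> in the ball with one constant as long as \<open>y\<close>
  stays in a ball of radius \<open>q < 1\<close>, hence it can be integrated against \<open>\<bar>\<phi>\<bar>\<close>.\<close>

lemma bergman_has_derivative:
  assumes z: "norm z < 1"
  shows "(bergman \<phi> has_derivative bergman_deriv z) (at z)"
proof -
  let ?m = "CARD('n) + 1"
  (* any radius between norm z and 1 would do *)
  define q where "q = (1 + norm z) / 2"
  have q: "norm z < q" "q < 1" using z by (auto simp: q_def)
  define B where "B = (\<Prod>k<2. real (?m + k)) / (1 - q) ^ (?m + 2)"
  have B: "0 \<le> B" using q unfolding B_def by (intro divide_nonneg_nonneg prod_nonneg) auto
  define L where "L = (\<integral>w. cmod (\<phi> w) \<partial>ball_measure)"
  have L: "0 \<le> L" by (simp add: L_def)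
  have berg: "bergman \<phi> y = (\<integral>w. \<phi> w * (pow_kernel ?m 0 (hprod y w)) \<partial>ball_measure)" for y
    by (simp add: bergman_def bergman_integrand_def pow_kernel_def)
  have int0: "integrable ball_measure (\<lambda>w. \<phi> w * pow_kernel ?m 0 (hprod y w))" if "norm y < 1" for y
    using integrable_kernel[OF that, of ?m 0 0 0] by simp
  have int1: "integrable ball_measure (\<lambda>w. \<phi> w * (pow_kernel ?m 1 (hprod z w) * hprod h w))" for h
    using integrable_kernel[OF z, of ?m 1 h 1] by simp
  have intn: "integrable ball_measure (\<lambda>w. cmod (\<phi> w))" using integrable by simp
  have bl: "bounded_linear (bergman_deriv z)"
  proof (rule bounded_linear_intro)
    fix x y r
    show "bergman_deriv z (x + y) = bergman_deriv z x + bergman_deriv z y"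
      unfolding bergman_deriv_def
      by (subst Bochner_Integration.integral_add[symmetric]) (auto simp: hprod_add_left distrib_left int1[simplified])
    show "bergman_deriv z (r *\<^sub>R x) = r *\<^sub>R bergman_deriv z x"
      unfolding bergman_deriv_def
      by (simp only: hprod_scaleR_left scaleR_conv_of_real[of r, where 'a=complex], subst integral_mult_right_zero[symmetric])
         (simp add: mult_ac)
    define C where "C = (\<Prod>k<1. real (?m + k)) / (1 - norm z) ^ (?m + 1)"
    have "norm (bergman_deriv z x) \<le> (\<integral>w. cmod (\<phi> w * (pow_kernel ?m 1 (hprod z w) * hprod x w)) \<partial>ball_measure)"
      unfolding bergman_deriv_def by (rule integral_norm_bound)
    also have "\<dots> \<le> (\<integral>w. (C * norm x) * cmod (\<phi> w) \<partial>ball_measure)"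
    proof (rule integral_mono)
      fix w :: "complex ^ 'n" assume "w \<in> space ball_measure"
      then have w: "norm w < 1" by simp
      have "cmod (pow_kernel ?m 1 (hprod z w)) * cmod (hprod x w) \<le> C * norm x"
        unfolding C_def using z
        by (intro mult_mono norm_pow_kernel_le norm_hprod_ball w) (auto intro!: divide_nonneg_nonneg prod_nonneg)
      then show "cmod (\<phi> w * (pow_kernel ?m 1 (hprod z w) * hprod x w)) \<le> (C * norm x) * cmod (\<phi> w)"
        by (simp add: norm_mult mult.commute[of "cmod (\<phi> w)"] mult_right_mono)
    qed (use int1 intn in auto)
    finally show "norm (bergman_deriv z x) \<le> norm x * (C * L)"
      by (simp add: L_def mult_ac)
  qed
  have est: "norm (bergman \<phi> y - bergman \<phi> z - bergman_deriv z (y - z)) \<le> B * L * (norm (y - z))\<^sup>2" if y: "norm y < q" for y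
  proof -
    have y1: "norm y < 1" using y q by simp
    have eq: "bergman \<phi> y - bergman \<phi> z - bergman_deriv z (y - z)
      = (\<integral>w. \<phi> w * pow_kernel ?m 0 (hprod y w) - \<phi> w * pow_kernel ?m 0 (hprod z w) - \<phi> w * (pow_kernel ?m 1 (hprod z w) * hprod (y - z) w) \<partial>ball_measure)"
      unfolding berg bergman_deriv_def
      using int0[OF y1] int0[OF z] int1[of "y - z"] by simp
    have "norm (bergman \<phi> y - bergman \<phi> z - bergman_deriv z (y - z)) \<le> (\<integral>w. cmod (\<phi> w * pow_kernel ?m 0 (hprod y w) - \<phi> w * pow_kernel ?m 0 (hprod z w) - \<phi> w * (pow_kernel ?m 1 (hprod z w) * hprod (y - z) w)) \<partial>ball_measure)"
      unfolding eq by (rule integral_norm_bound)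
    also have "\<dots> \<le> (\<integral>w. (B * (norm (y - z))\<^sup>2) * cmod (\<phi> w) \<partial>ball_measure)"
    proof (rule integral_mono)
      fix w :: "complex ^ 'n" assume "w \<in> space ball_measure"
      then have w: "norm w < 1" by simp
      define e where "e = pow_kernel ?m 0 (hprod y w) - pow_kernel ?m 0 (hprod z w) - pow_kernel ?m 1 (hprod z w) * (hprod y w - hprod z w)"
      have "cmod e \<le> B * (cmod (hprod y w - hprod z w))\<^sup>2"
        unfolding e_def B_def
        using norm_hprod_ball[OF w, of y] norm_hprod_ball[OF w, of z] y q
        by (intro pow_kernel_taylor) auto
      also have "\<dots> \<le> B * (norm (y - z))\<^sup>2"
        using norm_hprod_ball[OF w, of "y - z"] B
        by (intro mult_left_mono power_mono) (auto simp: hprod_diff_left)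
      finally have "cmod (\<phi> w) * cmod e \<le> cmod (\<phi> w) * (B * (norm (y - z))\<^sup>2)" by (rule mult_left_mono) simp
      moreover have "\<phi> w * pow_kernel ?m 0 (hprod y w) - \<phi> w * pow_kernel ?m 0 (hprod z w) - \<phi> w * (pow_kernel ?m 1 (hprod z w) * hprod (y - z) w) = \<phi> w * e"
        by (simp add: e_def hprod_diff_left algebra_simps)
      ultimately show "cmod (\<phi> w * pow_kernel ?m 0 (hprod y w) - \<phi> w * pow_kernel ?m 0 (hprod z w) - \<phi> w * (pow_kernel ?m 1 (hprod z w) * hprod (y - z) w))
         \<le> (B * (norm (y - z))\<^sup>2) * cmod (\<phi> w)"
        by (simp add: norm_mult mult.commute)
    qed ((intro integrable_norm Bochner_Integration.integrable_diff int0 y1 z int1)[1], use intn in simp)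
    also have "\<dots> = B * L * (norm (y - z))\<^sup>2" by (simp add: L_def)
    finally show ?thesis .
  qed
  show ?thesis
    unfolding has_derivative_at_within
  proof (intro conjI bl)
    have ev: "\<forall>\<^sub>F y in at z. norm y < q"
    proof -
      have "\<forall>\<^sub>F y in nhds z. y \<in> {y. norm y < q}"
        using q by (intro eventually_nhds_in_open open_Collect_less continuous_intros) auto
      then show ?thesis by (auto simp: eventually_at_filter elim: eventually_mono)
    qed
    have "((\<lambda>y. B * L * norm (y - z)) \<longlongrightarrow> B * L * norm (z - z)) (at z)"
      by (intro tendsto_intros)
    then have lim: "((\<lambda>y. B * L * norm (y - z)) \<longlongrightarrow> 0) (at z)" by simp
    show "((\<lambda>y. (bergman \<phi> y - bergman \<phi> z - bergman_deriv z (y - z)) /\<^sub>R norm (y - z)) \<longlongrightarrow> 0) (at z)"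
    proof (rule Lim_null_comparison[OF _ lim])
      show "\<forall>\<^sub>F y in at z. norm ((bergman \<phi> y - bergman \<phi> z - bergman_deriv z (y - z)) /\<^sub>R norm (y - z)) \<le> B * L * norm (y - z)"
        using ev
      proof eventually_elim
        case (elim y)
        show ?case
        proof (cases "y = z")
          case False
          then have d: "0 < norm (y - z)" by simp
          have "norm ((bergman \<phi> y - bergman \<phi> z - bergman_deriv z (y - z)) /\<^sub>R norm (y - z))
             = norm (bergman \<phi> y - bergman \<phi> z - bergman_deriv z (y - z)) / norm (y - z)"
            by (simp add: divide_inverse mult.commute)
          also have "\<dots> \<le> B * L * (norm (y - z))\<^sup>2 / norm (y - z)"
            by (intro divide_right_mono est[OF elim]) auto
          also have "\<dots> = B * L * norm (y - z)" using d by (simp add: power2_eq_square)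
          finally show ?thesis .
        qed simp
      qed
    qed
  qed
qed

lemma holomorphic_bergman: "holomorphic_vec_on (bergman \<phi>) (ball 0 1)"
  unfolding holomorphic_vec_on_def
  using bergman_has_derivative bergman_deriv_smult by (auto intro!: exI[of _ "bergman_deriv _"])

text \<open>With \<open>u = \<langle>z, w\<rangle>\<close>, \<open>(1 - u) + (n + 1) u / n = 1 + u / n\<close>: the normalization \<open>R / n\<close> leaves a
  numerator that is bounded and, near \<open>u = 1\<close>, bounded below.\<close>

lemma bergman_radial_formula:
  assumes z: "norm z < 1"
  shows "bergman \<phi> z + radial_deriv (bergman \<phi>) z / of_nat CARD('n)
    = (\<integral>w. \<phi> w * ((1 + hprod z w / of_nat CARD('n)) / (1 - hprod z w) ^ (CARD('n) + 2)) \<partial>ball_measure)"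
proof -
  let ?n = "CARD('n)"
  have "radial_deriv (bergman \<phi>) z = bergman_deriv z z"
    by (rule radial_deriv_eq[OF bergman_has_derivative[OF z] bergman_deriv_smult])
  then have "bergman \<phi> z + radial_deriv (bergman \<phi>) z / of_nat ?n
     = (\<integral>w. \<phi> w * pow_kernel (?n + 1) 0 (hprod z w) \<partial>ball_measure)
       + (\<integral>w. \<phi> w * (pow_kernel (?n + 1) 1 (hprod z w) * hprod z w) \<partial>ball_measure) / of_nat ?n"
    by (simp add: bergman_deriv_def bergman_def bergman_integrand_def pow_kernel_def)
  also have "\<dots> = (\<integral>w. \<phi> w * pow_kernel (?n + 1) 0 (hprod z w) + \<phi> w * (pow_kernel (?n + 1) 1 (hprod z w) * hprod z w) / of_nat ?n \<partial>ball_measure)"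
    using integrable_kernel[OF z, of "?n + 1" 0 0 0] integrable_kernel[OF z, of "?n + 1" 1 z 1]
    by (subst Bochner_Integration.integral_add) auto
  also have "\<dots> = (\<integral>w. \<phi> w * ((1 + hprod z w / of_nat ?n) / (1 - hprod z w) ^ (?n + 2)) \<partial>ball_measure)"
  proof (rule Bochner_Integration.integral_cong[OF refl])
    fix w :: "complex ^ 'n" assume "w \<in> space ball_measure"
    then have "norm w < 1" by simp
    then have "cmod (hprod z w) < 1" using norm_hprod_ball[of w z] z by simp
    then have nz: "1 - hprod z w \<noteq> 0" by auto
    have "pow_kernel (?n + 1) 0 (hprod z w) + pow_kernel (?n + 1) 1 (hprod z w) * hprod z w / of_nat ?n
       = (1 + hprod z w / of_nat ?n) / (1 - hprod z w) ^ (?n + 2)"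
    proof -
      define u where "u = hprod z w"
      have "1 / (1 - u) ^ (?n + 1) = (1 - u) / (1 - u) ^ (?n + 2)" using nz by (simp add: u_def)
      moreover have "(1 - u) / (1 - u) ^ (?n + 2) + (of_nat (?n + 1) / (1 - u) ^ (?n + 2)) * u / of_nat ?n
         = ((1 - u) + of_nat (?n + 1) * u / of_nat ?n) / (1 - u) ^ (?n + 2)"
      proof -
        have "a / X + (b / X) * u / c = (a + b * u / c) / X" for a b c X :: complex
          by (simp add: add_divide_distrib)
        then show ?thesis .
      qed
      moreover have "(1 - u) + of_nat (?n + 1) * u / of_nat ?n = 1 + u / of_nat ?n"
        by (simp add: field_simps)
      ultimately show ?thesis by (simp add: pow_kernel_def u_def)
    qed
    then show "\<phi> w * pow_kernel (?n + 1) 0 (hprod z w) + \<phi> w * (pow_kernel (?n + 1) 1 (hprod z w) * hprod z w) / of_nat ?n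
      = \<phi> w * ((1 + hprod z w / of_nat ?n) / (1 - hprod z w) ^ (?n + 2))"
      by (metis (no_types, lifting) distrib_left times_divide_eq_right)
  qed
  finally show ?thesis .
qed

end

section \<open>The upper bound\<close>

text \<open>The inner integral of \<^const>\<open>Lp2_norm\<close>. It is kept as an integral over an interval, because
  \<open>\<phi>\<close> need not be measurable along every ray; comparison with \<^const>\<open>radial_measure\<close> goes through
  measurable majorants and minorants.\<close>

definition radial_sq :: "(complex ^ 'n \<Rightarrow> complex) \<Rightarrow> complex ^ 'n \<Rightarrow> ennreal" where
  "radial_sq \<phi> \<zeta> = (\<integral>\<^sup>+ r\<in>{0..<1}. ennreal ((cmod (\<phi> (r *\<^sub>R \<zeta>)))\<^sup>2
            * (2 * real CARD('n) * r ^ (2 * CARD('n) - 1) / (1 - r\<^sup>2))) \<partial>lborel)"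

lemma Lp2_norm_radial_sq:
  "Lp2_norm p \<phi> = epowr (\<integral>\<^sup>+ \<zeta>. epowr (radial_sq \<phi> \<zeta>) (p / 2) \<partial>sphere_measure) (1 / p)"
  by (simp add: Lp2_norm_def radial_sq_def)

lemma square_weight_ennreal:
  assumes "0 \<le> r" "r < 1"
  shows "ennreal (x\<^sup>2 * (2 * real n * r ^ (2 * n - 1) / (1 - r\<^sup>2)))
    = ennreal (2 * real n * r ^ (2 * n - 1) / (1 - r\<^sup>2)) * (ennreal \<bar>x\<bar>)\<^sup>2"
proof -
  have "r\<^sup>2 < 1" using assms by (simp add: abs_square_less_1)
  then show ?thesis using assms
    by (subst mult.commute, subst ennreal_mult) (auto simp: ennreal_power)
qed

lemma radial_sq_le:
  fixes \<phi> :: "complex ^ 'n \<Rightarrow> complex"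
  assumes [measurable]: "G \<in> borel_measurable borel"
    and le: "\<And>r. 0 \<le> r \<Longrightarrow> r < 1 \<Longrightarrow> ennreal (cmod (\<phi> (r *\<^sub>R \<zeta>))) \<le> G r"
  shows "radial_sq \<phi> \<zeta> \<le> (\<integral>\<^sup>+ r. (G r)\<^sup>2 \<partial>radial_measure (CARD('n)))"
proof -
  have "radial_sq \<phi> \<zeta> \<le> (\<integral>\<^sup>+ r. ennreal (2 * real CARD('n) * r ^ (2 * CARD('n) - 1) / (1 - r\<^sup>2)) * (G r)\<^sup>2 * indicator {0..<1} r \<partial>lborel)"
    unfolding radial_sq_def
  proof (rule nn_integral_mono)
    fix r :: real
    show "ennreal ((cmod (\<phi> (r *\<^sub>R \<zeta>)))\<^sup>2 * (2 * real CARD('n) * r ^ (2 * CARD('n) - 1) / (1 - r\<^sup>2))) * indicator {0..<1} r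
      \<le> ennreal (2 * real CARD('n) * r ^ (2 * CARD('n) - 1) / (1 - r\<^sup>2)) * (G r)\<^sup>2 * indicator {0..<1} r"
    proof (cases "0 \<le> r \<and> r < 1")
      case True
      then show ?thesis
        unfolding square_weight_ennreal[OF conjunct1[OF True] conjunct2[OF True]] abs_norm_cancel
        by (intro mult_right_mono mult_left_mono power_mono le) auto
    qed (auto simp: indicator_def)
  qed
  also have "\<dots> = (\<integral>\<^sup>+ r. (G r)\<^sup>2 \<partial>radial_measure (CARD('n)))"
    by (rule radial_measure_integral[symmetric]) measurable
  finally show ?thesis .
qed

lemma radial_sq_ge:
  fixes \<phi> :: "complex ^ 'n \<Rightarrow> complex"
  assumes [measurable]: "G \<in> borel_measurable borel"
    and le: "\<And>r. 0 \<le> r \<Longrightarrow> r < 1 \<Longrightarrow> G r \<le> ennreal (cmod (\<phi> (r *\<^sub>R \<zeta>)))"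
  shows "(\<integral>\<^sup>+ r. (G r)\<^sup>2 \<partial>radial_measure (CARD('n))) \<le> radial_sq \<phi> \<zeta>"
proof -
  have "(\<integral>\<^sup>+ r. (G r)\<^sup>2 \<partial>radial_measure (CARD('n)))
     = (\<integral>\<^sup>+ r. ennreal (2 * real CARD('n) * r ^ (2 * CARD('n) - 1) / (1 - r\<^sup>2)) * (G r)\<^sup>2 * indicator {0..<1} r \<partial>lborel)"
    by (rule radial_measure_integral) measurable
  also have "\<dots> \<le> radial_sq \<phi> \<zeta>"
    unfolding radial_sq_def
  proof (rule nn_integral_mono)
    fix r :: real
    show "ennreal (2 * real CARD('n) * r ^ (2 * CARD('n) - 1) / (1 - r\<^sup>2)) * (G r)\<^sup>2 * indicator {0..<1} r
      \<le> ennreal ((cmod (\<phi> (r *\<^sub>R \<zeta>)))\<^sup>2 * (2 * real CARD('n) * r ^ (2 * CARD('n) - 1) / (1 - r\<^sup>2))) * indicator {0..<1} r"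
    proof (cases "0 \<le> r \<and> r < 1")
      case True
      then show ?thesis
        unfolding square_weight_ennreal[OF conjunct1[OF True] conjunct2[OF True]] abs_norm_cancel
        by (intro mult_right_mono mult_left_mono power_mono le) auto
    qed (auto simp: indicator_def)
  qed
  finally show ?thesis .
qed

lemma radial_sq_eq:
  fixes \<phi> :: "complex ^ 'n \<Rightarrow> complex"
  assumes [measurable]: "\<phi> \<in> borel_measurable borel"
  shows "radial_sq \<phi> \<zeta> = (\<integral>\<^sup>+ r. (ennreal (cmod (\<phi> (r *\<^sub>R \<zeta>))))\<^sup>2 \<partial>radial_measure (CARD('n)))"
  by (intro antisym radial_sq_le radial_sq_ge) auto

text \<open>Elements of the space are only Lebesgue measurable, and such functions need not be measurable along
  rays. They agree almost everywhere with Borel functions, on which polar coordinates can be used.\<close>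

lemma borel_version:
  fixes \<phi> :: "complex ^ 'n \<Rightarrow> complex"
  assumes "\<phi> \<in> borel_measurable ball_measure"
  obtains \<phi>0 where "\<phi>0 \<in> borel_measurable borel" "AE z in lborel. norm z < 1 \<longrightarrow> \<phi> z = \<phi>0 z"
proof -
  have "\<phi> \<in> borel_measurable (lebesgue_on (ball 0 1))"
    using assms by (simp add: ball_measure_def measurable_def)
  then have m: "(\<lambda>z. if z \<in> ball 0 1 then \<phi> z else 0) \<in> borel_measurable lebesgue"
    by (intro borel_measurable_if_I) auto
  have "(\<lambda>z. Re (if z \<in> ball 0 1 then \<phi> z else 0)) \<in> borel_measurable (completion lborel)"
    "(\<lambda>z. Im (if z \<in> ball 0 1 then \<phi> z else 0)) \<in> borel_measurable (completion lborel)"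
    using measurable_compose[OF m borel_measurable_Re] measurable_compose[OF m borel_measurable_Im] by simp_all
  from this[THEN completion_ex_borel_measurable_real]
  obtain a b where [measurable]: "a \<in> borel_measurable lborel" "b \<in> borel_measurable lborel"
    and ab: "AE z in lborel. Re (if z \<in> ball 0 1 then \<phi> z else 0) = a z"
      "AE z in lborel. Im (if z \<in> ball 0 1 then \<phi> z else 0) = b z"
    by (elim bexE) (rule that)
  show ?thesis
  proof
    show "(\<lambda>z. Complex (a z) (b z)) \<in> borel_measurable borel"
      unfolding Complex_eq by measurable
    show "AE z in lborel. norm z < 1 \<longrightarrow> \<phi> z = Complex (a z) (b z)"
      using ab by eventually_elim (auto simp: complex_eq_iff)
  qed
qed

text \<open>A null set meets almost every ray in a null set, so norms may be computed after a change on a null set.\<close>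

lemma polar_AE:
  fixes Q :: "complex ^ 'n \<Rightarrow> bool"
  assumes "AE z in lborel. norm z < 1 \<longrightarrow> Q z"
  shows "AE \<zeta> in sphere_measure. AE r in radial_measure (CARD('n)). Q (r *\<^sub>R \<zeta>)"
proof -
  interpret R: sigma_finite_measure "radial_measure (CARD('n))" by (rule sigma_finite_radial_measure)
  obtain N where N: "{z \<in> space lborel. \<not> (norm z < 1 \<longrightarrow> Q z)} \<subseteq> N" "emeasure lborel N = 0" "N \<in> sets lborel"
    using assms by (rule AE_E)
  then have [measurable]: "N \<in> sets borel" by simp
  have "emeasure lborel (ball 0 1 \<inter> N) \<le> emeasure lborel N" by (intro emeasure_mono) auto
  then have "emeasure borel_ball_measure N = 0" using N by (simp add: emeasure_borel_ball_measure)
  then have "(\<integral>\<^sup>+ z. indicator N z \<partial>borel_ball_measure) = 0" by simp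
  then have "(\<integral>\<^sup>+ \<zeta>. \<integral>\<^sup>+ r. ennreal (1 - r\<^sup>2) * indicator N (r *\<^sub>R \<zeta>) \<partial>radial_measure (CARD('n)) \<partial>sphere_measure) = 0"
    by (subst (asm) polar_integral) auto
  then have "AE \<zeta> in sphere_measure. (\<integral>\<^sup>+ r. ennreal (1 - r\<^sup>2) * indicator N (r *\<^sub>R \<zeta>) \<partial>radial_measure (CARD('n))) = 0"
    by (subst (asm) nn_integral_0_iff_AE) auto
  then show ?thesis
    using AE_sphere
  proof eventually_elim
    case (elim \<zeta>)
    have "AE r in radial_measure (CARD('n)). ennreal (1 - r\<^sup>2) * indicator N (r *\<^sub>R \<zeta>) = 0"
      using elim(1) by (subst (asm) nn_integral_0_iff_AE) auto
    then show ?case using AE_radial_measure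
    proof eventually_elim
      case (elim r)
      then have "r\<^sup>2 < 1" by (simp add: abs_square_less_1)
      then have "r *\<^sub>R \<zeta> \<notin> N" using elim by (auto split: split_indicator_asm simp: ennreal_eq_0_iff)
      moreover have "norm (r *\<^sub>R \<zeta>) < 1" using elim \<open>norm \<zeta> = 1\<close> by simp
      ultimately show ?case using subsetD[OF N(1), of "r *\<^sub>R \<zeta>"] by auto
    qed
  qed
qed

lemma Lp2_norm_cong:
  fixes \<phi> \<psi> :: "complex ^ 'n \<Rightarrow> complex"
  assumes "AE z in lborel. norm z < 1 \<longrightarrow> \<phi> z = \<psi> z"
  shows "Lp2_norm p \<phi> = Lp2_norm p \<psi>"
proof -
  have "(\<integral>\<^sup>+ \<zeta>. epowr (radial_sq \<phi> \<zeta>) (p / 2) \<partial>sphere_measure) = (\<integral>\<^sup>+ \<zeta>. epowr (radial_sq \<psi> \<zeta>) (p / 2) \<partial>sphere_measure)"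
  proof (rule nn_integral_cong_AE, rule eventually_mono[OF polar_AE[OF assms]])
    fix \<zeta> :: "complex ^ 'n" assume "AE r in radial_measure (CARD('n)). \<phi> (r *\<^sub>R \<zeta>) = \<psi> (r *\<^sub>R \<zeta>)"
    then have "AE r in lborel. 0 < ennreal (2 * real CARD('n) * r ^ (2 * CARD('n) - 1) / (1 - r\<^sup>2)) * indicator {0..<1} r \<longrightarrow> \<phi> (r *\<^sub>R \<zeta>) = \<psi> (r *\<^sub>R \<zeta>)"
      unfolding radial_measure_def by (subst (asm) AE_density) auto
    then have "AE r in lborel. ennreal ((cmod (\<phi> (r *\<^sub>R \<zeta>)))\<^sup>2 * (2 * real CARD('n) * r ^ (2 * CARD('n) - 1) / (1 - r\<^sup>2))) * indicator {0..<1} r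
       = ennreal ((cmod (\<psi> (r *\<^sub>R \<zeta>)))\<^sup>2 * (2 * real CARD('n) * r ^ (2 * CARD('n) - 1) / (1 - r\<^sup>2))) * indicator {0..<1} r"
      using AE_lborel_singleton[of 0]
    proof eventually_elim
      case (elim r)
      show ?case
      proof (cases "0 < r \<and> r < 1")
        case True
        then have "r\<^sup>2 < 1" by (simp add: abs_square_less_1)
        then have "0 < ennreal (2 * real CARD('n) * r ^ (2 * CARD('n) - 1) / (1 - r\<^sup>2)) * indicator {0..<1} r"
          using True by simp
        then have "\<phi> (r *\<^sub>R \<zeta>) = \<psi> (r *\<^sub>R \<zeta>)" using elim(1) by blast
        then show ?thesis by simp
      qed (use elim in \<open>auto simp: indicator_def\<close>)
    qed
    then have "radial_sq \<phi> \<zeta> = radial_sq \<psi> \<zeta>"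
      unfolding radial_sq_def by (rule nn_integral_cong_AE)
    then show "epowr (radial_sq \<phi> \<zeta>) (p / 2) = epowr (radial_sq \<psi> \<zeta>) (p / 2)" by simp
  qed
  then show ?thesis by (simp add: Lp2_norm_radial_sq)
qed

text \<open>The Cauchy--Schwarz inequality on each ray, then the comparison of the norms of \<open>L\<^sup>1\<close> and \<open>L\<^sup>p\<close> over
  the sphere. A function \<open>g\<close> with uniformly bounded square integrals along rays is thus bounded in every
  dual norm by one constant, independent of \<open>p\<close>.\<close>

lemma nn_integral_product_le:
  fixes F g :: "complex ^ 'n \<Rightarrow> ennreal"
  assumes [measurable]: "F \<in> borel_measurable borel" "g \<in> borel_measurable borel" and p: "1 \<le> p"
    and g: "\<And>\<zeta>. norm \<zeta> = 1 \<Longrightarrow> (\<integral>\<^sup>+ r. (g (r *\<^sub>R \<zeta>))\<^sup>2 \<partial>radial_measure (CARD('n))) \<le> c"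
  shows "(\<integral>\<^sup>+ \<zeta>. \<integral>\<^sup>+ r. F (r *\<^sub>R \<zeta>) * g (r *\<^sub>R \<zeta>) \<partial>radial_measure (CARD('n)) \<partial>sphere_measure)
    \<le> epowr c (1 / 2) * epowr (\<integral>\<^sup>+ \<zeta>. epowr (\<integral>\<^sup>+ r. (F (r *\<^sub>R \<zeta>))\<^sup>2 \<partial>radial_measure (CARD('n))) (p / 2) \<partial>sphere_measure) (1 / p)"
proof -
  interpret R: sigma_finite_measure "radial_measure (CARD('n))" by (rule sigma_finite_radial_measure)
  let ?N = "\<lambda>\<zeta>. \<integral>\<^sup>+ r. (F (r *\<^sub>R \<zeta>))\<^sup>2 \<partial>radial_measure (CARD('n))"
  have "(\<integral>\<^sup>+ \<zeta>. \<integral>\<^sup>+ r. F (r *\<^sub>R \<zeta>) * g (r *\<^sub>R \<zeta>) \<partial>radial_measure (CARD('n)) \<partial>sphere_measure)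
    \<le> (\<integral>\<^sup>+ \<zeta>. epowr c (1 / 2) * epowr (?N \<zeta>) (1 / 2) \<partial>sphere_measure)"
  proof (rule nn_integral_mono_AE, rule eventually_mono[OF AE_sphere])
    fix \<zeta> :: "complex ^ 'n" assume \<zeta>: "norm \<zeta> = 1"
    have "epowr (\<integral>\<^sup>+ r. F (r *\<^sub>R \<zeta>) * g (r *\<^sub>R \<zeta>) \<partial>radial_measure (CARD('n))) 2
      \<le> ?N \<zeta> * (\<integral>\<^sup>+ r. (g (r *\<^sub>R \<zeta>))\<^sup>2 \<partial>radial_measure (CARD('n)))"
      unfolding epowr_power2 by (rule Cauchy_Schwarz_nn_integral) measurable
    also have "\<dots> \<le> ?N \<zeta> * c" by (intro mult_left_mono g \<zeta>) auto
    finally show "(\<integral>\<^sup>+ r. F (r *\<^sub>R \<zeta>) * g (r *\<^sub>R \<zeta>) \<partial>radial_measure (CARD('n))) \<le> epowr c (1 / 2) * epowr (?N \<zeta>) (1 / 2)"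
      by (subst (asm) epowr_le_iff) (auto simp: epowr_mult mult.commute)
  qed
  also have "\<dots> = epowr c (1 / 2) * (\<integral>\<^sup>+ \<zeta>. epowr (?N \<zeta>) (1 / 2) \<partial>sphere_measure)"
    by (rule nn_integral_cmult) measurable
  also have "\<dots> \<le> epowr c (1 / 2) * epowr (\<integral>\<^sup>+ \<zeta>. epowr (epowr (?N \<zeta>) (1 / 2)) p \<partial>sphere_measure) (1 / p)"
    by (intro mult_left_mono nn_integral_le_epowr prob_space_sphere_measure p) auto
  finally show ?thesis by (simp add: epowr_epowr)
qed

text \<open>Pair with \<open>1 - \<bar>z\<bar>\<^sup>2\<close>, the density relating the two radial measures; its square has finite integral
  along each ray.\<close>

lemma integrable_of_Lp2:
  fixes \<phi> :: "complex ^ 'n \<Rightarrow> complex"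
  assumes p: "1 \<le> p" and [measurable]: "\<phi> \<in> borel_measurable borel" and fin: "Lp2_norm p \<phi> < \<infinity>"
  shows "integrable ball_measure \<phi>"
proof (rule integrableI_bounded)
  show "\<phi> \<in> borel_measurable ball_measure" by (rule borel_measurable_ball_measure) simp
  let ?n = "CARD('n)"
  have g: "(\<integral>\<^sup>+ r. (ennreal (1 - (norm (r *\<^sub>R \<zeta>))\<^sup>2))\<^sup>2 \<partial>radial_measure ?n) \<le> ennreal (2 * real ?n)"
    if \<zeta>: "norm \<zeta> = 1" for \<zeta> :: "complex ^ 'n"
  proof -
    have "(\<integral>\<^sup>+ r. (ennreal (1 - (norm (r *\<^sub>R \<zeta>))\<^sup>2))\<^sup>2 \<partial>radial_measure ?n) \<le> (\<integral>\<^sup>+ r. ennreal ((1 - r\<^sup>2) / (1 - 0 * r)\<^sup>2) \<partial>radial_measure ?n)"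
    proof (rule nn_integral_mono_AE, rule eventually_mono[OF AE_radial_measure])
      fix r :: real assume r: "0 \<le> r \<and> r < 1"
      then have r2: "0 \<le> r\<^sup>2" "r\<^sup>2 < 1" by (auto simp: abs_square_less_1)
      have "(1 - r\<^sup>2)\<^sup>2 \<le> 1 - r\<^sup>2" unfolding power2_eq_square[of "1 - r\<^sup>2"] using r2 by (intro mult_left_le) auto
      then show "(ennreal (1 - (norm (r *\<^sub>R \<zeta>))\<^sup>2))\<^sup>2 \<le> ennreal ((1 - r\<^sup>2) / (1 - 0 * r)\<^sup>2)"
        using r2 \<zeta> by (simp add: ennreal_power ennreal_leI)
    qed
    also have "\<dots> \<le> ennreal (2 * real ?n / (1 - 0))" by (rule radial_kernel_integral_le) auto
    finally show ?thesis by simp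
  qed
  have "(\<integral>\<^sup>+ z. ennreal (cmod (\<phi> z)) \<partial>ball_measure)
     = (\<integral>\<^sup>+ \<zeta>. \<integral>\<^sup>+ r. ennreal (1 - r\<^sup>2) * ennreal (cmod (\<phi> (r *\<^sub>R \<zeta>))) \<partial>radial_measure ?n \<partial>sphere_measure)"
    by (subst nn_integral_ball_measure, measurable, subst polar_integral, measurable)
  also have "\<dots> = (\<integral>\<^sup>+ \<zeta>. \<integral>\<^sup>+ r. ennreal (cmod (\<phi> (r *\<^sub>R \<zeta>))) * ennreal (1 - (norm (r *\<^sub>R \<zeta>))\<^sup>2) \<partial>radial_measure ?n \<partial>sphere_measure)"
    by (rule nn_integral_cong_AE, rule eventually_mono[OF AE_sphere], rule nn_integral_cong) (simp add: mult.commute)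
  also have "\<dots> \<le> epowr (ennreal (2 * real ?n)) (1 / 2)
     * epowr (\<integral>\<^sup>+ \<zeta>. epowr (\<integral>\<^sup>+ r. (ennreal (cmod (\<phi> (r *\<^sub>R \<zeta>))))\<^sup>2 \<partial>radial_measure ?n) (p / 2) \<partial>sphere_measure) (1 / p)"
    by (rule nn_integral_product_le[of "\<lambda>z. ennreal (cmod (\<phi> z))" "\<lambda>z. ennreal (1 - (norm z)\<^sup>2)", OF _ _ p g]) measurable
  also have "\<dots> = epowr (ennreal (2 * real ?n)) (1 / 2) * Lp2_norm p \<phi>"
    by (simp add: Lp2_norm_radial_sq radial_sq_eq)
  also have "\<dots> < \<infinity>" using fin by (simp add: ennreal_mult_less_top epowr_ennreal)
  finally show "(\<integral>\<^sup>+ z. ennreal (norm (\<phi> z)) \<partial>ball_measure) < \<infinity>" .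
qed

text \<open>Take absolute values in the kernel; the numerator \<open>1 + \<langle>z, w\<rangle> / n\<close> has modulus at most \<open>2\<close>.\<close>

lemma norm_radial_bergman_le:
  fixes \<phi> :: "complex ^ 'n \<Rightarrow> complex"
  assumes \<phi>: "integrable ball_measure \<phi>" and [measurable]: "\<phi> \<in> borel_measurable borel"
    and \<zeta>: "norm \<zeta> = 1" and r: "0 \<le> r" "r < 1"
  shows "ennreal (cmod ((1 - (norm (r *\<^sub>R \<zeta>))\<^sup>2) *\<^sub>R (bergman \<phi> (r *\<^sub>R \<zeta>) + radial_deriv (bergman \<phi>) (r *\<^sub>R \<zeta>) / of_nat CARD('n))))
    \<le> 2 * (\<integral>\<^sup>+ y. bergman_kernel (\<zeta>, r) y * ennreal (cmod (\<phi> (snd y *\<^sub>R fst y))) \<partial>(sphere_measure \<Otimes>\<^sub>M radial_measure (CARD('n))))"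
proof -
  let ?n = "CARD('n)"
  interpret integrable_on_ball \<phi> by unfold_locales (rule \<phi>)
  interpret R: sigma_finite_measure "radial_measure ?n" by (rule sigma_finite_radial_measure)
  define z where "z = r *\<^sub>R \<zeta>"
  have z: "norm z < 1" "norm z = r" using \<zeta> r by (auto simp: z_def)
  have r2: "r\<^sup>2 < 1" using r by (simp add: abs_square_less_1)
  let ?k = "\<lambda>w. (1 + hprod z w / of_nat ?n) / (1 - hprod z w) ^ (?n + 2)"
  have kle: "cmod (?k w) \<le> 2 / cmod (1 - hprod z w) ^ (?n + 2)" if w: "norm w < 1" for w
  proof -
    have "cmod (hprod z w) \<le> 1" using norm_hprod_ball[OF w, of z] z by simp
    moreover have "1 \<le> real ?n" using zero_less_card_finite[where 'a='n] by linarith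
    ultimately have "cmod (hprod z w) \<le> real ?n" by (rule order_trans)
    then have "cmod (hprod z w / of_nat ?n) \<le> 1" by (simp add: norm_divide)
    then have "cmod (1 + hprod z w / of_nat ?n) \<le> 2" using norm_triangle_ineq[of 1 "hprod z w / of_nat ?n"] by simp
    then show ?thesis unfolding norm_divide norm_power by (rule divide_right_mono) simp
  qed
  have "ennreal (cmod (bergman \<phi> z + radial_deriv (bergman \<phi>) z / of_nat ?n))
     \<le> (\<integral>\<^sup>+ w. ennreal (cmod (\<phi> w * ?k w)) \<partial>ball_measure)"
  proof -
    have "integrable ball_measure (\<lambda>w. \<phi> w * ?k w)"
    proof (rule integrable_times_bounded)
      show "?k \<in> borel_measurable borel" by measurable
      fix w :: "complex ^ 'n" assume w: "norm w < 1"
      have "1 - r \<le> cmod (1 - hprod z w)"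
        using norm_triangle_ineq2[of 1 "hprod z w"] norm_hprod_ball[OF w, of z] z by simp
      then have "2 / cmod (1 - hprod z w) ^ (?n + 2) \<le> 2 / (1 - r) ^ (?n + 2)"
        using r by (intro divide_left_mono power_mono mult_pos_pos zero_less_power) auto
      then show "cmod (?k w) \<le> 2 / (1 - r) ^ (?n + 2)" using kle[OF w] by linarith
    qed
    then show ?thesis
      unfolding bergman_radial_formula[OF z(1)] by (rule integral_norm_bound_ennreal)
  qed
  also have "\<dots> \<le> (\<integral>\<^sup>+ w. ennreal (2 / cmod (1 - hprod z w) ^ (?n + 2)) * ennreal (cmod (\<phi> w)) \<partial>ball_measure)"
  proof (rule nn_integral_mono)
    fix w :: "complex ^ 'n" assume "w \<in> space ball_measure"
    then have "norm w < 1" by simp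
    then have "cmod (\<phi> w * ?k w) \<le> 2 / cmod (1 - hprod z w) ^ (?n + 2) * cmod (\<phi> w)"
      unfolding norm_mult by (subst mult.commute) (intro mult_right_mono kle, auto)
    then show "ennreal (cmod (\<phi> w * ?k w)) \<le> ennreal (2 / cmod (1 - hprod z w) ^ (?n + 2)) * ennreal (cmod (\<phi> w))"
      by (simp add: ennreal_leI flip: ennreal_mult)
  qed
  also have "\<dots> = (\<integral>\<^sup>+ \<eta>. \<integral>\<^sup>+ s. ennreal (1 - s\<^sup>2) * (ennreal (2 / cmod (1 - hprod z (s *\<^sub>R \<eta>)) ^ (?n + 2)) * ennreal (cmod (\<phi> (s *\<^sub>R \<eta>)))) \<partial>radial_measure ?n \<partial>sphere_measure)"
    by (subst nn_integral_ball_measure, measurable, subst polar_integral, measurable)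
  finally have "ennreal (1 - r\<^sup>2) * ennreal (cmod (bergman \<phi> z + radial_deriv (bergman \<phi>) z / of_nat ?n))
     \<le> ennreal (1 - r\<^sup>2) * \<dots>" by (rule mult_left_mono) simp
  also have "\<dots> = (\<integral>\<^sup>+ \<eta>. \<integral>\<^sup>+ s. ennreal (1 - r\<^sup>2) * (ennreal (1 - s\<^sup>2) * (ennreal (2 / cmod (1 - hprod z (s *\<^sub>R \<eta>)) ^ (?n + 2)) * ennreal (cmod (\<phi> (s *\<^sub>R \<eta>))))) \<partial>radial_measure ?n \<partial>sphere_measure)"
    by (subst nn_integral_cmult[symmetric], measurable, intro nn_integral_cong nn_integral_cmult[symmetric]) measurable
  also have "\<dots> = (\<integral>\<^sup>+ \<eta>. \<integral>\<^sup>+ s. 2 * (bergman_kernel (\<zeta>, r) (\<eta>, s) * ennreal (cmod (\<phi> (s *\<^sub>R \<eta>)))) \<partial>radial_measure ?n \<partial>sphere_measure)"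
  proof (rule nn_integral_cong, rule nn_integral_cong_AE, rule eventually_mono[OF AE_radial_measure])
    fix \<eta> :: "complex ^ 'n" and s :: real assume "0 \<le> s \<and> s < 1"
    then have s2: "s\<^sup>2 < 1" by (simp add: abs_square_less_1)
    have "hprod z (s *\<^sub>R \<eta>) = of_real (r * s) * hprod \<zeta> \<eta>"
      by (simp only: z_def hprod_scaleR_left hprod_scaleR_right of_real_mult mult_ac)
    then have "bergman_kernel (\<zeta>, r) (\<eta>, s) = ennreal ((1 - r\<^sup>2) * (1 - s\<^sup>2) * (1 / cmod (1 - hprod z (s *\<^sub>R \<eta>)) ^ (?n + 2)))"
      by (simp add: bergman_kernel_def)
    also have "\<dots> = ennreal (1 - r\<^sup>2) * (ennreal (1 - s\<^sup>2) * ennreal (1 / cmod (1 - hprod z (s *\<^sub>R \<eta>)) ^ (?n + 2)))"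
    proof -
      have gen: "ennreal (a * b * c) = ennreal a * (ennreal b * ennreal c)" if "0 \<le> a" "0 \<le> b" "0 \<le> c" for a b c
        using that by (simp add: ennreal_mult mult.assoc)
      show ?thesis by (rule gen) (use r2 s2 in auto)
    qed
    finally have k: "bergman_kernel (\<zeta>, r) (\<eta>, s) = ennreal (1 - r\<^sup>2) * (ennreal (1 - s\<^sup>2) * ennreal (1 / cmod (1 - hprod z (s *\<^sub>R \<eta>)) ^ (?n + 2)))" .
    have "ennreal (2 / cmod (1 - hprod z (s *\<^sub>R \<eta>)) ^ (?n + 2)) = 2 * ennreal (1 / cmod (1 - hprod z (s *\<^sub>R \<eta>)) ^ (?n + 2))"
      using ennreal_mult'[of 2 "1 / cmod (1 - hprod z (s *\<^sub>R \<eta>)) ^ (?n + 2)"] by simp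
    then show "ennreal (1 - r\<^sup>2) * (ennreal (1 - s\<^sup>2) * (ennreal (2 / cmod (1 - hprod z (s *\<^sub>R \<eta>)) ^ (?n + 2)) * ennreal (cmod (\<phi> (s *\<^sub>R \<eta>)))))
       = 2 * (bergman_kernel (\<zeta>, r) (\<eta>, s) * ennreal (cmod (\<phi> (s *\<^sub>R \<eta>))))"
      unfolding k by (simp only: mult_ac)
  qed
  also have "\<dots> = 2 * (\<integral>\<^sup>+ y. bergman_kernel (\<zeta>, r) y * ennreal (cmod (\<phi> (snd y *\<^sub>R fst y))) \<partial>(sphere_measure \<Otimes>\<^sub>M radial_measure ?n))"
  proof -
    have [measurable]: "bergman_kernel (\<zeta>, r) \<in> borel_measurable (sphere_measure \<Otimes>\<^sub>M radial_measure ?n)"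
      unfolding bergman_kernel_def by measurable
    have "(\<integral>\<^sup>+ y. 2 * (bergman_kernel (\<zeta>, r) y * ennreal (cmod (\<phi> (snd y *\<^sub>R fst y)))) \<partial>(sphere_measure \<Otimes>\<^sub>M radial_measure ?n))
       = 2 * (\<integral>\<^sup>+ y. bergman_kernel (\<zeta>, r) y * ennreal (cmod (\<phi> (snd y *\<^sub>R fst y))) \<partial>(sphere_measure \<Otimes>\<^sub>M radial_measure ?n))"
      by (rule nn_integral_cmult) measurable
    moreover have "(\<integral>\<^sup>+ y. 2 * (bergman_kernel (\<zeta>, r) y * ennreal (cmod (\<phi> (snd y *\<^sub>R fst y)))) \<partial>(sphere_measure \<Otimes>\<^sub>M radial_measure ?n))
       = (\<integral>\<^sup>+ \<eta>. \<integral>\<^sup>+ s. 2 * (bergman_kernel (\<zeta>, r) (\<eta>, s) * ennreal (cmod (\<phi> (s *\<^sub>R \<eta>)))) \<partial>radial_measure ?n \<partial>sphere_measure)"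
      by (subst R.nn_integral_fst[symmetric]) auto
    ultimately show ?thesis by simp
  qed
  finally show ?thesis
    using r2 by (simp add: z_def[symmetric] z(2) ennreal_mult)
qed

text \<open>For the Borel version of \<open>\<phi>\<close>, the kernel bound and the general theorem on kernels dominated by a
  maximal operator apply; the factor \<open>2\<close> is the one of \<open>norm_radial_bergman_le\<close>.\<close>

theorem Fp2_norm_bergman_le:
  fixes \<phi> :: "complex ^ 'n \<Rightarrow> complex"
  assumes p: "1 < p" and \<phi>: "\<phi> \<in> Lp2 p"
  shows "integrable ball_measure \<phi>"
    and "Fp2_norm p (bergman \<phi>) \<le> ennreal (2 * bound_const TYPE('n) * max (sqrt p) (sqrt (conj_exp p))) * Lp2_norm p \<phi>"
proof -
  let ?n = "CARD('n)"
  interpret MK: maximal_kernel "sphere_measure :: (complex ^ 'n) measure" "radial_measure ?n" bergman_kernel "bound_const TYPE('n)"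
    by (rule maximal_kernel_bergman)
  define K where "K = bound_const TYPE('n) * max (sqrt p) (sqrt (conj_exp p))"
  have K: "0 \<le> K" using MK.A_pos p unfolding K_def by (intro mult_nonneg_nonneg) (auto simp: le_max_iff_disj)
  (* replace \<phi> by a Borel function; norm and Bergman transform stay the same *)
  obtain \<phi>0 where [measurable]: "\<phi>0 \<in> borel_measurable borel" and eq: "AE z in lborel. norm z < 1 \<longrightarrow> \<phi> z = \<phi>0 z"
    using \<phi> borel_version unfolding Lp2_def by blast
  have m: "\<phi> \<in> borel_measurable ball_measure" using \<phi> by (simp add: Lp2_def)
  have m0: "\<phi>0 \<in> borel_measurable ball_measure" by (rule borel_measurable_ball_measure) simp
  have norm_eq: "Lp2_norm p \<phi> = Lp2_norm p \<phi>0" by (rule Lp2_norm_cong[OF eq])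
  have int0: "integrable ball_measure \<phi>0"
    by (rule integrable_of_Lp2[of p]) (use p \<phi> norm_eq in \<open>auto simp: Lp2_def\<close>)
  have AEb: "AE z in ball_measure. \<phi> z = \<phi>0 z"
  proof -
    have "AE z in lebesgue. norm z < 1 \<longrightarrow> \<phi> z = \<phi>0 z" using eq by (rule AE_completion)
    then have "AE z in lebesgue_on (ball 0 1). \<phi> z = \<phi>0 z"
      by (subst AE_restrict_space_iff) (auto elim: eventually_mono)
    moreover have "(\<lambda>x :: complex ^ 'n. indicator (ball 0 1) x / emeasure lborel (ball 0 1 :: (complex ^ 'n) set)) \<in> borel_measurable (lebesgue_on (ball 0 1))"
      unfolding divide_ennreal_def
      by (intro measurable_restrict_space1 measurable_completion borel_measurable_times_ennreal borel_measurable_indicator) auto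
    ultimately show ?thesis
      unfolding ball_measure_eq by (subst AE_density) (auto elim: eventually_mono)
  qed
  show "integrable ball_measure \<phi>"
    using int0 integrable_cong_AE[OF m m0 AEb] by simp
  have "bergman \<phi> z = bergman \<phi>0 z" for z
    unfolding bergman_def
  proof (rule integral_cong_AE)
    have k: "(\<lambda>w. 1 / (1 - hprod z w) ^ (?n + 1)) \<in> borel_measurable ball_measure"
      by (rule borel_measurable_ball_measure) measurable
    show "bergman_integrand \<phi> z \<in> borel_measurable ball_measure" "bergman_integrand \<phi>0 z \<in> borel_measurable ball_measure"
      using borel_measurable_times[OF m k] borel_measurable_times[OF m0 k] by (simp_all add: bergman_integrand_def[abs_def])
    show "AE w in ball_measure. bergman_integrand \<phi> z w = bergman_integrand \<phi>0 z w"
      using AEb by eventually_elim (simp add: bergman_integrand_def)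
  qed
  then have berg: "bergman \<phi> = bergman \<phi>0" by auto
  define F where "F y = ennreal (cmod (\<phi>0 (snd y *\<^sub>R fst y)))" for y :: "(complex ^ 'n) \<times> real"
  have [measurable]: "F \<in> borel_measurable (sphere_measure \<Otimes>\<^sub>M radial_measure ?n)" unfolding F_def by measurable
  define T where "T z = (1 - (norm z)\<^sup>2) *\<^sub>R (bergman \<phi>0 z + radial_deriv (bergman \<phi>0) z / of_nat ?n)" for z :: "complex ^ 'n"
  have sqF: "MK.section_sq F \<zeta> = radial_sq \<phi>0 \<zeta>" for \<zeta>
    by (simp add: MK.section_sq_def F_def radial_sq_eq)
  have le: "radial_sq T \<zeta> \<le> 4 * MK.section_sq (MK.kernel_op F) \<zeta>" if \<zeta>: "norm \<zeta> = 1" for \<zeta> :: "complex ^ 'n"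
  proof -
    have opm: "(\<lambda>r. MK.kernel_op F (\<zeta>, r)) \<in> borel_measurable (radial_measure ?n)"
      by (rule measurable_Pair2[OF MK.kernel_op_measurable]) auto
    then have [measurable]: "(\<lambda>r. MK.kernel_op F (\<zeta>, r)) \<in> borel_measurable borel" by simp
    have "radial_sq T \<zeta> \<le> (\<integral>\<^sup>+ r. (2 * MK.kernel_op F (\<zeta>, r))\<^sup>2 \<partial>radial_measure ?n)"
    proof (rule radial_sq_le)
      fix r :: real assume "0 \<le> r" "r < 1"
      then show "ennreal (cmod (T (r *\<^sub>R \<zeta>))) \<le> 2 * MK.kernel_op F (\<zeta>, r)"
        unfolding T_def MK.kernel_op_def F_def
        by (intro norm_radial_bergman_le int0 \<zeta>) auto
    qed measurable
    also have "\<dots> = 4 * MK.section_sq (MK.kernel_op F) \<zeta>"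
      unfolding MK.section_sq_def power_mult_distrib using opm by (subst nn_integral_cmult) auto
    finally show ?thesis .
  qed
  have "(\<integral>\<^sup>+ \<zeta>. epowr (radial_sq T \<zeta>) (p / 2) \<partial>sphere_measure) \<le> (\<integral>\<^sup>+ \<zeta>. epowr 4 (p / 2) * epowr (MK.section_sq (MK.kernel_op F) \<zeta>) (p / 2) \<partial>sphere_measure)"
    by (rule nn_integral_mono_AE, rule eventually_mono[OF AE_sphere])
       (use p in \<open>auto simp flip: epowr_mult intro!: epowr_mono le\<close>)
  also have "\<dots> = epowr 4 (p / 2) * (\<integral>\<^sup>+ \<zeta>. epowr (MK.section_sq (MK.kernel_op F) \<zeta>) (p / 2) \<partial>sphere_measure)"
    by (rule nn_integral_cmult) measurable
  also have "\<dots> \<le> epowr 4 (p / 2) * (epowr (ennreal K) p * (\<integral>\<^sup>+ \<zeta>. epowr (MK.section_sq F \<zeta>) (p / 2) \<partial>sphere_measure))"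
    unfolding K_def by (intro mult_left_mono MK.kernel_op_bound p) auto
  finally have "epowr (\<integral>\<^sup>+ \<zeta>. epowr (radial_sq T \<zeta>) (p / 2) \<partial>sphere_measure) (1 / p)
    \<le> epowr (epowr 4 (p / 2) * (epowr (ennreal K) p * (\<integral>\<^sup>+ \<zeta>. epowr (MK.section_sq F \<zeta>) (p / 2) \<partial>sphere_measure))) (1 / p)"
    using p by (intro epowr_mono) auto
  also have "\<dots> = epowr 4 (1 / 2) * (ennreal K * Lp2_norm p \<phi>0)"
    using p by (simp add: epowr_mult epowr_epowr Lp2_norm_radial_sq sqF)
  also have "epowr 4 (1 / 2) = 2"
  proof -
    have "epowr 4 (1 / 2) = ennreal (4 powr (1 / 2))" by (simp add: epowr_def)
    also have "(4::real) powr (1 / 2) = 2" by (simp add: powr_half_sqrt)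
    finally show ?thesis by simp
  qed
  finally have "Lp2_norm p T \<le> 2 * (ennreal K * Lp2_norm p \<phi>0)"
    by (simp add: Lp2_norm_radial_sq)
  also have "\<dots> = ennreal (2 * K) * Lp2_norm p \<phi>"
    using K by (simp add: norm_eq ennreal_mult mult.assoc)
  finally show "Fp2_norm p (bergman \<phi>) \<le> ennreal (2 * bound_const TYPE('n) * max (sqrt p) (sqrt (conj_exp p))) * Lp2_norm p \<phi>"
    by (simp add: Fp2_norm_def berg T_def[abs_def] K_def mult.assoc)
qed

section \<open>A region of bounded sections where the kernel is positive\<close>

lemma hprod_axis: "hprod z (axis j 1) = z $ j"
  by (simp add: hprod_def axis_def if_distrib[of "\<lambda>x. _ * x"] if_distrib[of cnj] cong: if_cong)

lemma norm_axis_1: "norm (axis j (1::complex)) = 1"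
  by (simp add: norm_eq_1 inner_axis_axis)

definition radial_bergman_kernel :: "complex ^ 'n \<Rightarrow> complex ^ 'n \<Rightarrow> complex" where
  "radial_bergman_kernel z w = (1 + hprod z w / of_nat CARD('n)) / (1 - hprod z w) ^ (CARD('n) + 2)"

lemma radial_bergman_kernel_cnj: "radial_bergman_kernel w z = cnj (radial_bergman_kernel z w)"
  by (simp add: radial_bergman_kernel_def hprod_cnj)

text \<open>At \<open>e = v = 0\<close> the real part is \<open>1 + 1 / n\<close> with \<open>n = m + 1\<close>, and it depends continuously on
  \<open>e\<close> and \<open>v\<close>.\<close>

lemma ex_perturbation_bound:
  "\<exists>\<epsilon>>0. \<epsilon> \<le> 1 / 2 \<and> (\<forall>e v :: complex. cmod e \<le> \<epsilon> \<longrightarrow> cmod v \<le> \<epsilon> \<longrightarrow>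
     1 / 2 \<le> Re ((1 + (1 - v) / of_nat (Suc m)) / (1 + e) ^ (Suc m + 2)))"
proof -
  define f where "f x = Re ((1 + (1 - snd x) / of_nat (Suc m)) / (1 + fst x) ^ (Suc m + 2))" for x :: "complex \<times> complex"
  have "isCont f (0, 0)" unfolding f_def isCont_def by (intro tendsto_intros) (auto simp del: of_nat_Suc)
  then obtain \<delta> where \<delta>: "0 < \<delta>" "\<And>x. dist x (0, 0) < \<delta> \<Longrightarrow> dist (f x) (f (0, 0)) < 1 / 2"
    unfolding continuous_at_eps_delta by (metis half_gt_zero zero_less_one)
  have "1 \<le> f (0, 0)" by (simp add: f_def Re_divide_of_nat del: of_nat_Suc)
  have "1 / 2 \<le> Re ((1 + (1 - v) / of_nat (Suc m)) / (1 + e) ^ (Suc m + 2))"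
    if "cmod e \<le> min (1 / 2) (\<delta> / 3)" "cmod v \<le> min (1 / 2) (\<delta> / 3)" for e v
  proof -
    have "dist (e, v) (0, 0) \<le> cmod e + cmod v"
      using norm_Pair_le[of e v] by (simp add: dist_norm)
    then have "dist (e, v) (0, 0) < \<delta>" using that \<delta>(1) by auto
    then have "\<bar>f (e, v) - f (0, 0)\<bar> < 1 / 2" using \<delta>(2) by (simp add: dist_real_def)
    then have "1 / 2 \<le> f (e, v)" using \<open>1 \<le> f (0, 0)\<close> by linarith
    then show ?thesis by (simp add: f_def)
  qed
  then show ?thesis using \<delta>(1) by (intro exI[of _ "min (1 / 2) (\<delta> / 3)"]) auto
qed

text \<open>Near the boundary point \<open>e\<^sub>j\<close>, the \<open>j\<close>-th unit vector, the kernel is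
  \<open>(1 + (1 - v) / n) / v\<close> with the denominator to the power \<open>n + 2\<close>, where \<open>v = 1 - \<langle>z, w\<rangle>\<close> is small. For \<open>z\<close> and \<open>w\<close>
  close to the axis \<open>v = a (1 + e)\<close> with \<open>a > 0\<close> and a small relative error \<open>e\<close>. The number \<open>\<epsilon>\<close> is an
  error under which the real part of the kernel stays at least half of \<open>1 / a\<close> to that power.\<close>

locale test_region =
  fixes j :: "'n::finite" and \<epsilon> :: real
  assumes eps: "0 < \<epsilon>" "\<epsilon> \<le> 1 / 2"
    and perturbation: "\<And>e v :: complex. cmod e \<le> \<epsilon> \<Longrightarrow> cmod v \<le> \<epsilon> \<Longrightarrow>
      1 / 2 \<le> Re ((1 + (1 - v) / of_nat CARD('n)) / (1 + e) ^ (CARD('n) + 2))"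
begin

definition depth :: "complex ^ 'n \<Rightarrow> real" where
  "depth w = 1 - Re (w $ j)"

text \<open>The bound on \<open>Im (w $ j)\<close> from above and the last condition keep \<open>w\<close> close to the axis, relative to
  its depth, so that the kernel stays close to a positive one. The positive lower bound on
  \<open>Im (w $ j)\<close> slants the region: along a ray through the origin \<open>Im (w $ j)\<close> is nearly constant, hence so
  is the depth, up to a factor. So each ray meets the region in a set of bounded radial
  measure, although the region reaches the boundary.\<close>

definition region :: "(complex ^ 'n) set" where
  "region = {w. 0 < depth w \<and> depth w \<le> \<epsilon> / 8 \<and> \<epsilon> * depth w / 16 \<le> Im (w $ j) \<and> Im (w $ j) \<le> \<epsilon> * depth w / 8
     \<and> (norm w)\<^sup>2 - (cmod (w $ j))\<^sup>2 \<le> depth w}"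

lemma component_measurable [measurable]: "(\<lambda>w :: complex ^ 'n. w $ i) \<in> borel_measurable borel"
  by (intro borel_measurable_continuous_onI continuous_intros)

lemma depth_measurable [measurable]: "depth \<in> borel_measurable borel"
  unfolding depth_def by measurable

lemma region_borel [measurable]: "region \<in> sets borel"
  unfolding region_def by measurable

lemma region_bounds:
  assumes w: "w \<in> region"
  shows "depth w / 2 \<le> 1 - (norm w)\<^sup>2" "1 - (norm w)\<^sup>2 \<le> 2 * depth w" "norm w < 1"
    "cmod (w $ j) \<le> 1" "1 / 2 \<le> norm w"
proof -
  define x where "x = depth w"
  define y where "y = Im (w $ j)"
  have x: "0 < x" "x \<le> 1 / 16" and y: "0 \<le> y" "y \<le> x"
    and le: "(norm w)\<^sup>2 - (cmod (w $ j))\<^sup>2 \<le> x"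
  proof -
    show "0 < x" "(norm w)\<^sup>2 - (cmod (w $ j))\<^sup>2 \<le> x" using w by (auto simp: region_def x_def)
    show "x \<le> 1 / 16" using w eps by (auto simp: region_def x_def)
    have "\<epsilon> * x / 8 \<le> 1 * x / 8" using eps \<open>0 < x\<close> by (intro divide_right_mono mult_right_mono) auto
    moreover have "y \<le> \<epsilon> * x / 8" using w by (simp add: region_def x_def y_def)
    ultimately show "y \<le> x" using \<open>0 < x\<close> by linarith
    have "0 \<le> \<epsilon> * x / 16" using eps \<open>0 < x\<close> by simp
    then show "0 \<le> y" using w by (auto simp: region_def x_def y_def)
  qed
  have "\<epsilon> * x / 8 \<le> (1 / 2) * x / 8" using eps x by (intro divide_right_mono mult_right_mono) auto
  moreover have "y \<le> \<epsilon> * x / 8" using w by (simp add: region_def x_def y_def)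
  (* the imaginary part is negligible against the depth because \<epsilon> is at most 1 / 2 *)
  ultimately have y16: "y \<le> x / 16" by linarith
  have wj: "(cmod (w $ j))\<^sup>2 = (1 - x)\<^sup>2 + y\<^sup>2" by (simp add: cmod_power2 x_def y_def depth_def)
  have y2: "y\<^sup>2 \<le> x\<^sup>2 / 256"
    using power_mono[OF y16 y(1), of 2] by (simp add: power2_eq_square)
  have x2: "x\<^sup>2 \<le> x / 16" using x by (simp add: power2_eq_square mult_left_mono)
  have lower: "(1 - x)\<^sup>2 \<le> (norm w)\<^sup>2"
  proof -
    have "cmod (w $ j) \<le> norm w" by (rule Finite_Cartesian_Product.norm_nth_le)
    then have "(cmod (w $ j))\<^sup>2 \<le> (norm w)\<^sup>2" by (rule power_mono) simp
    then show ?thesis using wj zero_le_power2[of y] by linarith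
  qed
  have exp: "(1 - x)\<^sup>2 = 1 - 2 * x + x\<^sup>2" by (simp add: power2_eq_square algebra_simps)
  show 1: "depth w / 2 \<le> 1 - (norm w)\<^sup>2"
    using le wj y2 x2 x exp unfolding x_def[symmetric] by linarith
  show "1 - (norm w)\<^sup>2 \<le> 2 * depth w" using lower exp zero_le_power2[of x] unfolding x_def[symmetric] by linarith
  have "(norm w)\<^sup>2 < 1" using 1 x unfolding x_def[symmetric] by linarith
  then show "norm w < 1" by (simp add: power2_less_1_iff)
  then show "cmod (w $ j) \<le> 1" using Finite_Cartesian_Product.norm_nth_le[of w j] by linarith
  have "1 - x \<le> norm w" using lower x by (simp add: power2_le_iff_abs_le abs_le_square_iff[symmetric])
  then show "1 / 2 \<le> norm w" using x by linarith
qed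

text \<open>The product \<open>z\<^sub>j cnj w\<^sub>j\<close> has \<open>1 - z\<^sub>j cnj w\<^sub>j\<close> close to \<open>(1 - r) + depth w\<close>, and the other coordinates
  contribute at most the product of the distances of \<open>z\<close> and \<open>w\<close> from the axis, of order
  \<open>\<surd>(1 - r) \<surd>(depth w)\<close> with a small constant.\<close>

lemma hprod_near_depth:
  assumes w: "w \<in> region" and \<zeta>: "norm \<zeta> = 1" and r: "0 \<le> r" "r < 1" "1 - r \<le> \<epsilon> / 8"
    and d: "cmod (1 - \<zeta> $ j) \<le> \<epsilon>\<^sup>2 / 4 * (1 - r)"
  shows "cmod (1 - hprod (r *\<^sub>R \<zeta>) w - of_real (1 - r + depth w)) \<le> \<epsilon> * (1 - r + depth w)"
    and "cmod (1 - hprod (r *\<^sub>R \<zeta>) w) \<le> \<epsilon>"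
proof -
  define z where "z = r *\<^sub>R \<zeta>"
  define t where "t = 1 - r"
  define x where "x = depth w"
  define y where "y = Im (w $ j)"
  have t: "0 < t" "t \<le> \<epsilon> / 8" using r by (auto simp: t_def)
  have x: "0 < x" "x \<le> \<epsilon> / 8" "0 \<le> y" "y \<le> \<epsilon> * x / 8" "(norm w)\<^sup>2 - (cmod (w $ j))\<^sup>2 \<le> x"
    using w eps by (auto simp: region_def x_def y_def intro: order_trans[rotated])
  have zj: "z $ j = of_real r * \<zeta> $ j" by (simp only: z_def vector_scaleR_component scaleR_conv_of_real[where 'a = complex])
  have wj: "w $ j = Complex (1 - x) y" by (simp add: x_def y_def depth_def complex_eq_iff)
  have "cmod (hprod z w - z $ j * cnj (w $ j)) \<le> norm (z - z $ j *s axis j 1) * norm (w - w $ j *s axis j 1)"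
    using hprod_minus_projection_le[OF norm_axis_1[of j], of z w] by (simp add: hprod_axis)
  also have "\<dots> \<le> \<epsilon> * (t + x) / 2"
  proof (rule power2_le_imp_le)
    have "(norm (z - z $ j *s axis j 1))\<^sup>2 = r\<^sup>2 * (1 - (cmod (\<zeta> $ j))\<^sup>2)"
      using norm_proj_complement[OF norm_axis_1[of j], of z] \<zeta> zj
      by (simp add: hprod_axis z_def norm_mult power_mult_distrib algebra_simps)
    also have "\<dots> \<le> 1 * (2 * cmod (1 - \<zeta> $ j))"
    proof (rule mult_mono)
      show "r\<^sup>2 \<le> 1" using r by (simp add: power_le_one)
      have le1: "cmod (\<zeta> $ j) \<le> 1" using Finite_Cartesian_Product.norm_nth_le[of \<zeta> j] \<zeta> by simp
      show "1 - (cmod (\<zeta> $ j))\<^sup>2 \<le> 2 * cmod (1 - \<zeta> $ j)" by (rule one_minus_cmod_square_le[OF le1])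
      show "0 \<le> 1 - (cmod (\<zeta> $ j))\<^sup>2" using le1 by (simp add: power_le_one)
    qed simp
    also have "\<dots> \<le> \<epsilon>\<^sup>2 / 2 * t" using d by (simp add: t_def)
    finally have A: "(norm (z - z $ j *s axis j 1))\<^sup>2 \<le> \<epsilon>\<^sup>2 / 2 * t" .
    have B: "(norm (w - w $ j *s axis j 1))\<^sup>2 \<le> x"
      using norm_proj_complement[OF norm_axis_1[of j], of w] x(5) by (simp add: hprod_axis)
    have "(norm (z - z $ j *s axis j 1) * norm (w - w $ j *s axis j 1))\<^sup>2 \<le> (\<epsilon>\<^sup>2 / 2 * t) * x"
      unfolding power_mult_distrib using A B t eps by (intro mult_mono) auto
    also have "\<dots> = \<epsilon>\<^sup>2 / 4 * (2 * (t * x))" by simp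
    also have "\<dots> \<le> \<epsilon>\<^sup>2 / 4 * (t + x)\<^sup>2"
    proof (rule mult_left_mono)
      show "2 * (t * x) \<le> (t + x)\<^sup>2"
        using zero_le_power2[of t] zero_le_power2[of x] by (simp add: power2_sum)
    qed simp
    also have "\<dots> = (\<epsilon> * (t + x) / 2)\<^sup>2" by (simp add: power_mult_distrib power_divide)
    finally show "(norm (z - z $ j *s axis j 1) * norm (w - w $ j *s axis j 1))\<^sup>2 \<le> (\<epsilon> * (t + x) / 2)\<^sup>2" .
    show "0 \<le> \<epsilon> * (t + x) / 2" using eps t x by simp
  qed
  finally have rest: "cmod (hprod z w - z $ j * cnj (w $ j)) \<le> \<epsilon> * (t + x) / 2" .
  have main: "cmod (Complex (- t * x) (r * y)) \<le> \<epsilon> * x / 4"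
  proof -
    have "cmod (Complex (- t * x) (r * y)) \<le> \<bar>- t * x\<bar> + \<bar>r * y\<bar>"
      using cmod_le[of "Complex (- t * x) (r * y)"] by simp
    also have "\<dots> = t * x + r * y" using t x r by simp
    also have "\<dots> \<le> \<epsilon> / 8 * x + 1 * y"
      using t x r by (intro add_mono mult_right_mono) auto
    finally show ?thesis using x(4) by simp
  qed
  have third: "cmod (of_real r * cnj (w $ j) * (1 - \<zeta> $ j)) \<le> \<epsilon> * t / 8"
  proof -
    have "cmod (of_real r * cnj (w $ j) * (1 - \<zeta> $ j)) = (r * cmod (w $ j)) * cmod (1 - \<zeta> $ j)"
      using r by (simp add: norm_mult)
    also have "\<dots> \<le> 1 * (\<epsilon>\<^sup>2 / 4 * t)"
      using r region_bounds(4)[OF w] d by (intro mult_mono mult_le_one) (auto simp: t_def)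
    also have "\<dots> = (\<epsilon> / 2) * (\<epsilon> * t / 2)" by (simp add: power2_eq_square)
    also have "\<dots> \<le> (1 / 4) * (\<epsilon> * t / 2)" using eps t by (intro mult_right_mono) auto
    finally show ?thesis by simp
  qed
  (* three sources of error: the product t x of the depths together with the imaginary part of w,
     the deviation of \<zeta> from the axis, and the coordinates other than j *)
  have id: "1 - hprod z w - of_real (t + x)
    = Complex (- t * x) (r * y) + of_real r * cnj (w $ j) * (1 - \<zeta> $ j) - (hprod z w - z $ j * cnj (w $ j))"
    by (simp add: zj wj t_def complex_eq_iff algebra_simps)
  have "cmod (1 - hprod z w - of_real (t + x)) \<le> cmod (Complex (- t * x) (r * y) + of_real r * cnj (w $ j) * (1 - \<zeta> $ j)) + cmod (hprod z w - z $ j * cnj (w $ j))"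
    unfolding id by (rule norm_triangle_ineq4)
  also have "\<dots> \<le> (cmod (Complex (- t * x) (r * y)) + cmod (of_real r * cnj (w $ j) * (1 - \<zeta> $ j))) + cmod (hprod z w - z $ j * cnj (w $ j))"
    by (intro add_right_mono norm_triangle_ineq)
  also have "\<dots> \<le> \<epsilon> * x / 4 + \<epsilon> * t / 8 + \<epsilon> * (t + x) / 2"
    by (intro add_mono main third rest)
  also have "\<dots> \<le> \<epsilon> * (t + x)"
  proof -
    have "0 \<le> \<epsilon> * x" "0 \<le> \<epsilon> * t" using eps x t by auto
    then show ?thesis unfolding distrib_left add_divide_distrib by linarith
  qed
  finally have e1: "cmod (1 - hprod z w - of_real (t + x)) \<le> \<epsilon> * (t + x)" .
  then show "cmod (1 - hprod (r *\<^sub>R \<zeta>) w - of_real (1 - r + depth w)) \<le> \<epsilon> * (1 - r + depth w)"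
    by (simp add: z_def t_def x_def)
  have "cmod (1 - hprod z w) \<le> cmod (1 - hprod z w - of_real (t + x)) + cmod (of_real (t + x) :: complex)"
    using norm_triangle_ineq[of "1 - hprod z w - of_real (t + x)" "of_real (t + x)"] by simp
  also have "\<dots> \<le> \<epsilon> * (t + x) + (t + x)" using e1 t x by (intro add_mono) (auto simp del: of_real_add)
  also have "\<dots> = (1 + \<epsilon>) * (t + x)" by (simp add: algebra_simps)
  also have "\<dots> \<le> 2 * (\<epsilon> / 8 + \<epsilon> / 8)" using eps t x by (intro mult_mono) auto
  also have "\<dots> \<le> \<epsilon>" using eps by simp
  finally show "cmod (1 - hprod (r *\<^sub>R \<zeta>) w) \<le> \<epsilon>" by (simp add: z_def)
qed

lemma Re_kernel_ge:
  assumes w: "w \<in> region" and \<zeta>: "norm \<zeta> = 1" and r: "0 \<le> r" "r < 1" "1 - r \<le> \<epsilon> / 8"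
    and d: "cmod (1 - \<zeta> $ j) \<le> \<epsilon>\<^sup>2 / 4 * (1 - r)"
  shows "1 / 2 / (1 - r + depth w) ^ (CARD('n) + 2) \<le> Re (radial_bergman_kernel (r *\<^sub>R \<zeta>) w)"
proof -
  define a where "a = 1 - r + depth w"
  have a: "0 < a" using w r by (simp add: a_def region_def)
  define v where "v = 1 - hprod (r *\<^sub>R \<zeta>) w"
  (* the relative error in the denominator v of the kernel *)
  define e where "e = (v - of_real a) / of_real a"
  have ve: "cmod e \<le> \<epsilon>" "cmod v \<le> \<epsilon>"
    using hprod_near_depth[OF assms] a by (auto simp: v_def e_def a_def norm_divide divide_le_eq simp del: of_real_add of_real_diff)
  have v: "v = of_real a * (1 + e)" using a by (simp add: e_def field_simps)
  have h: "hprod (r *\<^sub>R \<zeta>) w = 1 - v" by (simp add: v_def)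
  define q where "q = (1 + (1 - v) / of_nat CARD('n)) / (1 + e) ^ (CARD('n) + 2)"
  have "radial_bergman_kernel (r *\<^sub>R \<zeta>) w = (1 + (1 - v) / of_nat CARD('n)) / v ^ (CARD('n) + 2)"
    by (simp add: radial_bergman_kernel_def h)
  also have "v ^ (CARD('n) + 2) = (1 + e) ^ (CARD('n) + 2) * of_real (a ^ (CARD('n) + 2))"
    by (subst v) (simp only: power_mult_distrib of_real_power mult.commute)
  finally have "radial_bergman_kernel (r *\<^sub>R \<zeta>) w = q / of_real (a ^ (CARD('n) + 2))"
    by (simp only: q_def divide_divide_eq_left)
  then have "Re (radial_bergman_kernel (r *\<^sub>R \<zeta>) w) = Re q / a ^ (CARD('n) + 2)"
    by (simp only: Re_divide_of_real)
  moreover have "1 / 2 \<le> Re q" unfolding q_def by (rule perturbation[OF ve])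
  ultimately show ?thesis unfolding a_def[symmetric] using a by (simp only: divide_right_mono zero_le_power less_imp_le)
qed

text \<open>On a ray through \<open>\<zeta>\<close> everything is comparable with \<open>a = 2 Im (\<zeta> $ j) / \<epsilon>\<close>: in the region
  \<open>a \<le> 1 - r\<^sup>2 \<le> 16 a\<close>, so the section has length at most \<open>16 a\<close> while the density of the radial measure is
  at most \<open>2 n / a\<close>.\<close>

lemma region_section_measure_le:
  assumes \<zeta>: "norm \<zeta> = 1"
  shows "(\<integral>\<^sup>+ r. (indicator region (r *\<^sub>R \<zeta>))\<^sup>2 \<partial>radial_measure (CARD('n))) \<le> ennreal (32 * real CARD('n))"
proof -
  define a where "a = 2 * Im (\<zeta> $ j) / \<epsilon>"
  let ?n = "CARD('n)"
  have mem: "0 < a \<and> a \<le> 1 - r\<^sup>2 \<and> 1 - 16 * a \<le> r" if r: "0 \<le> r" "r < 1" "r *\<^sub>R \<zeta> \<in> region" for r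
  proof -
    define x where "x = depth (r *\<^sub>R \<zeta>)"
    have x: "0 < x" "\<epsilon> * x / 16 \<le> r * Im (\<zeta> $ j)" "r * Im (\<zeta> $ j) \<le> \<epsilon> * x / 8"
      using r(3) by (auto simp: region_def x_def)
    have b: "x / 2 \<le> 1 - r\<^sup>2" "1 - r\<^sup>2 \<le> 2 * x" "1 / 2 \<le> r"
      using region_bounds[OF r(3)] r \<zeta> by (auto simp: x_def)
    have ra: "r * Im (\<zeta> $ j) = \<epsilon> * (r * a) / 2" using eps by (simp add: a_def)
    have l: "x \<le> 8 * (r * a)" using x(2) eps unfolding ra by (simp add: field_simps)
    have u: "4 * (r * a) \<le> x" using x(3) eps unfolding ra by (simp add: field_simps)
    have pos: "0 < a" using l x(1) r(1) by (smt (verit) mult_nonneg_nonpos)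
    have "(1 / 2) * a \<le> r * a" "r * a \<le> 1 * a" using b r pos by (auto intro!: mult_right_mono)
    then have "a \<le> 1 - r\<^sup>2" "1 - r\<^sup>2 \<le> 16 * a" using l u b by linarith+
    moreover have "r\<^sup>2 \<le> r" using r by (simp add: power2_eq_square mult_left_le)
    ultimately show ?thesis using pos by linarith
  qed
  show ?thesis
  proof (cases "0 < a")
    case False
    have "(\<integral>\<^sup>+ r. (indicator region (r *\<^sub>R \<zeta>))\<^sup>2 \<partial>radial_measure ?n) = (\<integral>\<^sup>+ r. 0 \<partial>radial_measure ?n)"
      by (rule nn_integral_cong_AE, rule eventually_mono[OF AE_radial_measure])
         (use mem False in \<open>auto simp: indicator_def\<close>)
    then show ?thesis by simp
  next
    case a: True
    have "(\<integral>\<^sup>+ r. (indicator region (r *\<^sub>R \<zeta>))\<^sup>2 \<partial>radial_measure ?n)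
      = (\<integral>\<^sup>+ r. ennreal (2 * real ?n * r ^ (2 * ?n - 1) / (1 - r\<^sup>2)) * (indicator region (r *\<^sub>R \<zeta>))\<^sup>2 * indicator {0..<1} r \<partial>lborel)"
      by (rule radial_measure_integral) measurable
    also have "\<dots> \<le> (\<integral>\<^sup>+ r. ennreal (2 * real ?n / a) * indicator {1 - 16 * a..1} r \<partial>lborel)"
    proof (rule nn_integral_mono)
      fix r :: real
      show "ennreal (2 * real ?n * r ^ (2 * ?n - 1) / (1 - r\<^sup>2)) * (indicator region (r *\<^sub>R \<zeta>))\<^sup>2 * indicator {0..<1} r
        \<le> ennreal (2 * real ?n / a) * indicator {1 - 16 * a..1} r"
      proof (cases "0 \<le> r \<and> r < 1 \<and> r *\<^sub>R \<zeta> \<in> region")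
        case True
        note m = mem[of r]
        have "2 * real ?n * r ^ (2 * ?n - 1) / (1 - r\<^sup>2) \<le> 2 * real ?n / a"
          using True m a by (intro frac_le mult_left_le power_le_one) auto
        then show ?thesis using True m by (simp add: ennreal_leI)
      qed (auto simp: indicator_def)
    qed
    also have "\<dots> = ennreal (2 * real ?n / a) * ennreal (16 * a)"
      using a by (subst nn_integral_cmult_indicator) auto
    also have "\<dots> = ennreal (32 * real ?n)" using a by (simp flip: ennreal_mult)
    finally show ?thesis .
  qed
qed

end

lemma Basis_complex_vec:
  "(Basis :: (complex ^ 'n) set) = (\<lambda>(i, u). axis i u) ` (UNIV \<times> {1, \<i>})"
  by (auto simp: Basis_vec_def Basis_complex_def)

lemma prod_Basis_complex_vec:
  "(\<Prod>b\<in>(Basis :: (complex ^ 'n) set). f b) = (\<Prod>i\<in>UNIV. f (axis i 1) * f (axis i \<i>))"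
proof -
  have "inj_on (\<lambda>(i, u). axis i u :: complex ^ 'n) (UNIV \<times> {1, \<i>})"
    by (auto simp: inj_on_def axis_eq_axis)
  then have "(\<Prod>b\<in>(Basis :: (complex ^ 'n) set). f b) = (\<Prod>(i, u)\<in>UNIV \<times> {1, \<i>}. f (axis i u))"
    unfolding Basis_complex_vec by (subst prod.reindex) (auto simp: case_prod_beta)
  also have "\<dots> = (\<Prod>i\<in>UNIV. f (axis i 1) * f (axis i \<i>))"
    by (subst prod.cartesian_product[symmetric]) (simp add: complex_eq_iff)
  finally show ?thesis .
qed

text \<open>No cancellation can occur in the real part.\<close>

lemma norm_integral_ge:
  fixes f :: "'a \<Rightarrow> complex"
  assumes f: "integrable M f" and g: "\<And>w. w \<in> space M \<Longrightarrow> 0 \<le> g w" "\<And>w. w \<in> space M \<Longrightarrow> g w \<le> Re (f w)"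
  shows "(\<integral>\<^sup>+ w. ennreal (g w) \<partial>M) \<le> ennreal (cmod (\<integral>w. f w \<partial>M))"
proof -
  have "(\<integral>\<^sup>+ w. ennreal (g w) \<partial>M) \<le> (\<integral>\<^sup>+ w. ennreal (Re (f w)) \<partial>M)"
    using g by (intro nn_integral_mono ennreal_leI) auto
  also have "\<dots> = ennreal (\<integral>w. Re (f w) \<partial>M)"
    using f g by (intro nn_integral_eq_integral integrable_Re AE_I2) (auto intro: order_trans)
  also have "(\<integral>w. Re (f w) \<partial>M) = Re (\<integral>w. f w \<partial>M)" using f by (rule integral_Re)
  also have "ennreal \<dots> \<le> ennreal (cmod (\<integral>w. f w \<partial>M))"
    by (intro ennreal_leI complex_Re_le_cmod)
  finally show ?thesis .
qed

text \<open>The radial measure is comparable to \<open>dr / (1 - r)\<close> away from the origin, and the interval has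
  logarithmic length \<open>L\<close>.\<close>

lemma radial_measure_log_interval:
  assumes n: "0 < n" and \<delta>: "0 < \<delta>" "\<delta> \<le> 1 / 2" and L: "0 \<le> L"
  shows "ennreal (real n / 4 ^ n * L) \<le> emeasure (radial_measure n) {1 - \<delta>..1 - \<delta> * exp (- L)}"
    and "emeasure (radial_measure n) {1 - \<delta>..1 - \<delta> * exp (- L)} \<le> ennreal (2 * real n * L)"
proof -
  let ?I = "{1 - \<delta>..1 - \<delta> * exp (- L)}"
  have dL: "0 < \<delta> * exp (- L)" "\<delta> * exp (- L) \<le> \<delta>" using \<delta> L by (auto simp: mult_left_le)
  have "(\<integral>\<^sup>+ r. ennreal (1 / (1 - r)) * indicator ?I r \<partial>lborel) = ennreal (- ln (1 - (1 - \<delta> * exp (- L))) - (- ln (1 - (1 - \<delta>))))"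
  proof (rule nn_integral_FTC_Icc)
    fix r assume r: "r \<in> ?I"
    then have "0 < 1 - r" using dL by auto
    then show "((\<lambda>r. - ln (1 - r)) has_real_derivative 1 / (1 - r)) (at r)"
      by (auto intro!: derivative_eq_intros simp: field_simps)
    show "0 \<le> 1 / (1 - r)" using \<open>0 < 1 - r\<close> by simp
  qed (use dL in auto)
  then have log: "(\<integral>\<^sup>+ r. ennreal (1 / (1 - r)) * indicator ?I r \<partial>lborel) = ennreal L"
    using \<delta> by (simp add: ln_mult)
  have mass: "emeasure (radial_measure n) ?I = (\<integral>\<^sup>+ r. ennreal (2 * real n * r ^ (2 * n - 1) / (1 - r\<^sup>2)) * indicator {0..<1} r * indicator ?I r \<partial>lborel)"
    unfolding radial_measure_def by (subst emeasure_density) auto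
  have cmult: "ennreal c * ennreal L = (\<integral>\<^sup>+ r. ennreal c * (ennreal (1 / (1 - r)) * indicator ?I r) \<partial>lborel)" for c
    unfolding log[symmetric] by (rule nn_integral_cmult[symmetric]) measurable
  have bounds: "0 \<le> r" "r < 1" "1 / 2 \<le> r" "r\<^sup>2 < 1" if "r \<in> ?I" for r
  proof -
    have "1 - \<delta> \<le> r" "r \<le> 1 - \<delta> * exp (- L)" using that by auto
    then show *: "0 \<le> r" "r < 1" "1 / 2 \<le> r" using dL \<delta> by linarith+
    show "r\<^sup>2 < 1" using * by (simp add: abs_square_less_1)
  qed
  have factor: "1 - r\<^sup>2 = (1 - r) * (1 + r)" for r :: real by (simp add: power2_eq_square algebra_simps)
  have "ennreal (real n / 4 ^ n * L) = ennreal (real n / 4 ^ n) * ennreal L"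
    using L by (intro ennreal_mult) auto
  also have "\<dots> \<le> emeasure (radial_measure n) ?I"
    unfolding cmult mass
  proof (rule nn_integral_mono)
    fix r :: real
    show "ennreal (real n / 4 ^ n) * (ennreal (1 / (1 - r)) * indicator ?I r)
      \<le> ennreal (2 * real n * r ^ (2 * n - 1) / (1 - r\<^sup>2)) * indicator {0..<1} r * indicator ?I r"
    proof (cases "r \<in> ?I")
      case True
      note b = bounds[OF True]
      have "real n / 4 ^ n * (1 / (1 - r)) = real n * (1 / 2) ^ (2 * n) / (1 - r)"
        by (simp add: power_mult power_divide)
      also have "\<dots> \<le> real n * r ^ (2 * n) / (1 - r)"
        using b by (intro divide_right_mono mult_left_mono power_mono) auto
      also have "\<dots> \<le> real n * r ^ (2 * n - 1) / (1 - r)"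
        using b n by (intro divide_right_mono mult_left_mono power_decreasing) auto
      also have "\<dots> = 2 * real n * r ^ (2 * n - 1) / (2 * (1 - r))"
        by (subst mult.assoc, subst mult_divide_mult_cancel_left) auto
      also have "\<dots> \<le> 2 * real n * r ^ (2 * n - 1) / (1 - r\<^sup>2)"
      proof (rule divide_left_mono)
        have "(1 - r) * (1 + r) \<le> (1 - r) * 2" using b by (intro mult_left_mono) auto
        then show "1 - r\<^sup>2 \<le> 2 * (1 - r)" by (simp only: factor mult.commute)
      qed (use b in auto)
      finally have F: "real n / 4 ^ n * (1 / (1 - r)) \<le> 2 * real n * r ^ (2 * n - 1) / (1 - r\<^sup>2)" .
      have eq: "ennreal (real n / 4 ^ n * (1 / (1 - r))) = ennreal (real n / 4 ^ n) * ennreal (1 / (1 - r))"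
        using b by (intro ennreal_mult) auto
      show ?thesis using True b ennreal_leI[OF F] unfolding eq by simp
    qed auto
  qed
  finally show "ennreal (real n / 4 ^ n * L) \<le> emeasure (radial_measure n) ?I" .
  have "emeasure (radial_measure n) ?I \<le> ennreal (2 * real n) * ennreal L"
    unfolding cmult mass
  proof (rule nn_integral_mono)
    fix r :: real
    show "ennreal (2 * real n * r ^ (2 * n - 1) / (1 - r\<^sup>2)) * indicator {0..<1} r * indicator ?I r
       \<le> ennreal (2 * real n) * (ennreal (1 / (1 - r)) * indicator ?I r)"
    proof (cases "r \<in> ?I")
      case True
      note b = bounds[OF True]
      have "1 - r \<le> 1 - r\<^sup>2" using b by (simp add: power2_eq_square mult_left_le)
      then have F: "2 * real n * r ^ (2 * n - 1) / (1 - r\<^sup>2) \<le> 2 * real n * (1 / (1 - r))"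
        using b frac_le[of "2 * real n" "2 * real n * r ^ (2 * n - 1)" "1 - r" "1 - r\<^sup>2"]
        by (simp add: mult_left_le power_le_one)
      have eq: "ennreal (2 * real n * (1 / (1 - r))) = ennreal (2 * real n) * ennreal (1 / (1 - r))"
        using b by (intro ennreal_mult) auto
      show ?thesis using True b ennreal_leI[OF F] unfolding eq by simp
    qed auto
  qed
  then show "emeasure (radial_measure n) ?I \<le> ennreal (2 * real n * L)"
    using L by (simp add: ennreal_mult)
qed

context test_region begin

text \<open>The cone over the cap contains the ball of radius \<open>t / 8\<close> around \<open>e\<^sub>j / 2\<close>. The exponent is far from
  optimal, but only the \<open>L\<close>-th root of the measure of a cap of radius \<open>exp (- L)\<close> will matter.\<close>

lemma emeasure_sphere_cap_ge:
  assumes t: "0 < t" "t \<le> 1"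
  shows "ennreal ((t / 8) ^ (2 * CARD('n))) \<le> emeasure sphere_measure {\<zeta> :: complex ^ 'n. cmod (1 - \<zeta> $ j) \<le> t}"
proof -
  define e :: "complex ^ 'n" where "e = axis j 1"
  have e: "norm e = 1" "e $ j = 1" using norm_axis_1[of j] by (simp_all add: e_def axis_def)
  have sub: "ball ((1 / 2) *\<^sub>R e) (t / 8) \<subseteq> ball 0 1 \<inter> {z. cmod (1 - sgn z $ j) \<le> t}"
  proof
    fix z assume "z \<in> ball ((1 / 2) *\<^sub>R e) (t / 8)"
    then have z: "norm (z - (1 / 2) *\<^sub>R e) < t / 8" by (simp add: dist_norm norm_minus_commute)
    have nn: "\<bar>norm z - 1 / 2\<bar> < t / 8"
      using norm_triangle_ineq3[of z "(1 / 2) *\<^sub>R e"] z e by simp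
    then have nz: "3 / 8 < norm z" "norm z < 1" using t unfolding abs_less_iff by linarith+
    have "z - norm z *\<^sub>R e = (z - (1 / 2) *\<^sub>R e) - (norm z - 1 / 2) *\<^sub>R e" by (simp add: algebra_simps)
    then have "norm (z - norm z *\<^sub>R e) \<le> norm (z - (1 / 2) *\<^sub>R e) + norm ((norm z - 1 / 2) *\<^sub>R e)"
      by (metis norm_triangle_ineq4)
    also have "\<dots> \<le> t / 4" using z nn e by simp
    finally have "norm (z - norm z *\<^sub>R e) \<le> t / 4" .
    moreover have "z - norm z *\<^sub>R e = norm z *\<^sub>R (sgn z - e)" 
    proof -
      have "norm z \<noteq> 0" using nz by linarith
      then show ?thesis by (simp add: sgn_div_norm scaleR_diff_right)
    qed
    ultimately have "norm z * norm (sgn z - e) \<le> t / 4" by simp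
    moreover have "3 / 8 * norm (sgn z - e) \<le> norm z * norm (sgn z - e)"
      using nz by (intro mult_right_mono) auto
    ultimately have "norm (sgn z - e) \<le> t" using t by linarith
    moreover have "cmod (1 - sgn z $ j) \<le> norm (sgn z - e)"
      using Finite_Cartesian_Product.norm_nth_le[of "sgn z - e" j] e by (simp add: norm_minus_commute)
    ultimately show "z \<in> ball 0 1 \<inter> {z. cmod (1 - sgn z $ j) \<le> t}" using nz by simp
  qed
  have "ennreal ((t / 8) ^ (2 * CARD('n))) * emeasure lborel (ball 0 1 :: (complex ^ 'n) set) = emeasure lborel (ball ((1 / 2) *\<^sub>R e) (t / 8))"
    using t by (simp add: emeasure_ball mult.commute flip: ennreal_mult)
  also have "\<dots> \<le> emeasure lborel (ball 0 1 \<inter> {z :: complex ^ 'n. cmod (1 - sgn z $ j) \<le> t})"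
    by (rule emeasure_mono[OF sub]) measurable
  finally have "ennreal ((t / 8) ^ (2 * CARD('n))) \<le> emeasure lborel (ball 0 1 \<inter> {z :: complex ^ 'n. cmod (1 - sgn z $ j) \<le> t}) / emeasure lborel (ball 0 1 :: (complex ^ 'n) set)"
    using divide_right_mono_ennreal[of "ennreal ((t / 8) ^ (2 * CARD('n))) * emeasure lborel (ball 0 1 :: (complex ^ 'n) set)" _
        "emeasure lborel (ball 0 1 :: (complex ^ 'n) set)"] ball_volume[where 'n='n]
    by (simp add: ennreal_mult_divide_eq)
  also have "\<dots> = emeasure borel_ball_measure {z :: complex ^ 'n. cmod (1 - sgn z $ j) \<le> t}"
    by (rule emeasure_borel_ball_measure[symmetric]) measurable
  also have "\<dots> = emeasure sphere_measure {\<zeta> :: complex ^ 'n. cmod (1 - \<zeta> $ j) \<le> t}"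
    unfolding sphere_measure_eq by (subst emeasure_distr) (auto simp: vimage_def)
  finally show ?thesis .
qed

text \<open>The part of the region at depth comparable to \<open>t\<close> contains a box with sides of order \<open>t\<close> in the two
  real directions of the \<open>j\<close>-th coordinate and \<open>\<surd>t\<close> in the others, of volume of order
  \<open>t\<close> to the power \<open>n + 1\<close>, and there the integrand is of order \<open>t\<close> to the power \<open>- (n + 2)\<close>.\<close>

lemma region_integral_ge:
  "\<exists>c>0. \<forall>t. 0 < t \<longrightarrow> t \<le> \<epsilon> / 8 \<longrightarrow>
     ennreal (c / t) \<le> (\<integral>\<^sup>+ w. indicator region w * ennreal (1 / 2 / (t + depth w) ^ (CARD('n) + 2)) \<partial>borel_ball_measure)"
proof -
  let ?n = "CARD('n)"
  have n1: "1 \<le> ?n" using zero_less_card_finite[where 'a='n] by linarith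
  obtain V where V: "emeasure lborel (ball 0 1 :: (complex ^ 'n) set) = ennreal V" "0 < V"
    using ball_volume[where 'n='n] by (cases "emeasure lborel (ball 0 1 :: (complex ^ 'n) set)") (auto simp: less_le)
  define c0 where "c0 = \<epsilon> / (128 * (4 * real ?n) ^ (?n - 1))"
  have c0: "0 < c0" using eps n1 by (auto simp: c0_def intro!: divide_pos_pos mult_pos_pos)
  define c where "c = c0 / V / (2 * 2 ^ (?n + 2))"
  have c: "0 < c" using c0 V by (simp add: c_def)
  have "ennreal (c / t) \<le> (\<integral>\<^sup>+ w. indicator region w * ennreal (1 / 2 / (t + depth w) ^ (?n + 2)) \<partial>borel_ball_measure)"
    if t: "0 < t" "t \<le> \<epsilon> / 8" for t
  proof -
    define \<rho> where "\<rho> = sqrt (t / (4 * real ?n))"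
    have \<rho>: "0 < \<rho>" "\<rho>\<^sup>2 = t / (4 * real ?n)" using t n1 by (simp_all add: \<rho>_def)
    (* corners of the box: depth between 3 t / 4 and t, so that the two bounds on the imaginary part,
       which depend on the depth, leave room for a fixed interval *)
    define l u :: "complex ^ 'n" where "l = (\<chi> i. if i = j then Complex (1 - t) (\<epsilon> * t / 16) else 0)"
      and "u = (\<chi> i. if i = j then Complex (1 - 3 * t / 4) (3 * \<epsilon> * t / 32) else Complex \<rho> \<rho>)"
    have mem: "Re (l $ i) < Re (w $ i) \<and> Re (w $ i) < Re (u $ i) \<and> Im (l $ i) < Im (w $ i) \<and> Im (w $ i) < Im (u $ i)"
      if "w \<in> box l u" for w i
    proof -
      have "axis i 1 \<in> (Basis :: (complex ^ 'n) set)" "axis i \<i> \<in> (Basis :: (complex ^ 'n) set)"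
        unfolding Basis_complex_vec by auto
      then have "l \<bullet> axis i 1 < w \<bullet> axis i 1 \<and> w \<bullet> axis i 1 < u \<bullet> axis i 1"
        "l \<bullet> axis i \<i> < w \<bullet> axis i \<i> \<and> w \<bullet> axis i \<i> < u \<bullet> axis i \<i>"
        using that unfolding mem_box by blast+
      then show ?thesis by (simp add: inner_axis inner_complex_def)
    qed
    have inD: "w \<in> region" "depth w < t" if w: "w \<in> box l u" for w
    proof -
      have wj: "1 - t < Re (w $ j)" "Re (w $ j) < 1 - 3 * t / 4" "\<epsilon> * t / 16 < Im (w $ j)" "Im (w $ j) < 3 * \<epsilon> * t / 32"
        using mem[OF w, of j] by (simp_all add: l_def u_def)
      show "depth w < t" using wj by (simp add: depth_def)
      have x: "3 * t / 4 < depth w" "depth w < t" using wj by (simp_all add: depth_def)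
      have "\<epsilon> * depth w / 16 \<le> \<epsilon> * t / 16" using x eps by (intro divide_right_mono mult_left_mono) auto
      moreover have "3 * \<epsilon> * t / 32 \<le> \<epsilon> * depth w / 8"
      proof -
        have "\<epsilon> * (3 * t / 4) / 8 \<le> \<epsilon> * depth w / 8" using x eps by (intro divide_right_mono mult_left_mono) auto
        then show ?thesis by simp
      qed
      moreover have "(norm w)\<^sup>2 - (cmod (w $ j))\<^sup>2 \<le> depth w"
      proof -
        have "(norm w)\<^sup>2 = (\<Sum>i\<in>UNIV. (cmod (w $ i))\<^sup>2)"
          by (simp add: norm_vec_def L2_set_def sum_nonneg)
        also have "\<dots> = (cmod (w $ j))\<^sup>2 + (\<Sum>i\<in>UNIV - {j}. (cmod (w $ i))\<^sup>2)"
          by (rule sum.remove) auto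
        finally have "(norm w)\<^sup>2 - (cmod (w $ j))\<^sup>2 = (\<Sum>i\<in>UNIV - {j}. (cmod (w $ i))\<^sup>2)" by simp
        also have "\<dots> \<le> (\<Sum>i\<in>UNIV - {j}. 2 * \<rho>\<^sup>2)"
        proof (rule sum_mono)
          fix i assume "i \<in> UNIV - {j}"
          then have "0 < Re (w $ i)" "Re (w $ i) < \<rho>" "0 < Im (w $ i)" "Im (w $ i) < \<rho>"
            using mem[OF w, of i] by (simp_all add: l_def u_def)
          then have "(Re (w $ i))\<^sup>2 \<le> \<rho>\<^sup>2" "(Im (w $ i))\<^sup>2 \<le> \<rho>\<^sup>2" by (auto intro!: power_mono)
          then show "(cmod (w $ i))\<^sup>2 \<le> 2 * \<rho>\<^sup>2" by (simp add: cmod_power2)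
        qed
        also have "\<dots> \<le> real ?n * (2 * \<rho>\<^sup>2)" by (simp add: mult_right_mono card_Diff_singleton)
        also have "\<dots> = t / 2" using n1 by (simp add: \<rho>(2))
        finally show ?thesis using x t by linarith
      qed
      ultimately show "w \<in> region" unfolding region_def using x wj t by (intro CollectI conjI) linarith+
    qed
    have vol: "emeasure lborel (box l u) = ennreal (c0 * t ^ (?n + 1))"
    proof -
      have d: "(u - l) \<bullet> axis i 1 = (if i = j then t / 4 else \<rho>)" "(u - l) \<bullet> axis i \<i> = (if i = j then \<epsilon> * t / 32 else \<rho>)" for i
        by (simp_all add: inner_axis inner_complex_def l_def u_def)
      have "l \<bullet> b \<le> u \<bullet> b" if "b \<in> Basis" for b
      proof -
        have "0 \<le> (u - l) \<bullet> b"
          using that d t eps \<rho> unfolding Basis_complex_vec by (auto split: if_splits)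
        then show ?thesis by (simp add: inner_diff_left)
      qed
      then have "emeasure lborel (box l u) = ennreal (\<Prod>b\<in>Basis. (u - l) \<bullet> b)" by (rule emeasure_lborel_box)
      also have "(\<Prod>b\<in>Basis. (u - l) \<bullet> b) = (\<Prod>i\<in>UNIV. (if i = j then t / 4 * (\<epsilon> * t / 32) else \<rho>\<^sup>2))"
        unfolding prod_Basis_complex_vec d by (intro prod.cong) (auto simp: power2_eq_square)
      also have "\<dots> = t / 4 * (\<epsilon> * t / 32) * (\<Prod>i\<in>UNIV - {j}. (if i = j then t / 4 * (\<epsilon> * t / 32) else \<rho>\<^sup>2))"
        by (subst prod.remove[of UNIV j]) auto
      also have "(\<Prod>i\<in>UNIV - {j}. (if i = j then t / 4 * (\<epsilon> * t / 32) else \<rho>\<^sup>2)) = (\<Prod>i\<in>UNIV - {j}. \<rho>\<^sup>2)"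
        by (intro prod.cong) auto
      also have "\<dots> = t ^ (?n - 1) / (4 * real ?n) ^ (?n - 1)"
        by (simp add: card_Diff_singleton \<rho>(2) power_divide)
      also have "t / 4 * (\<epsilon> * t / 32) * \<dots> = c0 * (t * t * t ^ (?n - 1))"
        by (simp add: c0_def)
      also have "t * t * t ^ (?n - 1) = t ^ (?n + 1)"
        using n1 by (simp add: power_eq_if)
      finally show ?thesis .
    qed
    have "ennreal (c / t) = ennreal (1 / 2 / (2 * t) ^ (?n + 2)) * ennreal (c0 * t ^ (?n + 1) / V)"
      using t V c0 by (simp add: c_def power_mult_distrib flip: ennreal_mult)
    also have "ennreal (c0 * t ^ (?n + 1) / V) = emeasure lborel (box l u) / emeasure lborel (ball 0 1 :: (complex ^ 'n) set)"
      using V c0 t by (simp add: vol divide_ennreal)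
    also have "\<dots> = emeasure borel_ball_measure (box l u)"
    proof -
      have "box l u \<subseteq> ball 0 1" using inD(1) region_bounds(3) by (auto simp: subset_iff)
      then have "ball 0 1 \<inter> box l u = box l u" by blast
      then show ?thesis by (subst emeasure_borel_ball_measure) auto
    qed
    also have "ennreal (1 / 2 / (2 * t) ^ (?n + 2)) * \<dots> = (\<integral>\<^sup>+ w. ennreal (1 / 2 / (2 * t) ^ (?n + 2)) * indicator (box l u) w \<partial>borel_ball_measure)"
      by (rule nn_integral_cmult_indicator[symmetric]) simp
    also have "\<dots> \<le> (\<integral>\<^sup>+ w. indicator region w * ennreal (1 / 2 / (t + depth w) ^ (?n + 2)) \<partial>borel_ball_measure)"
    proof (rule nn_integral_mono)
      fix w :: "complex ^ 'n"
      show "ennreal (1 / 2 / (2 * t) ^ (?n + 2)) * indicator (box l u) w \<le> indicator region w * ennreal (1 / 2 / (t + depth w) ^ (?n + 2))"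
      proof (cases "w \<in> box l u")
        case True
        note d = inD[OF True]
        have "0 < depth w" using d by (simp add: region_def)
        then have "1 / 2 / (2 * t) ^ (?n + 2) \<le> 1 / 2 / (t + depth w) ^ (?n + 2)"
          using t d by (intro divide_left_mono power_mono mult_pos_pos zero_less_power) auto
        then show ?thesis using d True by (simp add: ennreal_leI)
      qed auto
    qed
    finally show ?thesis .
  qed
  with c show ?thesis by blast
qed

end

section \<open>Lower bounds for the operator norm\<close>

lemma power_powr_lower:
  fixes b p :: real
  assumes b: "0 < b" "b \<le> 1" and p: "1 \<le> p"
  shows "(b * exp (- 1)) ^ m \<le> ((b * exp (- p)) ^ m) powr (1 / p)"
proof -
  have "(b * exp (- 1)) powr p = b powr p * exp (- p)"
  proof -
    have "exp (- 1 :: real) powr p = exp (- p)" by (simp add: powr_def)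
    then show ?thesis using b by (simp add: powr_mult)
  qed
  also have "\<dots> \<le> b powr 1 * exp (- p)"
    using b p by (intro mult_right_mono powr_mono') auto
  finally have "(b * exp (- 1)) powr p \<le> b * exp (- p)" using b by simp
  then have "((b * exp (- 1)) powr p) ^ m \<le> (b * exp (- p)) ^ m" by (rule power_mono) simp
  also have "((b * exp (- 1)) powr p) ^ m = ((b * exp (- 1)) ^ m) powr p"
    using b by (simp add: powr_realpow[symmetric] powr_powr mult.commute)
  finally have "(((b * exp (- 1)) ^ m) powr p) powr (1 / p) \<le> ((b * exp (- p)) ^ m) powr (1 / p)"
    using p by (intro powr_mono2) auto
  then show ?thesis using b p by (simp add: powr_powr)
qed

lemma bergman_norm_ge:
  fixes \<phi> :: "complex ^ 'n \<Rightarrow> complex"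
  assumes "\<phi> \<in> borel_measurable borel" "Lp2_norm p \<phi> \<le> 1"
  shows "Fp2_norm p (bergman \<phi>) \<le> bergman_norm TYPE('n) p"
proof -
  have "Lp2_norm p \<phi> < \<infinity>" using assms(2) by (rule le_less_trans) simp
  then have "\<phi> \<in> Lp2 p" using borel_measurable_ball_measure[OF assms(1)] by (simp add: Lp2_def)
  then show ?thesis unfolding bergman_norm_def operator_norm_def
    using assms(2) by (intro SUP_upper) simp
qed

lemma norm_radial_bergman_ge:
  fixes f :: "complex ^ 'n \<Rightarrow> real"
  assumes [measurable]: "f \<in> borel_measurable borel" and f: "\<And>w. 0 \<le> f w" "\<And>w. f w \<le> c"
    and [measurable]: "g \<in> borel_measurable borel"
    and g: "\<And>w. norm w < 1 \<Longrightarrow> f w \<noteq> 0 \<Longrightarrow> 0 \<le> g w" "\<And>w. norm w < 1 \<Longrightarrow> f w \<noteq> 0 \<Longrightarrow> g w \<le> Re (radial_bergman_kernel z w)"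
    and z: "norm z < 1"
  shows "(\<integral>\<^sup>+ w. ennreal (f w * g w) \<partial>borel_ball_measure)
    \<le> ennreal (cmod (bergman (\<lambda>w. of_real (f w)) z + radial_deriv (bergman (\<lambda>w. of_real (f w))) z / of_nat CARD('n)))"
proof -
  interpret P: prob_space "ball_measure :: (complex ^ 'n) measure" by (rule prob_space_ball_measure)
  have int: "integrable ball_measure (\<lambda>w. complex_of_real (f w))"
  proof (rule P.integrable_const_bound)
    show "AE w in ball_measure. norm (complex_of_real (f w)) \<le> c" using f by (intro AE_I2) simp
    show "(\<lambda>w. complex_of_real (f w)) \<in> borel_measurable ball_measure"
      by (rule borel_measurable_ball_measure) measurable
  qed
  interpret integrable_on_ball "\<lambda>w. complex_of_real (f w)" by unfold_locales (rule int)
  have "integrable ball_measure (\<lambda>w. of_real (f w) * radial_bergman_kernel z w)"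
  proof -
    have "integrable ball_measure (\<lambda>w. of_real (f w) * (pow_kernel (CARD('n) + 2) 0 (hprod z w) * hprod z w ^ 0)
        + of_real (f w) * (pow_kernel (CARD('n) + 2) 0 (hprod z w) * hprod z w ^ 1) / of_nat CARD('n))"
      by (intro Bochner_Integration.integrable_add Bochner_Integration.integrable_divide integrable_kernel z)
    then show ?thesis by (simp add: radial_bergman_kernel_def pow_kernel_def add_divide_distrib distrib_left mult_ac)
  qed
  then have "(\<integral>\<^sup>+ w. ennreal (f w * g w) \<partial>ball_measure) \<le> ennreal (cmod (\<integral>w. of_real (f w) * radial_bergman_kernel z w \<partial>ball_measure))"
  proof (rule norm_integral_ge)
    fix w :: "complex ^ 'n" assume "w \<in> space ball_measure"
    then have w: "norm w < 1" by simp
    show "0 \<le> f w * g w" using f g[OF w] by (cases "f w = 0") auto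
    show "f w * g w \<le> Re (of_real (f w) * radial_bergman_kernel z w)"
      using f g[OF w] by (cases "f w = 0") (auto intro: mult_left_mono)
  qed
  also have "(\<integral>w. of_real (f w) * radial_bergman_kernel z w \<partial>ball_measure)
     = bergman (\<lambda>w. of_real (f w)) z + radial_deriv (bergman (\<lambda>w. of_real (f w))) z / of_nat CARD('n)"
    unfolding bergman_radial_formula[OF z] radial_bergman_kernel_def ..
  finally show ?thesis by (subst (asm) nn_integral_ball_measure) auto
qed

context test_region begin

text \<open>A point \<open>r \<zeta>\<close> with \<open>r\<close> in the shell and \<open>\<zeta>\<close> in the small cap is close to the axis relative to its depth,
  at every depth that the shell allows: the aperture of the cap is adapted to the smallest one,
  \<open>\<delta>0 exp (- L)\<close>. The shell has radial measure of order \<open>L\<close>. Both are used with \<open>L = p\<close> or \<open>L = p'\<close>.\<close>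

abbreviation \<delta>0 :: real where "\<delta>0 \<equiv> \<epsilon> / 8"

abbreviation aperture :: "real \<Rightarrow> real" where "aperture L \<equiv> \<epsilon>\<^sup>2 / 4 * (\<delta>0 * exp (- L))"

abbreviation shell :: "real \<Rightarrow> real set" where "shell L \<equiv> {1 - \<delta>0..1 - \<delta>0 * exp (- L)}"

abbreviation small_cap :: "real \<Rightarrow> (complex ^ 'n) set" where
  "small_cap L \<equiv> {\<zeta>. cmod (1 - \<zeta> $ j) \<le> aperture L}"

lemma aperture_pos: "0 < aperture L" using eps by simp

lemma aperture_le_1: "0 \<le> L \<Longrightarrow> aperture L \<le> 1"
proof -
  assume "0 \<le> L"
  then have "\<delta>0 * exp (- L) \<le> 1" using eps mult_le_one[of \<delta>0 "exp (- L)"] by simp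
  moreover have "\<epsilon>\<^sup>2 / 4 \<le> 1" using power_le_one[of \<epsilon> 2] eps by simp
  ultimately show ?thesis using eps mult_le_one[of "\<epsilon>\<^sup>2 / 4" "\<delta>0 * exp (- L)"] by simp
qed

lemma shell_bounds:
  assumes "r \<in> shell L" "0 \<le> L"
  shows "0 \<le> r" "0 < r" "r < 1" "1 - r \<le> \<delta>0" "\<delta>0 * exp (- L) \<le> 1 - r"
proof -
  have "1 - \<delta>0 \<le> r" "r \<le> 1 - \<delta>0 * exp (- L)" using assms by auto
  moreover have "0 < \<delta>0 * exp (- L)" using eps by simp
  ultimately show "0 \<le> r" "0 < r" "r < 1" "1 - r \<le> \<delta>0" "\<delta>0 * exp (- L) \<le> 1 - r" using eps by linarith+
qed

lemma Re_kernel_ge_shell: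
  assumes w: "w \<in> region" and \<zeta>: "norm \<zeta> = 1" "\<zeta> \<in> small_cap L" and r: "r \<in> shell L" and L: "0 \<le> L"
  shows "1 / 2 / (1 - r + depth w) ^ (CARD('n) + 2) \<le> Re (radial_bergman_kernel (r *\<^sub>R \<zeta>) w)"
proof (rule Re_kernel_ge[OF w \<zeta>(1)])
  note b = shell_bounds[OF r L]
  show "0 \<le> r" "r < 1" "1 - r \<le> \<epsilon> / 8" using b by auto
  have "aperture L \<le> \<epsilon>\<^sup>2 / 4 * (1 - r)" using b by (intro mult_left_mono) auto
  then show "cmod (1 - \<zeta> $ j) \<le> \<epsilon>\<^sup>2 / 4 * (1 - r)" using \<zeta>(2) unfolding mem_Collect_eq by linarith
qed

text \<open>A lower bound for the \<open>L\<close>-th root of the measure of \<^term>\<open>small_cap L\<close>, uniform in \<open>L \<ge> 1\<close>: the radius of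
  the cap decays exponentially in \<open>L\<close>, so the root stays bounded below.\<close>

definition cap_floor :: real where
  "cap_floor = (\<epsilon>\<^sup>2 / 4 * \<delta>0 / 8 * exp (- 1)) ^ (2 * CARD('n))"

lemma cap_floor_pos: "0 < cap_floor" using eps by (simp add: cap_floor_def)

lemma cap_floor_le:
  assumes p: "1 \<le> p"
  shows "cap_floor \<le> ((aperture p / 8) ^ (2 * CARD('n))) powr (1 / p)"
proof -
  have "\<epsilon>\<^sup>2 / 4 * \<delta>0 / 8 \<le> 1" using aperture_le_1[of 0] by simp
  then have "cap_floor \<le> ((\<epsilon>\<^sup>2 / 4 * \<delta>0 / 8 * exp (- p)) ^ (2 * CARD('n))) powr (1 / p)"
    unfolding cap_floor_def using eps p by (intro power_powr_lower) auto
  then show ?thesis by (simp add: mult_ac)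
qed

lemma small_cap_measure:
  obtains s where "emeasure sphere_measure (small_cap L) = ennreal s" "0 \<le> s"
proof -
  interpret prob_space "sphere_measure :: (complex ^ 'n) measure" by (rule prob_space_sphere_measure)
  have "emeasure sphere_measure (small_cap L) \<noteq> top" using emeasure_finite by simp
  then show ?thesis using that by (cases "emeasure sphere_measure (small_cap L)") auto
qed

text \<open>The test function is a multiple of the indicator of the region, whose square function is at most \<open>1\<close>
  everywhere. On the small cap times the shell with \<open>L = p\<close>, its image is bounded below by a positive
  constant, so the square function of the image is of order \<open>\<surd>p\<close> on the cap; and the cap is so large
  that its measure to the power \<open>1 / p\<close> does not spoil this.\<close>

theorem bergman_norm_ge_sqrt:
  "\<exists>c>0. \<forall>p\<ge>2. ennreal (c * sqrt p) \<le> bergman_norm TYPE('n) p"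
proof -
  let ?n = "CARD('n)"
  obtain c1 where c1: "0 < c1"
    and J: "\<And>t. 0 < t \<Longrightarrow> t \<le> \<delta>0 \<Longrightarrow>
      ennreal (c1 / t) \<le> (\<integral>\<^sup>+ w. indicator region w * ennreal (1 / 2 / (t + depth w) ^ (?n + 2)) \<partial>borel_ball_measure)"
    using region_integral_ge by blast
  (* normalizes the square function of the indicator to at most 1 *)
  define c where "c = 1 / sqrt (32 * real ?n)"
  have c: "0 < c" "c\<^sup>2 * (32 * real ?n) = 1" by (simp_all add: c_def power_divide)
  define f where "f w = c * indicator region w" for w :: "complex ^ 'n"
  have [measurable]: "f \<in> borel_measurable borel" unfolding f_def by measurable
  define \<phi> where "\<phi> w = complex_of_real (f w)" for w
  have [measurable]: "\<phi> \<in> borel_measurable borel" unfolding \<phi>_def by measurable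
  define K where "K = (c * c1)\<^sup>2 * (real ?n / 4 ^ ?n)"
  have K: "0 < K" using c c1 by (simp add: K_def)
  have "ennreal (sqrt K * cap_floor * sqrt p) \<le> bergman_norm TYPE('n) p" if p: "2 \<le> p" for p
  proof -
    have "Lp2_norm p \<phi> \<le> 1"
    proof -
      have "radial_sq \<phi> \<zeta> \<le> 1" if "norm \<zeta> = 1" for \<zeta>
      proof -
        have "radial_sq \<phi> \<zeta> = (\<integral>\<^sup>+ r. ennreal (c\<^sup>2) * (indicator region (r *\<^sub>R \<zeta>))\<^sup>2 \<partial>radial_measure ?n)"
          unfolding radial_sq_eq[OF \<open>\<phi> \<in> borel_measurable borel\<close>]
          using c by (intro nn_integral_cong) (auto simp: \<phi>_def f_def ennreal_power split: split_indicator)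
        also have "\<dots> = ennreal (c\<^sup>2) * (\<integral>\<^sup>+ r. (indicator region (r *\<^sub>R \<zeta>))\<^sup>2 \<partial>radial_measure ?n)"
          by (rule nn_integral_cmult) measurable
        also have "\<dots> \<le> ennreal (c\<^sup>2) * ennreal (32 * real ?n)"
          by (intro mult_left_mono region_section_measure_le that) auto
        also have "\<dots> = 1" using c by (simp flip: ennreal_mult)
        finally show ?thesis .
      qed
      then have "(\<integral>\<^sup>+ \<zeta>. epowr (radial_sq \<phi> \<zeta>) (p / 2) \<partial>sphere_measure) \<le> (\<integral>\<^sup>+ \<zeta>. epowr 1 (p / 2) \<partial>(sphere_measure :: (complex ^ 'n) measure))"
        using p by (intro nn_integral_mono_AE eventually_mono[OF AE_sphere] epowr_mono) auto
      also have "\<dots> = 1"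
        using prob_space.emeasure_space_1[OF prob_space_sphere_measure[where 'n='n]] by simp
      finally show ?thesis
        unfolding Lp2_norm_radial_sq using p epowr_mono[of "1 / p" _ 1] by simp
    qed
    then have "Fp2_norm p (bergman \<phi>) \<le> bergman_norm TYPE('n) p"
      by (intro bergman_norm_ge) measurable
    define T where "T z = (1 - (norm z)\<^sup>2) *\<^sub>R (bergman \<phi> z + radial_deriv (bergman \<phi>) z / of_nat ?n)" for z :: "complex ^ 'n"
    have T: "ennreal (c * c1) \<le> ennreal (cmod (T (r *\<^sub>R \<zeta>)))"
      if \<zeta>: "norm \<zeta> = 1" "\<zeta> \<in> small_cap p" and r: "r \<in> shell p" for r \<zeta>
    proof -
      note b = shell_bounds[OF r]
      have "ennreal (c * c1 / (1 - r)) = ennreal c * ennreal (c1 / (1 - r))"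
        using c c1 b p by (simp flip: ennreal_mult)
      also have "\<dots> \<le> ennreal c * (\<integral>\<^sup>+ w. indicator region w * ennreal (1 / 2 / (1 - r + depth w) ^ (?n + 2)) \<partial>borel_ball_measure)"
        using b p by (intro mult_left_mono J) auto
      also have "\<dots> = (\<integral>\<^sup>+ w. ennreal c * (indicator region w * ennreal (1 / 2 / (1 - r + depth w) ^ (?n + 2))) \<partial>borel_ball_measure)"
        by (rule nn_integral_cmult[symmetric]) measurable
      also have "\<dots> = (\<integral>\<^sup>+ w. ennreal (f w * (1 / 2 / (1 - r + depth w) ^ (?n + 2))) \<partial>borel_ball_measure)"
      proof (rule nn_integral_cong)
        fix w
        have "ennreal (c * (1 / 2 / (1 - r + depth w) ^ (?n + 2))) = ennreal c * ennreal (1 / 2 / (1 - r + depth w) ^ (?n + 2))"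
          using c by (intro ennreal_mult') simp
        then show "ennreal c * (indicator region w * ennreal (1 / 2 / (1 - r + depth w) ^ (?n + 2)))
          = ennreal (f w * (1 / 2 / (1 - r + depth w) ^ (?n + 2)))"
          unfolding f_def by (cases "w \<in> region") simp_all
      qed
      also have "\<dots> \<le> ennreal (cmod (bergman \<phi> (r *\<^sub>R \<zeta>) + radial_deriv (bergman \<phi>) (r *\<^sub>R \<zeta>) / of_nat ?n))"
        unfolding \<phi>_def
      proof (rule norm_radial_bergman_ge)
        show "0 \<le> f w" "f w \<le> c" for w using c by (auto simp: f_def split: split_indicator)
        fix w assume "f w \<noteq> 0"
        then have w: "w \<in> region" by (cases "w \<in> region") (simp_all add: f_def)
        then have "0 < depth w" by (simp add: region_def)
        then show "0 \<le> 1 / 2 / (1 - r + depth w) ^ (?n + 2)" using b p by simp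
        show "1 / 2 / (1 - r + depth w) ^ (?n + 2) \<le> Re (radial_bergman_kernel (r *\<^sub>R \<zeta>) w)"
          using p by (intro Re_kernel_ge_shell[OF w \<zeta> r]) simp
      qed (use \<zeta> b p in auto)
      finally have X: "c * c1 / (1 - r) \<le> cmod (bergman \<phi> (r *\<^sub>R \<zeta>) + radial_deriv (bergman \<phi>) (r *\<^sub>R \<zeta>) / of_nat ?n)"
        by simp
      have r1: "0 \<le> r" "r < 1" using b p by auto
      then have r2: "1 - r \<le> 1 - r\<^sup>2" by (simp add: power2_eq_square mult_left_le)
      have "c * c1 = (1 - r) * (c * c1 / (1 - r))" using r1 by simp
      also have "\<dots> \<le> (1 - r\<^sup>2) * cmod (bergman \<phi> (r *\<^sub>R \<zeta>) + radial_deriv (bergman \<phi>) (r *\<^sub>R \<zeta>) / of_nat ?n)"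
        using r1 r2 c c1 by (intro mult_mono X) auto
      also have "\<dots> = cmod (T (r *\<^sub>R \<zeta>))"
        using r1 r2 \<zeta> by (simp add: T_def abs_of_nonneg)
      finally show ?thesis by (rule ennreal_leI)
    qed
    (* the image is at least c c1 on a shell of radial measure of order p *)
    have sqT: "ennreal (K * p) \<le> radial_sq T \<zeta>" if \<zeta>: "norm \<zeta> = 1" "\<zeta> \<in> small_cap p" for \<zeta>
    proof -
      have "ennreal (K * p) = ennreal ((c * c1)\<^sup>2) * ennreal (real ?n / 4 ^ ?n * p)"
        using p by (simp add: K_def flip: ennreal_mult)
      also have "\<dots> \<le> ennreal ((c * c1)\<^sup>2) * emeasure (radial_measure ?n) (shell p)"
        using eps p by (intro mult_left_mono radial_measure_log_interval) auto
      also have "\<dots> = (\<integral>\<^sup>+ r. ennreal ((c * c1)\<^sup>2) * indicator (shell p) r \<partial>radial_measure ?n)"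
        by (rule nn_integral_cmult_indicator[symmetric]) simp
      also have "\<dots> = (\<integral>\<^sup>+ r. (ennreal (c * c1) * indicator (shell p) r)\<^sup>2 \<partial>radial_measure ?n)"
        using c c1 by (intro nn_integral_cong) (auto simp: ennreal_power split: split_indicator)
      also have "\<dots> \<le> radial_sq T \<zeta>"
        by (rule radial_sq_ge) (use T[OF \<zeta>] in \<open>auto split: split_indicator\<close>)
      finally show ?thesis .
    qed
    have "ennreal (sqrt K * cap_floor * sqrt p) \<le> ennreal ((K * p) powr (1 / 2) * ((aperture p / 8) ^ (2 * ?n)) powr (1 / p))"
      using K p cap_floor_le[of p] cap_floor_pos
      by (intro ennreal_leI) (auto simp: powr_half_sqrt real_sqrt_mult mult.commute intro!: mult_left_mono)
    also have "\<dots> = epowr (epowr (ennreal (K * p)) (p / 2) * ennreal ((aperture p / 8) ^ (2 * ?n))) (1 / p)"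
    proof -
      have nonneg: "0 \<le> K * p" "0 \<le> (aperture p / 8) ^ (2 * ?n)" using K p eps by auto
      have "ennreal ((K * p) powr (1 / 2) * ((aperture p / 8) ^ (2 * ?n)) powr (1 / p))
         = epowr (ennreal (K * p)) (1 / 2) * epowr (ennreal ((aperture p / 8) ^ (2 * ?n))) (1 / p)"
        unfolding epowr_ennreal[OF nonneg(1)] epowr_ennreal[OF nonneg(2)] by (rule ennreal_mult) simp_all
      also have "epowr (ennreal (K * p)) (1 / 2) = epowr (epowr (ennreal (K * p)) (p / 2)) (1 / p)"
        using p by (simp add: epowr_epowr)
      finally show ?thesis by (simp only: epowr_mult)
    qed
    also have "\<dots> \<le> epowr (epowr (ennreal (K * p)) (p / 2) * emeasure sphere_measure (small_cap p)) (1 / p)"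
      using p aperture_pos aperture_le_1[of p] by (intro epowr_mono mult_left_mono emeasure_sphere_cap_ge) auto
    also have "epowr (ennreal (K * p)) (p / 2) * emeasure sphere_measure (small_cap p)
       = (\<integral>\<^sup>+ \<zeta>. epowr (ennreal (K * p)) (p / 2) * indicator (small_cap p) \<zeta> \<partial>sphere_measure)"
      by (rule nn_integral_cmult_indicator[symmetric]) measurable
    also have "epowr \<dots> (1 / p) \<le> epowr (\<integral>\<^sup>+ \<zeta>. epowr (radial_sq T \<zeta>) (p / 2) \<partial>sphere_measure) (1 / p)"
      using p sqT by (intro epowr_mono nn_integral_mono_AE eventually_mono[OF AE_sphere]) (auto split: split_indicator intro!: epowr_mono)
    also have "\<dots> = Fp2_norm p (bergman \<phi>)"
      by (simp add: Fp2_norm_def Lp2_norm_radial_sq T_def[abs_def])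
    finally show ?thesis using \<open>Fp2_norm p (bergman \<phi>) \<le> bergman_norm TYPE('n) p\<close> by (rule order_trans)
  qed
  then show ?thesis using K cap_floor_pos by (intro exI[of _ "sqrt K * cap_floor"]) auto
qed

text \<open>The dual example: the test function is now the normalized indicator of the small cap times the
  shell with \<open>L = p'\<close>, and its image is paired with the indicator of the region, which has dual norm
  \<open>O(1)\<close>. By symmetry of the kernel the pairing is an integral over the cap times the shell, of size
  \<open>L s\<close> for a cap of measure \<open>s\<close>, while the norm of the indicator is of order \<open>\<surd>L\<close> times
  \<open>s powr (1 / p)\<close>. The quotient is \<open>\<surd>L\<close> times \<open>s powr (1 / p')\<close>, and the last factor is bounded
  below.\<close>

theorem bergman_norm_ge_sqrt_conj_exp:
  "\<exists>c>0. \<forall>p. 1 < p \<and> p \<le> 2 \<longrightarrow> ennreal (c * sqrt (conj_exp p)) \<le> bergman_norm TYPE('n) p"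
proof -
  let ?n = "CARD('n)"
  interpret B: prob_space "borel_ball_measure :: (complex ^ 'n) measure" by (rule prob_space_borel_ball_measure)
  interpret R: sigma_finite_measure "radial_measure ?n" by (rule sigma_finite_radial_measure)
  interpret BB: pair_sigma_finite "borel_ball_measure :: (complex ^ 'n) measure" "borel_ball_measure :: (complex ^ 'n) measure"
    by unfold_locales
  obtain c1 where c1: "0 < c1"
    and J: "\<And>t. 0 < t \<Longrightarrow> t \<le> \<delta>0 \<Longrightarrow>
      ennreal (c1 / t) \<le> (\<integral>\<^sup>+ w. indicator region w * ennreal (1 / 2 / (t + depth w) ^ (?n + 2)) \<partial>borel_ball_measure)"
    using region_integral_ge by blast
  define K where "K = c1 * (real ?n / 4 ^ ?n) / (sqrt (32 * real ?n) * sqrt (2 * real ?n))"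
  have K: "0 < K" using c1 by (simp add: K_def)
  have "ennreal (K * cap_floor * sqrt (conj_exp p)) \<le> bergman_norm TYPE('n) p" if p: "1 < p" "p \<le> 2" for p
  proof -
    define L where "L = conj_exp p"
    have L: "2 \<le> L" "1 - 1 / p = 1 / L" using p by (auto simp: L_def conj_exp_def field_simps)
    obtain s where s: "emeasure sphere_measure (small_cap L) = ennreal s" "0 \<le> s" by (rule small_cap_measure)
    have s_ge: "(aperture L / 8) ^ (2 * ?n) \<le> s"
      using emeasure_sphere_cap_ge[OF aperture_pos aperture_le_1[of L]] L s by simp
    have s_pos: "0 < s"
    proof -
      have "0 < (aperture L / 8) ^ (2 * ?n)" using aperture_pos[of L] by simp
      then show ?thesis using s_ge by linarith
    qed
    (* the reciprocal of a bound for the norm of the indicator of E *)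
    define c where "c = 1 / (sqrt (2 * real ?n * L) * s powr (1 / p))"
    have c: "0 < c" using L s_pos by (simp add: c_def)
    define E where "E = {z :: complex ^ 'n. sgn z \<in> small_cap L \<and> norm z \<in> shell L}"
    have [measurable]: "E \<in> sets borel" unfolding E_def by measurable
    define f where "f z = c * indicator E z" for z :: "complex ^ 'n"
    have [measurable]: "f \<in> borel_measurable borel" unfolding f_def by measurable
    have f: "0 \<le> f z" "f z \<le> c" for z using c by (auto simp: f_def split: split_indicator)
    define \<psi> where "\<psi> z = complex_of_real (f z)" for z
    have [measurable]: "\<psi> \<in> borel_measurable borel" unfolding \<psi>_def by measurable
    have indE: "(indicator E (r *\<^sub>R \<zeta>) :: ennreal) = indicator (small_cap L) \<zeta> * indicator (shell L) r"
      if "norm \<zeta> = 1" "0 \<le> r" for r and \<zeta> :: "complex ^ 'n"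
    proof (cases "r = 0")
      case True
      have "(0 :: real) \<notin> shell L" using shell_bounds(2)[of 0 L] L by auto
      then show ?thesis using True by (auto simp: E_def)
    next
      case False
      then show ?thesis using that by (auto simp: E_def sgn_scaleR sgn_div_norm split: split_indicator)
    qed
    have "Lp2_norm p \<psi> \<le> 1"
    proof -
      have sq\<psi>: "radial_sq \<psi> \<zeta> \<le> ennreal (c\<^sup>2 * (2 * real ?n * L)) * indicator (small_cap L) \<zeta>" if \<zeta>: "norm \<zeta> = 1" for \<zeta>
      proof -
        have "radial_sq \<psi> \<zeta> = (\<integral>\<^sup>+ r. ennreal (c\<^sup>2) * indicator (small_cap L) \<zeta> * indicator (shell L) r \<partial>radial_measure ?n)"
          unfolding radial_sq_eq[OF \<open>\<psi> \<in> borel_measurable borel\<close>]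
        proof (rule nn_integral_cong_AE, rule eventually_mono[OF AE_radial_measure])
          fix r :: real assume r: "0 \<le> r \<and> r < 1"
          have "(ennreal (cmod (\<psi> (r *\<^sub>R \<zeta>))))\<^sup>2 = ennreal (c\<^sup>2) * indicator E (r *\<^sub>R \<zeta>)"
            using c by (auto simp: \<psi>_def f_def ennreal_power split: split_indicator)
          then show "(ennreal (cmod (\<psi> (r *\<^sub>R \<zeta>))))\<^sup>2 = ennreal (c\<^sup>2) * indicator (small_cap L) \<zeta> * indicator (shell L) r"
            using indE[OF \<zeta>] r by (simp add: mult.assoc)
        qed
        also have "\<dots> = ennreal (c\<^sup>2) * indicator (small_cap L) \<zeta> * emeasure (radial_measure ?n) (shell L)"
          by (rule nn_integral_cmult_indicator) simp
        also have "\<dots> \<le> ennreal (c\<^sup>2) * indicator (small_cap L) \<zeta> * ennreal (2 * real ?n * L)"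
          using eps L by (intro mult_left_mono radial_measure_log_interval) auto
        also have "\<dots> = ennreal (c\<^sup>2 * (2 * real ?n * L)) * indicator (small_cap L) \<zeta>"
          using L by (subst ennreal_mult) (auto simp: mult_ac)
        finally show ?thesis .
      qed
      have "(\<integral>\<^sup>+ \<zeta>. epowr (radial_sq \<psi> \<zeta>) (p / 2) \<partial>sphere_measure)
         \<le> (\<integral>\<^sup>+ \<zeta>. epowr (ennreal (c\<^sup>2 * (2 * real ?n * L))) (p / 2) * indicator (small_cap L) \<zeta> \<partial>sphere_measure)"
      proof (rule nn_integral_mono_AE, rule eventually_mono[OF AE_sphere])
        fix \<zeta> :: "complex ^ 'n" assume "norm \<zeta> = 1"
        then have "epowr (radial_sq \<psi> \<zeta>) (p / 2) \<le> epowr (ennreal (c\<^sup>2 * (2 * real ?n * L)) * indicator (small_cap L) \<zeta>) (p / 2)"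
          using p by (intro epowr_mono sq\<psi>) auto
        also have "\<dots> = epowr (ennreal (c\<^sup>2 * (2 * real ?n * L))) (p / 2) * indicator (small_cap L) \<zeta>"
          by (simp split: split_indicator)
        finally show "epowr (radial_sq \<psi> \<zeta>) (p / 2) \<le> epowr (ennreal (c\<^sup>2 * (2 * real ?n * L))) (p / 2) * indicator (small_cap L) \<zeta>" .
      qed
      also have "\<dots> = epowr (ennreal (c\<^sup>2 * (2 * real ?n * L))) (p / 2) * ennreal s"
        unfolding s(1)[symmetric] by (rule nn_integral_cmult_indicator) measurable
      finally have "Lp2_norm p \<psi> \<le> epowr (epowr (ennreal (c\<^sup>2 * (2 * real ?n * L))) (p / 2) * ennreal s) (1 / p)"
        unfolding Lp2_norm_radial_sq using p by (intro epowr_mono) auto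
      also have "\<dots> = ennreal ((c\<^sup>2 * (2 * real ?n * L)) powr (1 / 2)) * ennreal (s powr (1 / p))"
      proof -
        have nonneg: "0 \<le> c\<^sup>2 * (2 * real ?n * L)" using L by simp
        have "epowr (epowr (ennreal (c\<^sup>2 * (2 * real ?n * L))) (p / 2)) (1 / p) = epowr (ennreal (c\<^sup>2 * (2 * real ?n * L))) (1 / 2)"
          using p by (simp add: epowr_epowr)
        then show ?thesis
          by (simp only: epowr_mult epowr_ennreal[OF nonneg] epowr_ennreal[OF s(2)])
      qed
      also have "\<dots> = ennreal ((c\<^sup>2 * (2 * real ?n * L)) powr (1 / 2) * s powr (1 / p))"
        by (rule ennreal_mult[symmetric]) auto
      also have "(c\<^sup>2 * (2 * real ?n * L)) powr (1 / 2) = c * sqrt (2 * real ?n * L)"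
        using c L by (simp add: powr_half_sqrt real_sqrt_mult)
      also have "c * sqrt (2 * real ?n * L) * s powr (1 / p) = 1"
        using L s_pos by (simp add: c_def)
      finally show ?thesis by simp
    qed
    then have NY: "Fp2_norm p (bergman \<psi>) \<le> bergman_norm TYPE('n) p"
      by (intro bergman_norm_ge) measurable
    define T where "T z = (1 - (norm z)\<^sup>2) *\<^sub>R (bergman \<psi> z + radial_deriv (bergman \<psi>) z / of_nat ?n)" for z :: "complex ^ 'n"
    (* a minorant of f(z) times the real part of the kernel, for w in the region *)
    define k where "k z w = f z * (1 / 2 / (1 - norm z + depth w) ^ (?n + 2))" for z w :: "complex ^ 'n"
    have [measurable]: "(\<lambda>(z, w). k z w) \<in> borel_measurable (borel \<Otimes>\<^sub>M borel)" unfolding k_def by measurable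
    define H where "H w = (\<integral>\<^sup>+ z. ennreal (k z w) \<partial>borel_ball_measure)" for w
    have [measurable]: "H \<in> borel_measurable borel" unfolding H_def by measurable
    define F where "F w = ennreal (1 - (norm w)\<^sup>2) * H w * indicator region w" for w :: "complex ^ 'n"
    have [measurable]: "F \<in> borel_measurable borel" unfolding F_def by measurable
    have F_le: "F w \<le> ennreal (cmod (T w))" if "norm w < 1" for w
    proof (cases "w \<in> region")
      case True
      have "H w \<le> ennreal (cmod (bergman \<psi> w + radial_deriv (bergman \<psi>) w / of_nat ?n))"
        unfolding H_def k_def \<psi>_def
      proof (rule norm_radial_bergman_ge)
        show "0 \<le> f z" "f z \<le> c" for z by (rule f)+
        fix z assume "norm z < 1" "f z \<noteq> 0"
        then have z: "sgn z \<in> small_cap L" "norm z \<in> shell L" by (auto simp: f_def E_def split: split_indicator_asm)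
        have "0 < depth w" using True by (simp add: region_def)
        then show "0 \<le> 1 / 2 / (1 - norm z + depth w) ^ (?n + 2)" using \<open>norm z < 1\<close> by simp
        have "0 < norm z" using shell_bounds(2)[OF z(2)] L by simp
        then have "norm (sgn z) = 1" "norm z *\<^sub>R sgn z = z" by (auto simp: norm_sgn sgn_div_norm)
        then have "1 / 2 / (1 - norm z + depth w) ^ (?n + 2) \<le> Re (radial_bergman_kernel z w)"
          using Re_kernel_ge_shell[OF True _ z(1) z(2)] L by simp
        then show "1 / 2 / (1 - norm z + depth w) ^ (?n + 2) \<le> Re (radial_bergman_kernel w z)"
          by (simp add: radial_bergman_kernel_cnj[of w z])
      qed (use that in auto)
      then have "ennreal (1 - (norm w)\<^sup>2) * H w \<le> ennreal (1 - (norm w)\<^sup>2) * ennreal (cmod (bergman \<psi> w + radial_deriv (bergman \<psi>) w / of_nat ?n))"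
        by (rule mult_left_mono) simp
      also have "\<dots> = ennreal (cmod (T w))"
        using that by (simp add: T_def abs_square_less_1 abs_of_nonneg less_imp_le flip: ennreal_mult)
      finally show ?thesis using True by (simp add: F_def)
    qed (simp add: F_def)
    (* by Fubini the pairing is the integral of f(z) / (1 - norm z) up to constants, that is, of c against
       the product of the surface and radial measures over the cap times the shell *)
    have pairing: "ennreal (c * c1 * s * (real ?n / 4 ^ ?n * L))
       \<le> (\<integral>\<^sup>+ \<zeta>. \<integral>\<^sup>+ r. F (r *\<^sub>R \<zeta>) * indicator region (r *\<^sub>R \<zeta>) \<partial>radial_measure ?n \<partial>sphere_measure)"
    proof -
      have "ennreal (c * c1 * s * (real ?n / 4 ^ ?n * L)) = ennreal (c * c1) * (ennreal (real ?n / 4 ^ ?n * L) * ennreal s)"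
        using c c1 s L by (simp add: mult_ac flip: ennreal_mult)
      also have "\<dots> \<le> ennreal (c * c1) * (emeasure (radial_measure ?n) (shell L) * ennreal s)"
        using eps L by (intro mult_left_mono mult_right_mono radial_measure_log_interval) auto
      also have "emeasure (radial_measure ?n) (shell L) * ennreal s = (\<integral>\<^sup>+ \<zeta>. emeasure (radial_measure ?n) (shell L) * indicator (small_cap L) \<zeta> \<partial>sphere_measure)"
        unfolding s(1)[symmetric] by (rule nn_integral_cmult_indicator[symmetric]) measurable
      also have "\<dots> = (\<integral>\<^sup>+ \<zeta>. \<integral>\<^sup>+ r. indicator (small_cap L) \<zeta> * indicator (shell L) r \<partial>radial_measure ?n \<partial>sphere_measure)"
        by (intro nn_integral_cong) (subst nn_integral_cmult_indicator, auto simp: mult.commute)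
      also have "ennreal (c * c1) * \<dots> = (\<integral>\<^sup>+ \<zeta>. \<integral>\<^sup>+ r. ennreal (c * c1) * (indicator (small_cap L) \<zeta> * indicator (shell L) r) \<partial>radial_measure ?n \<partial>sphere_measure)"
        by (subst nn_integral_cmult[symmetric], measurable) (intro nn_integral_cong nn_integral_cmult[symmetric], measurable)
      also have "\<dots> \<le> (\<integral>\<^sup>+ \<zeta>. \<integral>\<^sup>+ r. ennreal (1 - r\<^sup>2) * ennreal (f (r *\<^sub>R \<zeta>) * (c1 / (1 - norm (r *\<^sub>R \<zeta>)))) \<partial>radial_measure ?n \<partial>sphere_measure)"
      proof (rule nn_integral_mono_AE, rule eventually_mono[OF AE_sphere], rule nn_integral_mono_AE, rule eventually_mono[OF AE_radial_measure])
        fix \<zeta> :: "complex ^ 'n" and r :: real assume \<zeta>: "norm \<zeta> = 1" and r: "0 \<le> r \<and> r < 1"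
        show "ennreal (c * c1) * (indicator (small_cap L) \<zeta> * indicator (shell L) r)
          \<le> ennreal (1 - r\<^sup>2) * ennreal (f (r *\<^sub>R \<zeta>) * (c1 / (1 - norm (r *\<^sub>R \<zeta>))))"
        proof (cases "r *\<^sub>R \<zeta> \<in> E")
          case True
          have "r\<^sup>2 \<le> r" using r by (simp add: power2_eq_square mult_left_le)
          have "c * c1 = (1 - r) * (c * (c1 / (1 - r)))" using r by simp
          also have "\<dots> \<le> (1 - r\<^sup>2) * (c * (c1 / (1 - r)))"
            using r c c1 \<open>r\<^sup>2 \<le> r\<close> by (intro mult_right_mono) auto
          finally have "ennreal (c * c1) \<le> ennreal ((1 - r\<^sup>2) * (c * (c1 / (1 - r))))" by (rule ennreal_leI)
          also have "\<dots> = ennreal (1 - r\<^sup>2) * ennreal (c * (c1 / (1 - r)))"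
            using r c c1 \<open>r\<^sup>2 \<le> r\<close> by (intro ennreal_mult) auto
          finally show ?thesis using True \<zeta> r indE[OF \<zeta>, of r] by (simp add: f_def)
        next
          case False
          then have "indicator (small_cap L) \<zeta> * indicator (shell L) r = (0 :: ennreal)"
            using indE[OF \<zeta>, of r] r by (metis indicator_simps(2))
          then show ?thesis by (simp only: mult_zero_right zero_le)
        qed
      qed
      also have "\<dots> = (\<integral>\<^sup>+ z. ennreal (f z * (c1 / (1 - norm z))) \<partial>borel_ball_measure)"
        by (rule polar_integral[symmetric]) measurable
      also have "\<dots> \<le> (\<integral>\<^sup>+ z. \<integral>\<^sup>+ w. ennreal (k z w) * indicator region w \<partial>borel_ball_measure \<partial>borel_ball_measure)"
      proof (rule nn_integral_mono)
        fix z :: "complex ^ 'n"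
        show "ennreal (f z * (c1 / (1 - norm z))) \<le> (\<integral>\<^sup>+ w. ennreal (k z w) * indicator region w \<partial>borel_ball_measure)"
        proof (cases "z \<in> E")
          case True
          then have z: "norm z \<in> shell L" by (simp add: E_def)
          note b = shell_bounds[OF z]
          have "ennreal (f z * (c1 / (1 - norm z))) = ennreal (f z) * ennreal (c1 / (1 - norm z))"
            using f by (intro ennreal_mult') auto
          also have "\<dots> \<le> ennreal (f z) * (\<integral>\<^sup>+ w. indicator region w * ennreal (1 / 2 / (1 - norm z + depth w) ^ (?n + 2)) \<partial>borel_ball_measure)"
            using b L by (intro mult_left_mono J) auto
          also have "\<dots> = (\<integral>\<^sup>+ w. ennreal (f z) * (indicator region w * ennreal (1 / 2 / (1 - norm z + depth w) ^ (?n + 2))) \<partial>borel_ball_measure)"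
            by (rule nn_integral_cmult[symmetric]) measurable
          also have "\<dots> = (\<integral>\<^sup>+ w. ennreal (k z w) * indicator region w \<partial>borel_ball_measure)"
            unfolding k_def ennreal_mult'[OF f(1)] by (simp only: mult_ac)
          finally show ?thesis .
        qed (simp add: f_def)
      qed
      also have "\<dots> = (\<integral>\<^sup>+ w. \<integral>\<^sup>+ z. ennreal (k z w) * indicator region w \<partial>borel_ball_measure \<partial>borel_ball_measure)"
        by (rule BB.Fubini') measurable
      also have "\<dots> = (\<integral>\<^sup>+ w. H w * indicator region w \<partial>borel_ball_measure)"
        unfolding H_def by (intro nn_integral_cong nn_integral_multc) measurable
      also have "\<dots> = (\<integral>\<^sup>+ \<zeta>. \<integral>\<^sup>+ r. ennreal (1 - r\<^sup>2) * (H (r *\<^sub>R \<zeta>) * indicator region (r *\<^sub>R \<zeta>)) \<partial>radial_measure ?n \<partial>sphere_measure)"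
        by (rule polar_integral) measurable
      also have "\<dots> = (\<integral>\<^sup>+ \<zeta>. \<integral>\<^sup>+ r. F (r *\<^sub>R \<zeta>) * indicator region (r *\<^sub>R \<zeta>) \<partial>radial_measure ?n \<partial>sphere_measure)"
        by (rule nn_integral_cong_AE, rule eventually_mono[OF AE_sphere], rule nn_integral_cong)
           (auto simp: F_def mult.assoc split: split_indicator)
      finally show ?thesis .
    qed
    have "ennreal (c * c1 * s * (real ?n / 4 ^ ?n * L))
       \<le> epowr (ennreal (32 * real ?n)) (1 / 2) * epowr (\<integral>\<^sup>+ \<zeta>. epowr (\<integral>\<^sup>+ r. (F (r *\<^sub>R \<zeta>))\<^sup>2 \<partial>radial_measure ?n) (p / 2) \<partial>sphere_measure) (1 / p)"
      by (rule order_trans[OF pairing nn_integral_product_le]) (use p region_section_measure_le in auto)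
    also have "\<dots> \<le> epowr (ennreal (32 * real ?n)) (1 / 2) * epowr (\<integral>\<^sup>+ \<zeta>. epowr (radial_sq T \<zeta>) (p / 2) \<partial>sphere_measure) (1 / p)"
    proof (intro mult_left_mono epowr_mono nn_integral_mono_AE eventually_mono[OF AE_sphere])
      fix \<zeta> :: "complex ^ 'n" assume "norm \<zeta> = 1"
      then show "(\<integral>\<^sup>+ r. (F (r *\<^sub>R \<zeta>))\<^sup>2 \<partial>radial_measure ?n) \<le> radial_sq T \<zeta>"
        by (intro radial_sq_ge F_le) auto
    qed (use p in auto)
    also have "\<dots> = ennreal (sqrt (32 * real ?n)) * Fp2_norm p (bergman \<psi>)"
      by (simp add: Fp2_norm_def Lp2_norm_radial_sq T_def[abs_def] epowr_ennreal powr_half_sqrt)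
    finally have "ennreal (1 / sqrt (32 * real ?n)) * ennreal (c * c1 * s * (real ?n / 4 ^ ?n * L))
       \<le> ennreal (1 / sqrt (32 * real ?n)) * (ennreal (sqrt (32 * real ?n)) * Fp2_norm p (bergman \<psi>))"
      by (rule mult_left_mono) simp
    also have "\<dots> = Fp2_norm p (bergman \<psi>)"
      by (simp flip: mult.assoc ennreal_mult)
    also have "ennreal (1 / sqrt (32 * real ?n)) * ennreal (c * c1 * s * (real ?n / 4 ^ ?n * L))
       = ennreal (1 / sqrt (32 * real ?n) * (c * c1 * s * (real ?n / 4 ^ ?n * L)))"
      using c c1 s L by (intro ennreal_mult[symmetric]) auto
    also have "1 / sqrt (32 * real ?n) * (c * c1 * s * (real ?n / 4 ^ ?n * L)) = K * s powr (1 / L) * sqrt L"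
    proof -
      have sL: "L = sqrt L * sqrt L" using L by simp
      (* L is the conjugate exponent of p *)
      have ss: "s = s powr (1 / L) * s powr (1 / p)"
      proof -
        have "s powr (1 / L) * s powr (1 / p) = s powr (1 / L + 1 / p)" by (rule powr_add[symmetric])
        also have "1 / L + 1 / p = 1" using L by simp
        finally show ?thesis using s_pos by simp
      qed
      have "1 / sqrt (32 * real ?n) * (c * c1 * s * (real ?n / 4 ^ ?n * L))
        = (c1 * (real ?n / 4 ^ ?n) / sqrt (32 * real ?n)) * ((s * L) * c)" by (simp add: mult_ac)
      also have "(s * L) * c = s powr (1 / L) * sqrt L / sqrt (2 * real ?n)"
      proof -
        have "(s * L) * c = (s powr (1 / L) * s powr (1 / p)) * (sqrt L * sqrt L) / (sqrt (2 * real ?n) * sqrt L * s powr (1 / p))"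
          unfolding c_def real_sqrt_mult[of "2 * real ?n" L] ss[symmetric] sL[symmetric] by simp
        also have "\<dots> = s powr (1 / L) * sqrt L / sqrt (2 * real ?n)"
        proof -
          have cancel: "x * y * (l * l) / (m * l * y) = x * l / m" if "l \<noteq> 0" "y \<noteq> 0" for x y l m :: real
            using that by simp
          show ?thesis by (rule cancel) (use L s_pos in auto)
        qed
        finally show ?thesis .
      qed
      finally show ?thesis by (simp add: K_def mult_ac)
    qed
    finally have "ennreal (K * s powr (1 / L) * sqrt L) \<le> bergman_norm TYPE('n) p" using NY by (rule order_trans)
    moreover have "K * cap_floor * sqrt (conj_exp p) \<le> K * s powr (1 / L) * sqrt L"
    proof -
      have "cap_floor \<le> ((aperture L / 8) ^ (2 * ?n)) powr (1 / L)" using L by (intro cap_floor_le) simp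
      also have "\<dots> \<le> s powr (1 / L)" using s_ge L eps by (intro powr_mono2) auto
      finally show ?thesis unfolding L_def[symmetric] using K L by (intro mult_right_mono mult_left_mono) auto
    qed
    ultimately show ?thesis using ennreal_leI order_trans by blast
  qed
  then show ?thesis using K cap_floor_pos by (intro exI[of _ "K * cap_floor"]) auto
qed

end

lemma ex_test_region: "\<exists>\<epsilon>. test_region TYPE('n::finite) \<epsilon>"
proof -
  obtain m where m: "CARD('n) = Suc m" using zero_less_card_finite[where 'a='n] by (cases "CARD('n)") auto
  show ?thesis using ex_perturbation_bound[of m] unfolding test_region_def m by blast
qed

text \<open>For large \<open>x\<close> the conjugate exponent is at most \<open>2\<close>, and \<open>\<surd>x\<close> outgrows every smaller power.\<close>

lemma sqrt_not_dominated:
  assumes \<alpha>: "\<alpha> < 1 / 2" and c: "0 < c"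
    and le: "\<And>x. 2 \<le> x \<Longrightarrow> ennreal (c * sqrt x) \<le> ennreal (C * max (x powr \<alpha>) (sqrt (conj_exp x)))"
  shows False
proof -
  define \<beta> where "\<beta> = max \<alpha> 0"
  define \<gamma> where "\<gamma> = 1 / 2 - \<beta>"
  have \<gamma>: "0 < \<gamma>" using \<alpha> by (simp add: \<gamma>_def \<beta>_def)
  define M where "M = 2 * \<bar>C\<bar> / c + 1"
  have M: "0 < M" using c by (simp add: M_def add_nonneg_pos)
  define x where "x = max 2 (M powr (1 / \<gamma>))"
  have x: "2 \<le> x" by (simp add: x_def)
  have "M = (M powr (1 / \<gamma>)) powr \<gamma>" using M \<gamma> by (simp add: powr_powr)
  also have "\<dots> \<le> x powr \<gamma>" using \<gamma> by (intro powr_mono2) (auto simp: x_def)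
  finally have Mx: "M \<le> x powr \<gamma>" .
  have "conj_exp x \<le> 2" using x by (simp add: conj_exp_def field_simps)
  then have "sqrt (conj_exp x) \<le> sqrt 4" by (intro real_sqrt_le_mono) simp
  then have "sqrt (conj_exp x) \<le> 2" by simp
  moreover have "1 \<le> x powr \<beta>" using x by (intro ge_one_powr_ge_zero) (auto simp: \<beta>_def)
  moreover have "x powr \<alpha> \<le> x powr \<beta>" using x by (intro powr_mono) (auto simp: \<beta>_def)
  ultimately have m: "max (x powr \<alpha>) (sqrt (conj_exp x)) \<le> 2 * x powr \<beta>" "0 \<le> max (x powr \<alpha>) (sqrt (conj_exp x))"
    by (auto simp: le_max_iff_disj)
  have pos: "0 < c * sqrt x" using c x by simp
  have "c * sqrt x \<le> C * max (x powr \<alpha>) (sqrt (conj_exp x))"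
    using le[OF x] pos by (subst (asm) ennreal_le_iff2) auto
  also have "\<dots> \<le> \<bar>C\<bar> * (2 * x powr \<beta>)"
    using m by (intro mult_mono) auto
  finally have "c * x powr (\<beta> + \<gamma>) \<le> 2 * \<bar>C\<bar> * x powr \<beta>"
    using x by (simp add: \<gamma>_def powr_half_sqrt)
  then have "x powr \<beta> * (c * x powr \<gamma>) \<le> x powr \<beta> * (2 * \<bar>C\<bar>)" by (simp add: powr_add mult_ac)
  then have "c * x powr \<gamma> \<le> 2 * \<bar>C\<bar>" using x by (simp add: mult_le_cancel_left_pos)
  moreover have "c * M \<le> c * x powr \<gamma>" using Mx c by (intro mult_left_mono) auto
  moreover have "c * M = 2 * \<bar>C\<bar> + c" using c by (simp add: M_def field_simps)
  ultimately show False using c by linarith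
qed

theorem theorem1p5:
  shows "(\<exists>C::real. \<forall>p::real. 1 < p \<longrightarrow>
            (\<forall>\<phi>\<in>(Lp2 p :: (complex ^ 'n \<Rightarrow> complex) set).
               (\<forall>z\<in>ball 0 1. integrable ball_measure (bergman_integrand \<phi> z))
               \<and> bergman \<phi> \<in> Fp2 p)
            \<and> bergman_norm TYPE('n) p \<le> ennreal (C * max (sqrt p) (sqrt (conj_exp p))))
       \<and> (\<forall>\<alpha>::real. \<alpha> < 1/2 \<longrightarrow>
            \<not> (\<exists>C::real. \<forall>p::real. 1 < p \<longrightarrow>
                 bergman_norm TYPE('n) p \<le> ennreal (C * max (p powr \<alpha>) (sqrt (conj_exp p)))))
       \<and> (\<forall>\<alpha>::real. \<alpha> < 1/2 \<longrightarrow>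
            \<not> (\<exists>C::real. \<forall>p::real. 1 < p \<longrightarrow>
                 bergman_norm TYPE('n) p \<le> ennreal (C * max (sqrt p) (conj_exp p powr \<alpha>))))"
proof (intro conjI allI impI)
  let ?C = "2 * bound_const TYPE('n)"
  show "\<exists>C::real. \<forall>p::real. 1 < p \<longrightarrow>
            (\<forall>\<phi>\<in>(Lp2 p :: (complex ^ 'n \<Rightarrow> complex) set).
               (\<forall>z\<in>ball 0 1. integrable ball_measure (bergman_integrand \<phi> z))
               \<and> bergman \<phi> \<in> Fp2 p)
            \<and> bergman_norm TYPE('n) p \<le> ennreal (C * max (sqrt p) (sqrt (conj_exp p)))"
  proof (rule exI[of _ ?C], intro allI impI conjI ballI)
    fix p :: real and \<phi> :: "complex ^ 'n \<Rightarrow> complex" and z :: "complex ^ 'n"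
    assume p: "1 < p" and \<phi>: "\<phi> \<in> Lp2 p"
    interpret integrable_on_ball \<phi> by unfold_locales (rule Fp2_norm_bergman_le(1)[OF p \<phi>])
    show "integrable ball_measure (bergman_integrand \<phi> z)" if "z \<in> ball 0 1"
      using that by (intro integrable_bergman_integrand) simp
    have "ennreal (?C * max (sqrt p) (sqrt (conj_exp p))) * Lp2_norm p \<phi> < \<infinity>"
      using \<phi> by (simp add: Lp2_def ennreal_mult_less_top)
    then have "Fp2_norm p (bergman \<phi>) < \<infinity>"
      using Fp2_norm_bergman_le(2)[OF p \<phi>] by (rule le_less_trans[rotated])
    then show "bergman \<phi> \<in> Fp2 p" using holomorphic_bergman by (simp add: Fp2_def)
  next
    fix p :: real assume p: "1 < p"
    show "bergman_norm TYPE('n) p \<le> ennreal (?C * max (sqrt p) (sqrt (conj_exp p)))"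
      unfolding bergman_norm_def operator_norm_def
    proof (rule SUP_least, clarify)
      fix \<phi> :: "complex ^ 'n \<Rightarrow> complex" assume \<phi>: "\<phi> \<in> Lp2 p" "Lp2_norm p \<phi> \<le> 1"
      have "ennreal (?C * max (sqrt p) (sqrt (conj_exp p))) * Lp2_norm p \<phi> \<le> ennreal (?C * max (sqrt p) (sqrt (conj_exp p))) * 1"
        using \<phi>(2) by (rule mult_left_mono) simp
      then show "Fp2_norm p (bergman \<phi>) \<le> ennreal (?C * max (sqrt p) (sqrt (conj_exp p)))"
        using Fp2_norm_bergman_le(2)[OF p \<phi>(1)] by simp
    qed
  qed
next
  obtain \<epsilon> where "test_region TYPE('n) \<epsilon>" using ex_test_region by blast
  then interpret test_region "undefined :: 'n" \<epsilon> .
  fix \<alpha> :: real assume \<alpha>: "\<alpha> < 1 / 2"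
  show "\<not> (\<exists>C::real. \<forall>p::real. 1 < p \<longrightarrow>
      bergman_norm TYPE('n) p \<le> ennreal (C * max (p powr \<alpha>) (sqrt (conj_exp p))))"
  proof
    assume "\<exists>C::real. \<forall>p::real. 1 < p \<longrightarrow>
      bergman_norm TYPE('n) p \<le> ennreal (C * max (p powr \<alpha>) (sqrt (conj_exp p)))"
    then obtain C where C: "\<And>p. 1 < p \<Longrightarrow> bergman_norm TYPE('n) p \<le> ennreal (C * max (p powr \<alpha>) (sqrt (conj_exp p)))"
      by blast
    obtain c where c: "0 < c" "\<And>p. 2 \<le> p \<Longrightarrow> ennreal (c * sqrt p) \<le> bergman_norm TYPE('n) p"
      using bergman_norm_ge_sqrt by blast
    show False
      by (rule sqrt_not_dominated[OF \<alpha> c(1)], rule order_trans[OF c(2) C]) auto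
  qed
  show "\<not> (\<exists>C::real. \<forall>p::real. 1 < p \<longrightarrow>
      bergman_norm TYPE('n) p \<le> ennreal (C * max (sqrt p) (conj_exp p powr \<alpha>)))"
  proof
    assume "\<exists>C::real. \<forall>p::real. 1 < p \<longrightarrow>
      bergman_norm TYPE('n) p \<le> ennreal (C * max (sqrt p) (conj_exp p powr \<alpha>))"
    then obtain C where C: "\<And>p. 1 < p \<Longrightarrow> bergman_norm TYPE('n) p \<le> ennreal (C * max (sqrt p) (conj_exp p powr \<alpha>))"
      by blast
    obtain c where c: "0 < c" "\<And>p. 1 < p \<and> p \<le> 2 \<Longrightarrow> ennreal (c * sqrt (conj_exp p)) \<le> bergman_norm TYPE('n) p"
      using bergman_norm_ge_sqrt_conj_exp by blast
    show False
    proof (rule sqrt_not_dominated[OF \<alpha> c(1)])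
      fix x :: real assume x: "2 \<le> x"
      have q: "1 < conj_exp x" "conj_exp x \<le> 2" "conj_exp (conj_exp x) = x"
        using x by (auto simp: conj_exp_def field_simps)
      show "ennreal (c * sqrt x) \<le> ennreal (C * max (x powr \<alpha>) (sqrt (conj_exp x)))"
        using order_trans[OF c(2) C, of "conj_exp x"] q by (simp add: max.commute)
    qed
  qed
qed

end
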